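(* Let $q=pn$ where $p,n$ are integers with $p,|n|>1$. The automorphism group $\mathrm{Aut}(BS(p,q))$ is generated by the automorphisms $c_x,c_t,\psi,\iota$ and $\phi_k$ for $k\ge1$, subject to the following (defining) relations: $$c_tc_x^pc_t^{-1}=c_x^q,\qquad \iota^{-1}=\iota,\qquad \iota c_x\iota=c_x^{-1},\qquad \iota c_t\iota=c_t,$$ $$\iota\psi\iota=\psi^{-1},\qquad \iota\phi_k\iota=\phi_k^{-1}\ (k\ge1),\qquad \psi^p=\phi_1^n,\qquad \psi^{p(n-1)}=c_x^{-p},$$ $$\psi c_x\psi^{-1}=c_x,\qquad \psi c_t\psi^{-1}=c_xc_t,\qquad \phi_kc_x\phi_k^{-1}=c_x\ (k\ge1),$$ $$\phi_kc_t\phi_k^{-1}=c_t^{-k}c_x^pc_t^{k+1}\ (k\ge1),\qquad \phi_{k+1}^n=\phi_k\ (k\ge1).$$ The outer automorphism group has presentation $$\mathrm{Out}(BS(p,q))=\Bigl(\mathbb{Z}_{p|n-1|} *_{\mathbb{Z}_{|n-1|}} \mathbb{Z}\bigl[\tfrac{1}{|n|}\bigr]/|n(n-1)|\mathbb{Z}\Bigr)\rtimes\mathbb{Z}_2,$$ generated by the images of $\psi,\iota$ and $\phi_k$ for $k\ge1$.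
   Context: $BS(p,q)=\langle x,t\mid tx^pt^{-1}=x^q\rangle$. For $g\in BS(p,q)$, $c_g$ is the inner automorphism $g'\mapsto gg'g^{-1}$. The other automorphisms are defined on the generators by $$\psi:\ x\mapsto x,\ t\mapsto xt;\qquad \iota:\ x\mapsto x^{-1},\ t\mapsto t;\qquad \phi_k:\ x\mapsto x,\ t\mapsto (t^{-k}x^pt^k)t\quad(k\ge1).$$ Automorphisms are composed as functions (right to left). $\mathbb{Z}_m$ denotes the cyclic group of order $m$; $\mathbb{Z}[\frac1{|n|}]/|n(n-1)|\mathbb{Z}$ is the quotient of additive groups; $A*_CB$ denotes amalgamated free product. In the description of $\mathrm{Out}(BS(p,q))$: the factor $\mathbb{Z}_{p|n-1|}$ is generated by the image of $\psi$; the factor $\mathbb{Z}[\frac1{|n|}]/|n(n-1)|\mathbb{Z}$ is generated by the images of the $\phi_k$, with $1$ corresponding to the image of $\phi_1$ (and $\phi_{k+1}^n=\phi_k$); the amalgamation identifies $\psi^p$ with $\phi_1^n$; and $\mathbb{Z}_2$ is generated by the image of $\iota$, acting by inversion on each of the two factors. *)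

theory Defs
  imports "HOL-Algebra.Algebra"
begin

section \<open>Group presentations\<close>

text \<open>A word is a list of letters; the letter \<open>(a, True)\<close> stands for the generator \<open>a\<close> and
  \<open>(a, False)\<close> for its formal inverse.\<close>

type_synonym 'a word = "('a \<times> bool) list"

definition letter :: "'a \<Rightarrow> 'a word" where
  "letter a = [(a, True)]"

definition word_inv :: "'a word \<Rightarrow> 'a word" where
  "word_inv w = rev (map (\<lambda>(a, b). (a, \<not> b)) w)"

definition word_pow :: "'a word \<Rightarrow> int \<Rightarrow> 'a word" where
  "word_pow w k =
     (if 0 \<le> k then concat (replicate (nat k) w)
      else concat (replicate (nat (- k)) (word_inv w)))"

text \<open>Defining relations are given as equations, i.e. as pairs of words. \<open>word_eq S R\<close> relates two
  words over \<open>S\<close> that represent the same element of the group with generators \<open>S\<close> and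
  relations \<open>R\<close>.\<close>

inductive_set word_eq :: "'a set \<Rightarrow> ('a word \<times> 'a word) set \<Rightarrow> ('a word \<times> 'a word) set"
  for S :: "'a set" and R :: "('a word \<times> 'a word) set" where
  refl: "u \<in> lists (S \<times> UNIV) \<Longrightarrow> (u, u) \<in> word_eq S R"
| sym: "(u, v) \<in> word_eq S R \<Longrightarrow> (v, u) \<in> word_eq S R"
| trans: "(u, v) \<in> word_eq S R \<Longrightarrow> (v, w) \<in> word_eq S R \<Longrightarrow> (u, w) \<in> word_eq S R"
| cancel: "u \<in> lists (S \<times> UNIV) \<Longrightarrow> v \<in> lists (S \<times> UNIV) \<Longrightarrow> a \<in> S \<Longrightarrow>
    (u @ [(a, b), (a, \<not> b)] @ v, u @ v) \<in> word_eq S R"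
| rel: "u \<in> lists (S \<times> UNIV) \<Longrightarrow> v \<in> lists (S \<times> UNIV) \<Longrightarrow> (l, r) \<in> R \<Longrightarrow>
    l \<in> lists (S \<times> UNIV) \<Longrightarrow> r \<in> lists (S \<times> UNIV) \<Longrightarrow>
    (u @ l @ v, u @ r @ v) \<in> word_eq S R"

definition presented_group :: "'a set \<Rightarrow> ('a word \<times> 'a word) set \<Rightarrow> 'a word set monoid" where
  "presented_group S R =
     \<lparr>carrier = lists (S \<times> UNIV) // word_eq S R,
      monoid.mult = (\<lambda>A B. word_eq S R `` {u @ v |u v. u \<in> A \<and> v \<in> B}),
      one = word_eq S R `` {[]}\<rparr>"

definition pres_gen :: "'a set \<Rightarrow> ('a word \<times> 'a word) set \<Rightarrow> 'a \<Rightarrow> 'a word set" where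
  "pres_gen S R a = word_eq S R `` {letter a}"

fun eval_word :: "('b, 'm) monoid_scheme \<Rightarrow> ('a \<Rightarrow> 'b) \<Rightarrow> 'a word \<Rightarrow> 'b" where
  "eval_word G f [] = \<one>\<^bsub>G\<^esub>"
| "eval_word G f ((a, b) # w) = (if b then f a else inv\<^bsub>G\<^esub> (f a)) \<otimes>\<^bsub>G\<^esub> eval_word G f w"

text \<open>The homomorphism from a presented group to \<open>G\<close> determined by the images \<open>f\<close> of the generators.
  It is meaningful when \<open>f\<close> respects the relations: all words of a class then have the
  same value in \<open>G\<close>. It is extensional, as the elements of \<^const>\<open>AutoGroup\<close> are.\<close>

definition pres_hom ::
  "'a set \<Rightarrow> ('a word \<times> 'a word) set \<Rightarrow> ('b, 'm) monoid_scheme \<Rightarrow> ('a \<Rightarrow> 'b) \<Rightarrow> 'a word set \<Rightarrow> 'b"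
  where
  "pres_hom S R G f = (\<lambda>C\<in>carrier (presented_group S R). the_elem (eval_word G f ` C))"

text \<open>\<open>G\<close> is generated by the elements \<open>f s\<close>, for \<open>s\<close> in \<open>S\<close>, with defining relations \<open>R\<close>.\<close>

definition has_presentation ::
  "('b, 'm) monoid_scheme \<Rightarrow> 'a set \<Rightarrow> ('a word \<times> 'a word) set \<Rightarrow> ('a \<Rightarrow> 'b) \<Rightarrow> bool" where
  "has_presentation G S R f \<longleftrightarrow>
     group G \<and> f \<in> S \<rightarrow> carrier G \<and> pres_hom S R G f \<in> iso (presented_group S R) G"

section \<open>Amalgamated and semidirect products\<close>

text \<open>The amalgamated product along \<open>f : C \<rightarrow> A\<close> and \<open>g : C \<rightarrow> B\<close>, presented by the multiplication
  tables of \<open>A\<close> and \<open>B\<close> together with the identification of \<open>f c\<close> with \<open>g c\<close>.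
  It is an amalgamated free product in the usual sense when \<open>f\<close> and \<open>g\<close> are monomorphisms.\<close>

definition amalgam_gens :: "'a monoid \<Rightarrow> 'b monoid \<Rightarrow> ('a + 'b) set" where
  "amalgam_gens A B = carrier A <+> carrier B"

definition amalgam_rels ::
  "'c monoid \<Rightarrow> 'a monoid \<Rightarrow> 'b monoid \<Rightarrow> ('c \<Rightarrow> 'a) \<Rightarrow> ('c \<Rightarrow> 'b)
    \<Rightarrow> (('a + 'b) word \<times> ('a + 'b) word) set" where
  "amalgam_rels C A B f g =
     {(letter (Inl x) @ letter (Inl y), letter (Inl (x \<otimes>\<^bsub>A\<^esub> y))) |x y. x \<in> carrier A \<and> y \<in> carrier A}
   \<union> {(letter (Inr x) @ letter (Inr y), letter (Inr (x \<otimes>\<^bsub>B\<^esub> y))) |x y. x \<in> carrier B \<and> y \<in> carrier B}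
   \<union> {(letter (Inl (f c)), letter (Inr (g c))) |c. c \<in> carrier C}"

definition amalgam ::
  "'c monoid \<Rightarrow> 'a monoid \<Rightarrow> 'b monoid \<Rightarrow> ('c \<Rightarrow> 'a) \<Rightarrow> ('c \<Rightarrow> 'b) \<Rightarrow> ('a + 'b) word set monoid" where
  "amalgam C A B f g = presented_group (amalgam_gens A B) (amalgam_rels C A B f g)"

definition amalgam_inl ::
  "'c monoid \<Rightarrow> 'a monoid \<Rightarrow> 'b monoid \<Rightarrow> ('c \<Rightarrow> 'a) \<Rightarrow> ('c \<Rightarrow> 'b) \<Rightarrow> 'a \<Rightarrow> ('a + 'b) word set" where
  "amalgam_inl C A B f g x = pres_gen (amalgam_gens A B) (amalgam_rels C A B f g) (Inl x)"

definition amalgam_inr ::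
  "'c monoid \<Rightarrow> 'a monoid \<Rightarrow> 'b monoid \<Rightarrow> ('c \<Rightarrow> 'a) \<Rightarrow> ('c \<Rightarrow> 'b) \<Rightarrow> 'b \<Rightarrow> ('a + 'b) word set" where
  "amalgam_inr C A B f g y = pres_gen (amalgam_gens A B) (amalgam_rels C A B f g) (Inr y)"

definition semidirect :: "'a monoid \<Rightarrow> 'b monoid \<Rightarrow> ('b \<Rightarrow> 'a \<Rightarrow> 'a) \<Rightarrow> ('a \<times> 'b) monoid" where
  "semidirect N H \<alpha> =
     \<lparr>carrier = carrier N \<times> carrier H,
      monoid.mult = (\<lambda>(a, h) (b, k). (a \<otimes>\<^bsub>N\<^esub> \<alpha> h b, h \<otimes>\<^bsub>H\<^esub> k)),
      one = (\<one>\<^bsub>N\<^esub>, \<one>\<^bsub>H\<^esub>)\<rparr>"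

section \<open>Inner and outer automorphisms\<close>

definition conj_auto :: "('a, 'm) monoid_scheme \<Rightarrow> 'a \<Rightarrow> 'a \<Rightarrow> 'a" where
  "conj_auto G g = (\<lambda>h\<in>carrier G. g \<otimes>\<^bsub>G\<^esub> h \<otimes>\<^bsub>G\<^esub> inv\<^bsub>G\<^esub> g)"

definition Inn :: "('a, 'm) monoid_scheme \<Rightarrow> ('a \<Rightarrow> 'a) set" where
  "Inn G = conj_auto G ` carrier G"

definition Out :: "('a, 'm) monoid_scheme \<Rightarrow> ('a \<Rightarrow> 'a) set monoid" where
  "Out G = AutoGroup G Mod Inn G"

definition out_class :: "('a, 'm) monoid_scheme \<Rightarrow> ('a \<Rightarrow> 'a) \<Rightarrow> ('a \<Rightarrow> 'a) set" where
  "out_class G \<alpha> = Inn G #>\<^bsub>AutoGroup G\<^esub> \<alpha>"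

section \<open>Baumslag--Solitar groups and their automorphisms\<close>

datatype bs_gen = GenX | GenT

definition BS_rels :: "int \<Rightarrow> int \<Rightarrow> (bs_gen word \<times> bs_gen word) set" where
  "BS_rels p q =
     {(letter GenT @ word_pow (letter GenX) p @ word_inv (letter GenT), word_pow (letter GenX) q)}"

definition BS :: "int \<Rightarrow> int \<Rightarrow> bs_gen word set monoid" where
  "BS p q = presented_group UNIV (BS_rels p q)"

definition BS_x :: "int \<Rightarrow> int \<Rightarrow> bs_gen word set" where
  "BS_x p q = pres_gen UNIV (BS_rels p q) GenX"

definition BS_t :: "int \<Rightarrow> int \<Rightarrow> bs_gen word set" where
  "BS_t p q = pres_gen UNIV (BS_rels p q) GenT"

text \<open>The endomorphism of \<open>BS(p,q)\<close> with \<open>x \<mapsto> a\<close> and \<open>t \<mapsto> b\<close> (if these images satisfy the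
  defining relation).\<close>

definition BS_map ::
  "int \<Rightarrow> int \<Rightarrow> bs_gen word set \<Rightarrow> bs_gen word set \<Rightarrow> bs_gen word set \<Rightarrow> bs_gen word set" where
  "BS_map p q a b = pres_hom UNIV (BS_rels p q) (BS p q) (case_bs_gen a b)"

definition BS_psi :: "int \<Rightarrow> int \<Rightarrow> bs_gen word set \<Rightarrow> bs_gen word set" where
  "BS_psi p q = BS_map p q (BS_x p q) (BS_x p q \<otimes>\<^bsub>BS p q\<^esub> BS_t p q)"

definition BS_iota :: "int \<Rightarrow> int \<Rightarrow> bs_gen word set \<Rightarrow> bs_gen word set" where
  "BS_iota p q = BS_map p q (inv\<^bsub>BS p q\<^esub> (BS_x p q)) (BS_t p q)"

definition BS_phi :: "int \<Rightarrow> int \<Rightarrow> nat \<Rightarrow> bs_gen word set \<Rightarrow> bs_gen word set" where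
  "BS_phi p q k = BS_map p q (BS_x p q)
     ((BS_t p q [^]\<^bsub>BS p q\<^esub> (- int k) \<otimes>\<^bsub>BS p q\<^esub> BS_x p q [^]\<^bsub>BS p q\<^esub> p
         \<otimes>\<^bsub>BS p q\<^esub> BS_t p q [^]\<^bsub>BS p q\<^esub> int k) \<otimes>\<^bsub>BS p q\<^esub> BS_t p q)"

datatype aut_gen = Cx | Ct | Psi | Iota | Phi nat

definition aut_gens :: "aut_gen set" where
  "aut_gens = {Cx, Ct, Psi, Iota} \<union> {Phi k |k. 1 \<le> k}"

primrec aut_val :: "int \<Rightarrow> int \<Rightarrow> aut_gen \<Rightarrow> bs_gen word set \<Rightarrow> bs_gen word set" where
  "aut_val p q Cx = conj_auto (BS p q) (BS_x p q)"
| "aut_val p q Ct = conj_auto (BS p q) (BS_t p q)"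
| "aut_val p q Psi = BS_psi p q"
| "aut_val p q Iota = BS_iota p q"
| "aut_val p q (Phi k) = BS_phi p q k"

definition aut_rels :: "int \<Rightarrow> int \<Rightarrow> int \<Rightarrow> (aut_gen word \<times> aut_gen word) set" where
  "aut_rels p n q =
    (let cx = letter Cx; ct = letter Ct; \<psi> = letter Psi; \<iota> = letter Iota;
         \<phi> = (\<lambda>k. letter (Phi k)) in
     {(ct @ word_pow cx p @ word_inv ct, word_pow cx q),
      (word_inv \<iota>, \<iota>),
      (\<iota> @ cx @ \<iota>, word_inv cx),
      (\<iota> @ ct @ \<iota>, ct),
      (\<iota> @ \<psi> @ \<iota>, word_inv \<psi>),
      (word_pow \<psi> p, word_pow (\<phi> 1) n),
      (word_pow \<psi> (p * (n - 1)), word_pow cx (- p)),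
      (\<psi> @ cx @ word_inv \<psi>, cx),
      (\<psi> @ ct @ word_inv \<psi>, cx @ ct)}
   \<union> {(\<iota> @ \<phi> k @ \<iota>, word_inv (\<phi> k)) |k. 1 \<le> k}
   \<union> {(\<phi> k @ cx @ word_inv (\<phi> k), cx) |k. 1 \<le> k}
   \<union> {(\<phi> k @ ct @ word_inv (\<phi> k),
        word_pow ct (- int k) @ word_pow cx p @ word_pow ct (int k + 1)) |k. 1 \<le> k}
   \<union> {(word_pow (\<phi> (k + 1)) n, \<phi> k) |k. 1 \<le> k})"

section \<open>The factors of the outer automorphism group\<close>

definition Z_inverting :: "int \<Rightarrow> rat monoid" where
  "Z_inverting m =
     \<lparr>carrier = {of_int a / of_int m ^ k |a k. True}, monoid.mult = (+), one = 0\<rparr>"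

definition int_multiples :: "int \<Rightarrow> rat set" where
  "int_multiples m = {of_int (m * a) |a. True}"

definition out_A :: "int \<Rightarrow> int \<Rightarrow> int monoid" where
  "out_A p n = integer_mod_group (nat (p * \<bar>n - 1\<bar>))"

definition out_B :: "int \<Rightarrow> rat set monoid" where
  "out_B n = Z_inverting \<bar>n\<bar> Mod int_multiples \<bar>n * (n - 1)\<bar>"

definition out_B_class :: "int \<Rightarrow> rat \<Rightarrow> rat set" where
  "out_B_class n r = int_multiples \<bar>n * (n - 1)\<bar> #>\<^bsub>Z_inverting \<bar>n\<bar>\<^esub> r"

definition out_C :: "int \<Rightarrow> int monoid" where
  "out_C n = integer_mod_group (nat \<bar>n - 1\<bar>)"

text \<open>The embeddings of the amalgamated subgroup send its generator to \<open>p\<close> (that is, \<open>\<psi>\<^sup>p\<close>) and to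
  the class of \<open>n\<close> (that is, \<open>\<phi>\<^sub>1\<^sup>n\<close>).\<close>

definition out_f :: "int \<Rightarrow> int \<Rightarrow> int" where
  "out_f p i = p * i"

definition out_g :: "int \<Rightarrow> int \<Rightarrow> rat set" where
  "out_g n i = out_B_class n (of_int (n * i))"

definition out_N :: "int \<Rightarrow> int \<Rightarrow> (int + rat set) word set monoid" where
  "out_N p n = amalgam (out_C n) (out_A p n) (out_B n) (out_f p) (out_g n)"

definition out_inl :: "int \<Rightarrow> int \<Rightarrow> int \<Rightarrow> (int + rat set) word set" where
  "out_inl p n = amalgam_inl (out_C n) (out_A p n) (out_B n) (out_f p) (out_g n)"

definition out_inr :: "int \<Rightarrow> int \<Rightarrow> rat set \<Rightarrow> (int + rat set) word set" where
  "out_inr p n = amalgam_inr (out_C n) (out_A p n) (out_B n) (out_f p) (out_g n)"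

text \<open>\<open>\<alpha>\<close> is the action of the cyclic group of order two on the amalgam whose generator inverts the
  elements of both factors; this determines \<open>\<alpha>\<close>, as the factors generate the amalgam.\<close>

definition inverting_action ::
  "int \<Rightarrow> int \<Rightarrow> (int \<Rightarrow> (int + rat set) word set \<Rightarrow> (int + rat set) word set) \<Rightarrow> bool"
  where
  "inverting_action p n \<alpha> \<longleftrightarrow>
     \<alpha> \<in> hom (integer_mod_group 2) (AutoGroup (out_N p n)) \<and>
     (\<forall>a\<in>carrier (out_A p n). \<alpha> 1 (out_inl p n a) = out_inl p n (inv\<^bsub>out_A p n\<^esub> a)) \<and>
     (\<forall>b\<in>carrier (out_B n). \<alpha> 1 (out_inr p n b) = out_inr p n (inv\<^bsub>out_B n\<^esub> b))"

end

theory Submission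
  imports Defs
begin

text \<open>\<open>G = BS(p, pn)\<close> acts on its Bass--Serre tree, whose vertices are normal forms; the root is stabilised
  by \<open>\<langle>x\<rangle>\<close>.

  Generation: the relation between the images of \<open>x\<close> and \<open>t\<close> makes the image of \<open>x\<close> elliptic, so up to
  an inner automorphism and \<open>\<iota>\<close> an automorphism fixes \<open>x\<close>. Let \<open>\<tau>\<close> be the image of \<open>t\<close>. As long as some
  \<open>\<tau>\<^sup>-\<^sup>j x\<^sup>p\<^sup>i \<tau>\<^sup>j\<^sup>+\<^sup>1\<close> is closer to the root than \<open>\<tau>\<close>, a power of \<open>\<phi>\<^sub>j\<close> shortens \<open>\<tau>\<close>. Otherwise ping-pong
  between \<open>\<langle>x\<rangle>\<close> and \<open>\<langle>x\<^sup>p, \<tau>\<rangle>\<close> shows that every element of the group generated by \<open>x\<close> and \<open>\<tau>\<close> outside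
  \<open>\<langle>x\<rangle>\<close> has length at least two, unless \<open>\<tau>\<close> itself has length one.

  Relations: modulo the inner automorphisms and \<open>\<iota>\<close>, a word in the generators is an alternating product
  of powers of \<open>\<psi>\<close> and of the \<open>\<phi>\<^sub>k\<close>. A product that genuinely alternates fixes \<open>x\<close> and sends \<open>t\<close> to an
  element whose geodesic starts downwards along a fixed edge. An inner automorphism fixing \<open>x\<close> is conjugation
  by a power of \<open>x\<close> and sends \<open>t\<close> to an element whose geodesic starts upwards. Hence the relations of the
  presentation suffice, and modulo inner automorphisms the powers of \<open>\<psi>\<close> and of the \<open>\<phi>\<^sub>k\<close> form an
  amalgamated product.\<close>

section \<open>Presented groups\<close>

text \<open>The proof rests on an asymmetry at the root of the tree. Left multiplication by
  \<open>x\<close> permutes the \<open>|q|\<close> edges \<open>x^r t\<close> cyclically, and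
  likewise the \<open>p\<close> edges \<open>x^r t^-1\<close>. As \<open>q\<close> does not divide
  \<open>p\<close>, the element \<open>x^p\<close> fixes every edge of the second kind and none of
  the first. Any \<open>g\<close> outside the powers of \<open>x\<close> with
  \<open>x^p g = g x^j\<close> therefore has a geodesic that starts with \<open>t^-1\<close>; this
  is where the downward directions come from.

  Distances are handled through the common prefix of two geodesics. It satisfies an ultrametric
  inequality, and a product does not cancel when two first edges differ.

  The lemma \<open>alternating_exhaust\<close> writes elements as alternating products in
  \<open>G\<close>, in the presented group and in the amalgam. In the last two cases such a product
  is mapped to automorphisms, where its effect on \<open>t\<close> shows that it is not trivial;
  this is how injectivity is obtained.

  The infinite family of the \<open>\<phi>_k\<close> is governed by the elements
  \<open>t^-k x^(p*i) t^k\<close>, which form a copy of \<open>Z[1/n]\<close>.\<close>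

declare in_lists_conv_set [simp del] in_listsD [rule del] in_listsI [rule del]

lemma word_eq_lists:
  assumes "(u, v) \<in> word_eq S R"
  shows "u \<in> lists (S \<times> UNIV)" "v \<in> lists (S \<times> UNIV)"
proof -
  from assms have "u \<in> lists (S \<times> UNIV) \<and> v \<in> lists (S \<times> UNIV)"
    by (induction rule: word_eq.induct) auto
  then show "u \<in> lists (S \<times> UNIV)" "v \<in> lists (S \<times> UNIV)" by auto
qed

lemma word_eq_append_left:
  assumes "(u, v) \<in> word_eq S R" "w \<in> lists (S \<times> UNIV)"
  shows "(w @ u, w @ v) \<in> word_eq S R"
  using assms
proof (induction rule: word_eq.induct)
  case (refl u)
  then show ?case by (intro word_eq.refl) auto
next
  case (cancel u v a b)
  then show ?case using word_eq.cancel[of "w @ u" S v a b R] by simp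
next
  case (rel u v l r)
  then show ?case using word_eq.rel[of "w @ u" S v l r R] by simp
qed (auto intro: word_eq.sym word_eq.trans)

lemma word_eq_append_right:
  assumes "(u, v) \<in> word_eq S R" "w \<in> lists (S \<times> UNIV)"
  shows "(u @ w, v @ w) \<in> word_eq S R"
  using assms
proof (induction rule: word_eq.induct)
  case (refl u)
  then show ?case by (intro word_eq.refl) auto
next
  case (cancel u v a b)
  then show ?case using word_eq.cancel[of u S "v @ w" a b R] by simp
next
  case (rel u v l r)
  then show ?case using word_eq.rel[of u S "v @ w" l r R] by simp
qed (auto intro: word_eq.sym word_eq.trans)

lemma word_eq_append:
  assumes "(u, u') \<in> word_eq S R" "(v, v') \<in> word_eq S R"
  shows "(u @ v, u' @ v') \<in> word_eq S R"
  using word_eq_append_left[OF assms(2) word_eq_lists(1)[OF assms(1)]]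
    word_eq_append_right[OF assms(1) word_eq_lists(2)[OF assms(2)]]
  by (rule word_eq.trans)

lemma equiv_word_eq: "equiv (lists (S \<times> UNIV)) (word_eq S R)"
  by (intro equivI refl_onI symI transI)
    (auto intro: word_eq.refl word_eq.sym word_eq.trans dest: word_eq_lists)

lemma word_inv_Cons: "word_inv ((a, b) # w) = word_inv w @ [(a, \<not> b)]"
  by (simp add: word_inv_def)

lemma word_inv_lists: "w \<in> lists (S \<times> UNIV) \<Longrightarrow> word_inv w \<in> lists (S \<times> UNIV)"
  by (induction w) (auto simp: word_inv_Cons word_inv_def)

lemma word_pow_lists:
  assumes "w \<in> lists (S \<times> UNIV)"
  shows "word_pow w k \<in> lists (S \<times> UNIV)"
proof -
  have *: "concat (replicate m v) \<in> lists (S \<times> UNIV)" if "v \<in> lists (S \<times> UNIV)" for m v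
    using that by (induction m) auto
  show ?thesis
    using *[OF assms] *[OF word_inv_lists[OF assms]] by (simp add: word_pow_def)
qed

lemma word_eq_inv_left:
  assumes "w \<in> lists (S \<times> UNIV)"
  shows "(word_inv w @ w, []) \<in> word_eq S R"
  using assms
proof (induction w)
  case Nil
  then show ?case by (auto simp: word_inv_def intro: word_eq.refl)
next
  case (Cons l w)
  obtain a b where l: "l = (a, b)" by force
  \<comment> \<open>The double negation matches the shape of \<open>cancel\<close>, instantiated
    with the sign \<open>\<not> b\<close>.\<close>
  have "(word_inv w @ [(a, \<not> b), (a, \<not> \<not> b)] @ w, word_inv w @ w) \<in> word_eq S R"
    using Cons by (intro word_eq.cancel) (auto simp: l word_inv_lists)
  then show ?case
    using Cons word_eq.trans by (force simp: l word_inv_Cons)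
qed

abbreviation word_class :: "'a set \<Rightarrow> ('a word \<times> 'a word) set \<Rightarrow> 'a word \<Rightarrow> 'a word set" where
  "word_class S R w \<equiv> word_eq S R `` {w}"

lemma word_class_eq:
  "(u, v) \<in> word_eq S R \<Longrightarrow> word_class S R u = word_class S R v"
  using equiv_class_eq[OF equiv_word_eq] .

lemma carrier_presented_group:
  "carrier (presented_group S R) = word_class S R ` lists (S \<times> UNIV)"
  by (auto simp: presented_group_def quotient_def)

lemma one_presented_group: "\<one>\<^bsub>presented_group S R\<^esub> = word_class S R []"
  by (simp add: presented_group_def)

text \<open>The product is defined without representatives, by saturating the set of all
  concatenations. Since \<open>word_eq\<close> is a congruence, that set lies in a single
  class.\<close>

lemma mult_presented_group:
  assumes "u \<in> lists (S \<times> UNIV)" "v \<in> lists (S \<times> UNIV)"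
  shows "word_class S R u \<otimes>\<^bsub>presented_group S R\<^esub> word_class S R v = word_class S R (u @ v)"
proof -
  have "word_eq S R `` {u' @ v' |u' v'. u' \<in> word_class S R u \<and> v' \<in> word_class S R v}
      = word_class S R (u @ v)" (is "?L = ?R")
  proof
    show "?L \<subseteq> ?R"
      by (auto intro: word_eq.trans word_eq_append)
    have "u \<in> word_class S R u" "v \<in> word_class S R v"
      using assms by (auto intro: word_eq.refl)
    then show "?R \<subseteq> ?L" by blast
  qed
  then show ?thesis by (simp add: presented_group_def)
qed

lemma group_presented_group: "group (presented_group S R)"
proof (rule groupI, unfold carrier_presented_group one_presented_group, elim imageE)
  fix A assume "A \<in> word_class S R ` lists (S \<times> UNIV)"
  then obtain w where w: "w \<in> lists (S \<times> UNIV)" "A = word_class S R w"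
    by (elim imageE)
  have "word_class S R (word_inv w) \<otimes>\<^bsub>presented_group S R\<^esub> A = word_class S R []"
    unfolding w(2) mult_presented_group[OF word_inv_lists[OF w(1)] w(1)]
    by (rule word_class_eq[OF word_eq_inv_left[OF w(1)]])
  then show "\<exists>B\<in>word_class S R ` lists (S \<times> UNIV).
      B \<otimes>\<^bsub>presented_group S R\<^esub> A = word_class S R []"
    using word_inv_lists[OF w(1)] by (intro bexI) (assumption, rule imageI)
qed (elim imageE | simp add: mult_presented_group)+

context group
begin

lemma eval_word_closed:
  assumes "f \<in> S \<rightarrow> carrier G" "w \<in> lists (S \<times> UNIV)"
  shows "eval_word G f w \<in> carrier G"
  using assms(2)
proof (induction w)
  case (Cons l w)
  then show ?case using assms(1) by (cases l) auto
qed auto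

lemma eval_word_append:
  assumes "f \<in> S \<rightarrow> carrier G" "u \<in> lists (S \<times> UNIV)" "v \<in> lists (S \<times> UNIV)"
  shows "eval_word G f (u @ v) = eval_word G f u \<otimes> eval_word G f v"
  using assms(2)
proof (induction u)
  case Nil
  then show ?case using eval_word_closed[OF assms(1,3)] by simp
next
  case (Cons l u)
  then show ?case using assms(1) eval_word_closed[OF assms(1)] assms(3)
    by (cases l) (auto simp: m_assoc Pi_iff)
qed

lemma eval_word_letter: "f a \<in> carrier G \<Longrightarrow> eval_word G f (letter a) = f a"
  by (simp add: letter_def)

lemma letter_lists: "a \<in> S \<Longrightarrow> letter a \<in> lists (S \<times> UNIV)"
  by (simp add: letter_def)

lemma eval_word_inv:
  assumes "f \<in> S \<rightarrow> carrier G" "w \<in> lists (S \<times> UNIV)"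
  shows "eval_word G f (word_inv w) = inv (eval_word G f w)"
  using assms(2)
proof (induction w)
  case Nil
  then show ?case by (simp add: word_inv_def)
next
  case (Cons l w)
  obtain a b where l: "l = (a, b)" by force
  have fa: "f a \<in> carrier G" using Cons assms(1) l by auto
  have "eval_word G f (word_inv w @ [(a, \<not> b)]) = eval_word G f (word_inv w) \<otimes> eval_word G f [(a, \<not> b)]"
    using Cons by (intro eval_word_append[OF assms(1)]) (auto simp: l word_inv_lists)
  then show ?case
    using Cons fa eval_word_closed[OF assms(1)] by (auto simp: l word_inv_Cons inv_mult_group)
qed

lemma eval_word_pow:
  assumes "f \<in> S \<rightarrow> carrier G" "w \<in> lists (S \<times> UNIV)"
  shows "eval_word G f (word_pow w k) = eval_word G f w [^] k"
proof -
  have *: "concat (replicate m v) \<in> lists (S \<times> UNIV) \<and>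
      eval_word G f (concat (replicate m v)) = eval_word G f v [^] m"
    if v: "v \<in> lists (S \<times> UNIV)" for m v
  proof (induction m)
    case 0
    show ?case by simp
  next
    case (Suc m)
    then have "eval_word G f (v @ concat (replicate m v)) = eval_word G f v \<otimes> eval_word G f v [^] m"
      using eval_word_append[OF assms(1) v] by simp
    then show ?case
      unfolding nat_pow_Suc2[OF eval_word_closed[OF assms(1) v]] using v Suc by simp
  qed
  have c: "eval_word G f w \<in> carrier G" by (rule eval_word_closed[OF assms])
  show ?thesis
  proof (cases "0 \<le> k")
    case True
    then show ?thesis
      unfolding word_pow_def int_pow_def2 using *[OF assms(2), of "nat k"] by simp
  next
    case False
    then show ?thesis
      unfolding word_pow_def int_pow_def2
      using *[OF word_inv_lists[OF assms(2)], of "nat (- k)"] nat_pow_inv[OF c, of "nat (- k)"]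
      by (simp only: eval_word_inv[OF assms]) simp
  qed
qed

text \<open>Von Dyck's theorem on the level of words. Only relations between words over
  \<open>S\<close> have to be checked, because \<open>word_eq\<close> applies no others.\<close>

lemma eval_word_respects:
  assumes f: "f \<in> S \<rightarrow> carrier G"
    and rels: "\<And>l r. (l, r) \<in> R \<Longrightarrow> l \<in> lists (S \<times> UNIV) \<Longrightarrow> r \<in> lists (S \<times> UNIV)
      \<Longrightarrow> eval_word G f l = eval_word G f r"
    and "(u, v) \<in> word_eq S R"
  shows "eval_word G f u = eval_word G f v"
  using assms(3)
proof (induction rule: word_eq.induct)
  case (cancel u v a b)
  have "f a \<in> carrier G" using f cancel by auto
  then have "eval_word G f ([(a, b), (a, \<not> b)] @ v) = eval_word G f v"
    using eval_word_closed[OF f] cancel by (auto simp: m_assoc[symmetric])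
  then show ?case
    using cancel eval_word_append[OF f, of u "[(a, b), (a, \<not> b)] @ v"] eval_word_append[OF f, of u v]
    by auto
next
  case (rel u v l r)
  then show ?case using rels[of l r] by (simp add: eval_word_append[OF f])
qed auto

end

text \<open>All words of a class have one value, so the image of the class is a singleton and
  \<open>the_elem\<close> returns that value.\<close>

lemma pres_hom_class:
  assumes H: "group H" and f: "f \<in> S \<rightarrow> carrier H"
    and rels: "\<And>l r. (l, r) \<in> R \<Longrightarrow> l \<in> lists (S \<times> UNIV) \<Longrightarrow> r \<in> lists (S \<times> UNIV)
      \<Longrightarrow> eval_word H f l = eval_word H f r"
    and w: "w \<in> lists (S \<times> UNIV)"
  shows "pres_hom S R H f (word_class S R w) = eval_word H f w"
proof -
  interpret H: group H by (rule H)
  have "eval_word H f ` word_class S R w = {eval_word H f w}"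
    using H.eval_word_respects[OF f rels, symmetric] word_eq.refl[OF w]
    by (auto simp: image_iff) blast
  then show ?thesis using w by (simp add: pres_hom_def carrier_presented_group)
qed

lemma pres_hom_hom:
  assumes H: "group H" and f: "f \<in> S \<rightarrow> carrier H"
    and rels: "\<And>l r. (l, r) \<in> R \<Longrightarrow> l \<in> lists (S \<times> UNIV) \<Longrightarrow> r \<in> lists (S \<times> UNIV)
      \<Longrightarrow> eval_word H f l = eval_word H f r"
  shows "pres_hom S R H f \<in> hom (presented_group S R) H"
proof -
  interpret H: group H by (rule H)
  show ?thesis
    by (rule homI; unfold carrier_presented_group; elim imageE;
        simp add: pres_hom_class[OF H f rels] mult_presented_group
          H.eval_word_closed[OF f] H.eval_word_append[OF f])
qed

lemma pres_hom_gen: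
  assumes "group H" "f \<in> S \<rightarrow> carrier H"
    and "\<And>l r. (l, r) \<in> R \<Longrightarrow> l \<in> lists (S \<times> UNIV) \<Longrightarrow> r \<in> lists (S \<times> UNIV)
      \<Longrightarrow> eval_word H f l = eval_word H f r"
    and "a \<in> S"
  shows "pres_hom S R H f (pres_gen S R a) = f a"
proof -
  interpret H: group H by fact
  have "f a \<in> carrier H" using assms(2,4) by auto
  then show ?thesis
    unfolding pres_gen_def using assms(4)
    by (subst pres_hom_class[OF assms(1-3)]) (auto simp: letter_def)
qed

lemma pres_gen_closed: "a \<in> S \<Longrightarrow> pres_gen S R a \<in> carrier (presented_group S R)"
  by (auto simp: pres_gen_def carrier_presented_group letter_def)

lemma inv_word_class:
  assumes "w \<in> lists (S \<times> UNIV)"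
  shows "inv\<^bsub>presented_group S R\<^esub> (word_class S R w) = word_class S R (word_inv w)"
proof -
  interpret group "presented_group S R" by (rule group_presented_group)
  show ?thesis
    using assms word_class_eq[OF word_eq_inv_left[OF assms]]
    by (intro inv_equality)
      (auto simp: mult_presented_group one_presented_group carrier_presented_group word_inv_lists)
qed

lemma eval_word_pres_gen:
  assumes "w \<in> lists (S \<times> UNIV)"
  shows "eval_word (presented_group S R) (pres_gen S R) w = word_class S R w"
  using assms
proof (induction w)
  case Nil
  then show ?case by (simp add: one_presented_group)
next
  case (Cons l w)
  obtain a b where l: "l = (a, b)" by force
  have a: "[(a, True)] \<in> lists (S \<times> UNIV)" using Cons l by auto
  show ?case
  proof (cases b)
    case True
    then show ?thesis using Cons a mult_presented_group[OF a Cons.hyps(2)]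
      by (auto simp: l pres_gen_def letter_def)
  next
    case False
    have "[(a, False)] \<in> lists (S \<times> UNIV)" using Cons l by auto
    then show ?thesis
      using False Cons inv_word_class[OF a] mult_presented_group[of "[(a, False)]" S w R]
      by (auto simp: l pres_gen_def letter_def word_inv_def)
  qed
qed

lemma presented_group_rel:
  assumes "(l, r) \<in> R" "l \<in> lists (S \<times> UNIV)" "r \<in> lists (S \<times> UNIV)"
  shows "eval_word (presented_group S R) (pres_gen S R) l = eval_word (presented_group S R) (pres_gen S R) r"
  using word_class_eq[OF word_eq.rel[of "[]" S "[]" l r R]] assms by (simp add: eval_word_pres_gen)

lemma generate_presented_group:
  "generate (presented_group S R) (pres_gen S R ` S) = carrier (presented_group S R)"
proof
  interpret group "presented_group S R" by (rule group_presented_group)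
  have sub: "pres_gen S R ` S \<subseteq> carrier (presented_group S R)" by (auto simp: pres_gen_closed)
  show "generate (presented_group S R) (pres_gen S R ` S) \<subseteq> carrier (presented_group S R)"
    by (rule generate_incl[OF sub])
  have "eval_word (presented_group S R) (pres_gen S R) w \<in> generate (presented_group S R) (pres_gen S R ` S)"
    if "w \<in> lists (S \<times> UNIV)" for w
    using that
  proof (induction w)
    case (Cons l w)
    obtain a b where l: "l = (a, b)" by force
    then have "pres_gen S R a \<in> pres_gen S R ` S" using Cons by auto
    then have "(if b then pres_gen S R a else inv\<^bsub>presented_group S R\<^esub> (pres_gen S R a))
        \<in> generate (presented_group S R) (pres_gen S R ` S)"
      by (simp add: generate.incl generate.inv)
    then show ?case using generate.eng[OF _ Cons.IH] by (simp add: l)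
  qed (simp add: generate.one)
  then show "carrier (presented_group S R) \<subseteq> generate (presented_group S R) (pres_gen S R ` S)"
    using eval_word_pres_gen by (fastforce simp: carrier_presented_group)
qed

section \<open>Homomorphisms and generating sets\<close>

lemma hom_eq_on_generate:
  fixes G :: "('a, 'm) monoid_scheme" and H :: "('b, 'n) monoid_scheme"
  assumes G: "group G" and H: "group H" and h: "h \<in> hom G H" and k: "k \<in> hom G H"
    and Z: "Z \<subseteq> carrier G" "\<And>a. a \<in> Z \<Longrightarrow> h a = k a"
    and g: "g \<in> generate G Z"
  shows "h g = k g"
proof -
  interpret h: group_hom G H h using G H h by (simp add: group_hom_def group_hom_axioms_def)
  interpret k: group_hom G H k using G H k by (simp add: group_hom_def group_hom_axioms_def)
  show ?thesis using g
  proof (induction rule: generate.induct)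
    case (inv a)
    then show ?case using Z by (metis h.hom_inv k.hom_inv subsetD)
  next
    case (eng a b)
    then show ?case using h.G.generate_in_carrier[OF Z(1)] by simp
  qed (auto simp: Z)
qed

lemma hom_image_generate_eq:
  fixes G :: "('a, 'm) monoid_scheme" and H :: "('b, 'n) monoid_scheme"
  assumes "group G" "group H" "h \<in> hom G H" "Z \<subseteq> carrier G" "generate G Z = carrier G"
  shows "h ` carrier G = generate H (h ` Z)"
proof -
  interpret group_hom G H h using assms by (simp add: group_hom_def group_hom_axioms_def)
  show ?thesis using generate_img[OF assms(4)] assms(5) by simp
qed

text \<open>Products \<open>a_1 b_1 ... a_m b_m\<close> in which every factor lies in exactly one of
  the two subgroups, except that \<open>a_1\<close> may be any element of \<open>A\<close>,
  including the identity. A last factor from \<open>A\<close> is kept separate, so that every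
  product ends in \<open>B\<close> outside \<open>A\<close>.\<close>

inductive_set alternating :: "('a, 'm) monoid_scheme \<Rightarrow> 'a set \<Rightarrow> 'a set \<Rightarrow> 'a set"
  for G and A B where
  base: "a \<in> A \<Longrightarrow> b \<in> B \<Longrightarrow> b \<notin> A \<Longrightarrow> a \<otimes>\<^bsub>G\<^esub> b \<in> alternating G A B"
| step: "g \<in> alternating G A B \<Longrightarrow> a \<in> A \<Longrightarrow> a \<notin> B \<Longrightarrow> b \<in> B \<Longrightarrow> b \<notin> A
    \<Longrightarrow> g \<otimes>\<^bsub>G\<^esub> (a \<otimes>\<^bsub>G\<^esub> b) \<in> alternating G A B"

lemma (in group) alternating_closed:
  assumes "subgroup A G" "subgroup B G" "g \<in> alternating G A B"
  shows "g \<in> carrier G"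
  using assms(3) by induction (auto dest: subgroup.mem_carrier[OF assms(1)] subgroup.mem_carrier[OF assms(2)])

text \<open>The factor \<open>c\<close> changes only the last letter \<open>b\<close>. If
  \<open>b c\<close> falls into \<open>A\<close>, then it merges with the \<open>a\<close> before
  it, which leaves an element of \<open>A\<close> or a shorter alternating product times an element
  of \<open>A\<close>.\<close>

lemma (in group) alternating_mult:
  assumes A: "subgroup A G" and B: "subgroup B G"
    and h: "h \<in> alternating G A B" and c: "c \<in> A \<inter> B \<or> c \<in> B"
  shows "h \<otimes> c \<in> A \<or> (\<exists>h'\<in>alternating G A B. \<exists>a\<in>A. h \<otimes> c = h' \<otimes> a)"
  using h
proof cases
  case (base a b)
  have car: "a \<in> carrier G" "b \<in> carrier G" "c \<in> carrier G"
    using base c subgroup.mem_carrier[OF A] subgroup.mem_carrier[OF B] by auto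
  have e: "h \<otimes> c = a \<otimes> (b \<otimes> c)" using base car by (simp add: m_assoc)
  have bc: "b \<otimes> c \<in> B" using subgroup.m_closed[OF B] base c by blast
  show ?thesis
  proof (cases "b \<otimes> c \<in> A")
    case True
    then show ?thesis using e subgroup.m_closed[OF A base(2)] by simp
  next
    case False
    then have "a \<otimes> (b \<otimes> c) \<in> alternating G A B" using base bc by (auto intro: alternating.base)
    then show ?thesis using e car subgroup.one_closed[OF A] by (intro disjI2 bexI[of _ "h \<otimes> c"] bexI[of _ \<one>]) auto
  qed
next
  case (step g a b)
  have car: "a \<in> carrier G" "b \<in> carrier G" "c \<in> carrier G" "g \<in> carrier G"
    using step c subgroup.mem_carrier[OF A] subgroup.mem_carrier[OF B] alternating_closed[OF A B] by auto
  have e: "h \<otimes> c = g \<otimes> (a \<otimes> (b \<otimes> c))" using step car by (simp add: m_assoc)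
  have bc: "b \<otimes> c \<in> B" using subgroup.m_closed[OF B] step c by blast
  show ?thesis
  proof (cases "b \<otimes> c \<in> A")
    case True
    then show ?thesis using e step(2) subgroup.m_closed[OF A step(3) True] by blast
  next
    case False
    then have "g \<otimes> (a \<otimes> (b \<otimes> c)) \<in> alternating G A B" using step bc by (auto intro: alternating.step)
    then show ?thesis using e car subgroup.one_closed[OF A] by (intro disjI2 bexI[of _ "h \<otimes> c"] bexI[of _ \<one>]) auto
  qed
qed

text \<open>The existence half of the normal form theorem, for any two subgroups. The nontriviality
  of alternating products is a matter of geometry in each application.\<close>

lemma (in group) alternating_exhaust:
  assumes A: "subgroup A G" and B: "subgroup B G" and g: "g \<in> generate G (A \<union> B)"
  shows "g \<in> A \<or> (\<exists>h\<in>alternating G A B. \<exists>a\<in>A. g = h \<otimes> a)"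
proof -
  note cA = subgroup.mem_carrier[OF A] and cB = subgroup.mem_carrier[OF B]
    and cH = alternating_closed[OF A B]
  define Z where "Z = A \<union> {h \<otimes> a |h a. h \<in> alternating G A B \<and> a \<in> A}"
  \<comment> \<open>The right multipliers that preserve the set \<open>Z\<close> of admissible forms
    are closed under products; it remains to see that they contain \<open>A\<close> and
    \<open>B\<close>.\<close>
  define Y where "Y = {y \<in> carrier G. \<forall>g\<in>Z. g \<otimes> y \<in> Z}"
  have ZC: "g \<in> carrier G" if "g \<in> Z" for g
    using that cA cH by (auto simp: Z_def)
  have YA: "A \<subseteq> Y"
  proof
    fix c assume c: "c \<in> A"
    have "g \<otimes> c \<in> Z" if "g \<in> Z" for g
      using that
      unfolding Z_def
    proof
      assume "g \<in> A"
      then show "g \<otimes> c \<in> A \<union> {h \<otimes> a |h a. h \<in> alternating G A B \<and> a \<in> A}"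
        using c A by (simp add: subgroup.m_closed)
    next
      assume "g \<in> {h \<otimes> a |h a. h \<in> alternating G A B \<and> a \<in> A}"
      then obtain h a where ha: "g = h \<otimes> a" "h \<in> alternating G A B" "a \<in> A" by auto
      then have "g \<otimes> c = h \<otimes> (a \<otimes> c)" using c cA cH by (simp add: m_assoc)
      moreover have "a \<otimes> c \<in> A" using ha c A by (simp add: subgroup.m_closed)
      ultimately show "g \<otimes> c \<in> A \<union> {h \<otimes> a |h a. h \<in> alternating G A B \<and> a \<in> A}"
        using ha by blast
    qed
    then show "c \<in> Y" using c cA by (simp add: Y_def)
  qed
  have YB: "B \<subseteq> Y"
  proof
    fix c assume c: "c \<in> B"
    have "g \<otimes> c \<in> Z" if "g \<in> Z" for g
    proof (cases "c \<in> A")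
      case True
      then show ?thesis using YA that by (auto simp: Y_def)
    next
      case False
      from that consider "g \<in> A" | h a where "g = h \<otimes> a" "h \<in> alternating G A B" "a \<in> A"
        by (auto simp: Z_def)
      then show ?thesis
      proof cases
        case 1
        then have "g \<otimes> c \<in> alternating G A B" using c False by (auto intro: alternating.base)
        moreover have "g \<otimes> c = (g \<otimes> c) \<otimes> \<one>" using 1 c cA cB by simp
        ultimately show ?thesis using subgroup.one_closed[OF A] unfolding Z_def by blast
      next
        case (2 h a)
        show ?thesis
        proof (cases "a \<in> B")
          case True
          then have "a \<otimes> c \<in> B" using c B by (simp add: subgroup.m_closed)
          then have "h \<otimes> (a \<otimes> c) \<in> Z"
            using alternating_mult[OF A B 2(2), of "a \<otimes> c"] unfolding Z_def by blast
          then show ?thesis using 2 c cA cB cH by (simp add: m_assoc)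
        next
          case nB: False
          then have "h \<otimes> (a \<otimes> c) \<in> alternating G A B" using 2 c False by (auto intro: alternating.step)
          moreover have "g \<otimes> c = (h \<otimes> (a \<otimes> c)) \<otimes> \<one>" using 2 c cA cB cH by (simp add: m_assoc)
          ultimately show ?thesis using subgroup.one_closed[OF A] unfolding Z_def by blast
        qed
      qed
    qed
    then show "c \<in> Y" using c cB by (simp add: Y_def)
  qed
  have "g \<in> Y" using g
  proof (induction rule: generate.induct)
    case one
    then show ?case using ZC by (simp add: Y_def)
  next
    case (incl h)
    then show ?case using YA YB by auto
  next
    case (inv h)
    then show ?case using YA YB subgroup.m_inv_closed[OF A] subgroup.m_inv_closed[OF B] by auto
  next
    case (eng y z)
    then show ?case using ZC by (auto simp: Y_def simp flip: m_assoc)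
  qed
  moreover have "\<one> \<in> Z" using subgroup.one_closed[OF A] by (simp add: Z_def)
  ultimately have "\<one> \<otimes> g \<in> Z" "g \<in> carrier G" by (auto simp: Y_def)
  then show ?thesis unfolding Z_def by auto
qed

lemma (in group) conj_eq_iff:
  assumes "a \<in> carrier G" "b \<in> carrier G" "c \<in> carrier G"
  shows "a \<otimes> b \<otimes> inv a = c \<longleftrightarrow> a \<otimes> b = c \<otimes> a"
  using assms by (metis inv_solve_right m_closed)

lemma (in group) mult_inv_cancel [simp]:
  assumes "a \<in> carrier G" "b \<in> carrier G"
  shows "a \<otimes> (inv a \<otimes> b) = b" "inv a \<otimes> (a \<otimes> b) = b"
  using assms by (simp_all flip: m_assoc)

lemma (in group) conj_int_pow:
  assumes "a \<in> carrier G" "b \<in> carrier G"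
  shows "(a \<otimes> b \<otimes> inv a) [^] (k::int) = a \<otimes> b [^] k \<otimes> inv a"
proof -
  have "(\<lambda>b. a \<otimes> b \<otimes> inv a) \<in> hom G G"
    using assms by (auto intro!: homI simp: m_assoc)
  then interpret group_hom G G "\<lambda>b. a \<otimes> b \<otimes> inv a"
    by (simp add: group_hom_def group_hom_axioms_def)
  show ?thesis using hom_int_pow[OF assms(2)] by simp
qed

lemma (in group) eval_word_letter_pow:
  "f a \<in> carrier G \<Longrightarrow> eval_word G f (word_pow (letter a) k) = f a [^] k"
  using eval_word_pow[of f "{a}" "letter a" k] by (simp add: letter_lists eval_word_letter)

lemma BijGroup_simps [simp]:
  "carrier (BijGroup S) = Bij S"
  "\<one>\<^bsub>BijGroup S\<^esub> = (\<lambda>v\<in>S. v)"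
  by (simp_all add: BijGroup_def)

lemma mult_BijGroup:
  "f \<in> Bij S \<Longrightarrow> g \<in> Bij S \<Longrightarrow> f \<otimes>\<^bsub>BijGroup S\<^esub> g = compose S f g"
  by (simp add: BijGroup_def)

lemma range_bs_gen: "range f = {f GenX, f GenT}"
proof -
  have U: "UNIV = {GenX, GenT}" by (auto intro: bs_gen.exhaust)
  show ?thesis unfolding U by simp
qed

section \<open>Normal forms in Baumslag--Solitar groups\<close>

text \<open>A list with entries \<open>(r, True)\<close> and \<open>(r, False)\<close> stands for the product of the elements
  \<open>x\<^sup>r t\<close> and \<open>x\<^sup>r t\<^sup>-\<^sup>1\<close>. Moving \<open>x\<^sup>k\<close> from the left through such a product changes the exponents
  and leaves a carry at the end. With the vertices of the Bass--Serre tree taken as lists, the longest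
  common prefix of two lists is the overlap of the geodesics from the root.\<close>

definition bs_mod :: "int \<Rightarrow> int \<Rightarrow> bool \<Rightarrow> int" where
  "bs_mod p q e = (if e then q else p)"

fun nf_shift :: "int \<Rightarrow> int \<Rightarrow> int \<Rightarrow> (int \<times> bool) list \<Rightarrow> (int \<times> bool) list" where
  "nf_shift p q k [] = []"
| "nf_shift p q k ((r, e) # L) = ((r + k) mod bs_mod p q e, e)
      # nf_shift p q ((r + k) div bs_mod p q e * bs_mod p q (\<not> e)) L"

fun nf_carry :: "int \<Rightarrow> int \<Rightarrow> int \<Rightarrow> (int \<times> bool) list \<Rightarrow> int" where
  "nf_carry p q k [] = k"
| "nf_carry p q k ((r, e) # L) = nf_carry p q ((r + k) div bs_mod p q e * bs_mod p q (\<not> e)) L"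

text \<open>Left multiplication by \<open>t\<close> or \<open>t^-1\<close>. Since exponents are
  reduced, a pinch with the first letter occurs only at exponent 0.\<close>

fun nf_stable :: "bool \<Rightarrow> (int \<times> bool) list \<Rightarrow> (int \<times> bool) list" where
  "nf_stable e [] = [(0, e)]"
| "nf_stable e ((r, e') # L) = (if r = 0 \<and> e' \<noteq> e then L else (0, e) # (r, e') # L)"

text \<open>Britton-reduced words with reduced exponents. From \<open>x^q t = t x^p\<close>, the
  exponent in \<open>x^r t\<close> counts modulo \<open>q\<close> and that in
  \<open>x^r t^-1\<close> modulo \<open>p\<close>. The condition \<open>r mod m = r\<close> also
  serves negative \<open>q\<close>, whose remainders are not positive.\<close>

fun nf_valid :: "int \<Rightarrow> int \<Rightarrow> (int \<times> bool) list \<Rightarrow> bool" where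
  "nf_valid p q [] \<longleftrightarrow> True"
| "nf_valid p q [(r, e)] \<longleftrightarrow> r mod bs_mod p q e = r"
| "nf_valid p q ((r, e) # (r', e') # L) \<longleftrightarrow>
     r mod bs_mod p q e = r \<and> \<not> (r' = 0 \<and> e' \<noteq> e) \<and> nf_valid p q ((r', e') # L)"

lemma nf_valid_Cons:
  "nf_valid p q ((r, e) # L) \<longleftrightarrow>
     r mod bs_mod p q e = r \<and> (\<forall>L'. L \<noteq> (0, \<not> e) # L') \<and> nf_valid p q L"
  by (cases L) auto

lemma length_nf_shift [simp]: "length (nf_shift p q k L) = length L"
  by (induction p q k L rule: nf_shift.induct) auto

text \<open>Moving \<open>x^k\<close> and then \<open>x^j\<close> through a letter leaves the same
  remainder as moving \<open>x^(j+k)\<close> at once, and the two quotients add up. Hence the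
  carries into the tail add up as well, and induction applies.\<close>

lemma nf_shift_add:
  assumes "p \<noteq> 0" "q \<noteq> 0"
  shows "nf_shift p q j (nf_shift p q k L) = nf_shift p q (j + k) L"
    and "nf_carry p q j (nf_shift p q k L) + nf_carry p q k L = nf_carry p q (j + k) L"
proof -
  have "nf_shift p q j (nf_shift p q k L) = nf_shift p q (j + k) L \<and>
    nf_carry p q j (nf_shift p q k L) + nf_carry p q k L = nf_carry p q (j + k) L"
  proof (induction L arbitrary: j k)
    case (Cons l L)
    obtain r e where l: "l = (r, e)" by force
    define m where "m = bs_mod p q e"
    have m: "m \<noteq> 0" using assms by (simp add: m_def bs_mod_def)
    have *: "r + (j + k) = ((r + k) mod m + j) + m * ((r + k) div m)"
      using mult_div_mod_eq[of m "r + k"] by linarith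
    have 1: "((r + k) mod m + j) mod m = (r + (j + k)) mod m"
      by (subst *) (rule mod_mult_self2[symmetric])
    have "(r + (j + k)) div m = (r + k) div m + ((r + k) mod m + j) div m"
      by (subst *) (rule div_mult_self2[OF m])
    then have 2: "((r + k) mod m + j) div m + (r + k) div m = (r + (j + k)) div m"
      by simp
    with 1 show ?case
      using Cons.IH by (simp add: l flip: m_def distrib_right)
  qed simp
  then show "nf_shift p q j (nf_shift p q k L) = nf_shift p q (j + k) L"
    "nf_carry p q j (nf_shift p q k L) + nf_carry p q k L = nf_carry p q (j + k) L" by auto
qed

lemma nf_shift_0:
  assumes "p \<noteq> 0" "q \<noteq> 0" "nf_valid p q L"
  shows "nf_shift p q 0 L = L" "nf_carry p q 0 L = 0"
proof -
  have "nf_shift p q 0 L = L \<and> nf_carry p q 0 L = 0" using assms(3)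
  proof (induction L)
    case (Cons l L)
    obtain r e where l: "l = (r, e)" by force
    define m where "m = bs_mod p q e"
    have m: "m \<noteq> 0" using assms by (simp add: m_def bs_mod_def)
    have r: "r mod m = r" "nf_valid p q L" using Cons.prems by (simp_all add: l nf_valid_Cons m_def)
    then have "r div m = 0" using m mult_div_mod_eq[of m r] by simp
    then show ?case using r Cons.IH by (simp add: l flip: m_def)
  qed simp
  then show "nf_shift p q 0 L = L" "nf_carry p q 0 L = 0" by auto
qed

text \<open>No pinch can arise: the carry out of a letter of sign \<open>e\<close> is a multiple of
  the modulus of sign \<open>\<not> e\<close>, so it leaves the exponent of a following letter of
  opposite sign unchanged.\<close>

lemma nf_valid_shift:
  assumes "p \<noteq> 0" "q \<noteq> 0" "nf_valid p q L"
  shows "nf_valid p q (nf_shift p q k L)"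
  using assms(3)
proof (induction L arbitrary: k)
  case (Cons l L)
  obtain r e where l: "l = (r, e)" by force
  have v: "nf_valid p q L" "\<forall>L'. L \<noteq> (0, \<not> e) # L'" using Cons.prems by (auto simp: l nf_valid_Cons)
  have "nf_shift p q (c * bs_mod p q (\<not> e)) L \<noteq> (0, \<not> e) # L'" for c L'
  proof (cases L)
    case (Cons l' M)
    obtain r' e' where l': "l' = (r', e')" by force
    have "r' mod bs_mod p q e' = r'" using v(1) by (simp add: Cons l' nf_valid_Cons)
    then show ?thesis using v(2) by (auto simp: Cons l')
  qed simp
  then show ?case using Cons.IH[OF v(1)] by (simp add: l nf_valid_Cons)
qed simp

lemma nf_valid_stable:
  assumes "nf_valid p q L"
  shows "nf_valid p q (nf_stable e L)"
proof (cases L)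
  case (Cons l M)
  then show ?thesis using assms by (cases l) (auto simp: nf_valid_Cons)
qed simp

text \<open>After a cancellation the rest does not start with \<open>(0, e)\<close>, because the
  list was valid; so the inverse letter is put back rather than cancelled again.\<close>

lemma nf_stable_inverse:
  assumes "nf_valid p q L"
  shows "nf_stable (\<not> e) (nf_stable e L) = L"
proof (cases L)
  case (Cons l M)
  obtain r e' where l: "l = (r, e')" by force
  show ?thesis
  proof (cases "r = 0 \<and> e' \<noteq> e")
    case True
    then have *: "\<forall>M'. M \<noteq> (0, e) # M'" using assms by (auto simp: Cons l nf_valid_Cons)
    have "nf_stable (\<not> e) M = (0, \<not> e) # M"
    proof (cases M)
      case (Cons l' N)
      show ?thesis using * by (cases l') (auto simp: Cons)
    qed simp
    then show ?thesis using True by (auto simp: Cons l)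
  qed (auto simp: Cons l)
qed simp

section \<open>Common prefixes and distances in a rooted tree\<close>

fun lcp :: "'a list \<Rightarrow> 'a list \<Rightarrow> nat" where
  "lcp (a # L) (b # M) = (if a = b then Suc (lcp L M) else 0)"
| "lcp _ _ = 0"

lemma lcp_le: "lcp L M \<le> length L" "lcp L M \<le> length M"
  by (induction L M rule: lcp.induct) auto

lemma lcp_commute: "lcp L M = lcp M L"
  by (induction L M rule: lcp.induct) auto

lemma lcp_self [simp]: "lcp L L = length L"
  by (induction L) auto

text \<open>Two prefixes of \<open>K\<close> are comparable, so the shorter one is common to
  \<open>L\<close> and \<open>M\<close>.\<close>

lemma lcp_ultrametric: "min (lcp L K) (lcp K M) \<le> lcp L M"
proof (induction L M arbitrary: K rule: lcp.induct)
  case (1 a L b M)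
  show ?case
  proof (cases K)
    case (Cons c K')
    show ?thesis using "1.IH"[of K'] by (auto simp: Cons)
  qed simp
qed simp_all

lemma lcp_full: "lcp L M = length L \<Longrightarrow> length M = length L \<Longrightarrow> L = M"
proof (induction L arbitrary: M)
  case (Cons a L)
  then show ?case by (cases M) (auto split: if_splits)
qed simp

text \<open>On reduced exponents of one sign, \<open>r \<mapsto> (r + k) mod m\<close> is injective,
  so unequal first letters stay unequal; equal first letters pass the same carry to both
  tails.\<close>

lemma lcp_nf_shift:
  assumes "p \<noteq> 0" "q \<noteq> 0" "nf_valid p q L" "nf_valid p q M"
  shows "lcp (nf_shift p q k L) (nf_shift p q k M) = lcp L M"
  using assms(3,4)
proof (induction L M arbitrary: k rule: lcp.induct)
  case (1 a L b M)
  obtain r e r' e' where ab: "a = (r, e)" "b = (r', e')" by fastforce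
  have v: "nf_valid p q L" "nf_valid p q M" "r mod bs_mod p q e = r" "r' mod bs_mod p q e' = r'"
    using 1 by (auto simp: ab nf_valid_Cons)
  have "r = r'" if "e = e'" "(r + k) mod bs_mod p q e = (r' + k) mod bs_mod p q e'"
    using that v mod_add_cong[of "r + k" "bs_mod p q e" "r' + k" "- k" "- k"] by simp
  then show ?case using "1.IH"[OF _ v(1,2)] by (auto simp: ab)
qed auto

text \<open>The geodesic between two vertices runs through the end of their common prefix.\<close>

definition tree_dist :: "'a list \<Rightarrow> 'a list \<Rightarrow> int" where
  "tree_dist L M = int (length L) + int (length M) - 2 * int (lcp L M)"

lemma nf_cases:
  obtains (Nil) "L = []" | (same) r L' where "L = (r, e) # L'"
    | (other) r L' where "L = (r, \<not> e) # L'" "r \<noteq> (0::int)" | (zero) L' where "L = (0, \<not> e) # L'"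
proof (cases L)
  case (Cons l L')
  obtain r e' where l: "l = (r, e')" by force
  show ?thesis
    using same other zero by (cases "e' = e"; cases "r = 0") (auto simp: Cons l)
qed

text \<open>The delicate case is that one list loses its first letter while the other gains one. The
  total length is then unchanged, and the common prefix is empty before and after: by validity the
  shortened list does not start with \<open>(0, e)\<close>.\<close>

lemma tree_dist_nf_stable:
  assumes "nf_valid p q L" "nf_valid p q M"
  shows "tree_dist (nf_stable e L) (nf_stable e M) = tree_dist L M"
proof -
  have *: "lcp K ((0, e) # N) = 0" "lcp ((0, e) # N) K = 0" if "\<And>K'. K \<noteq> (0, e) # K'" for K N
    using that by (cases K; auto)+
  have vL: "L' \<noteq> (0, e) # K'" if "L = (0, \<not> e) # L'" for L' K'
    using assms(1) that by (auto simp: nf_valid_Cons)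
  have vM: "M' \<noteq> (0, e) # K'" if "M = (0, \<not> e) # M'" for M' K'
    using assms(2) that by (auto simp: nf_valid_Cons)
  show ?thesis
  proof (cases rule: nf_cases[where L = L and e = e])
    case (zero L')
    show ?thesis
      by (cases rule: nf_cases[where L = M and e = e]) (use vL[OF zero] in \<open>auto simp: zero tree_dist_def *\<close>)
  next
    case Nil
    show ?thesis
      by (cases rule: nf_cases[where L = M and e = e]) (use vM in \<open>auto simp: Nil tree_dist_def *\<close>)
  next
    case (same r L')
    show ?thesis
      by (cases rule: nf_cases[where L = M and e = e]) (use vM in \<open>auto simp: same tree_dist_def *\<close>)
  next
    case (other r L')
    show ?thesis
      by (cases rule: nf_cases[where L = M and e = e]) (use vM in \<open>auto simp: other tree_dist_def *\<close>)
  qed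
qed

section \<open>The Bass--Serre tree\<close>

locale bs = group G for G :: "bs_gen word set monoid" (structure) +
  fixes p n q :: int and x t :: "bs_gen word set"
  assumes G_eq: "G = BS p q" and x_eq: "x = BS_x p q" and t_eq: "t = BS_t p q"
    and p_gt: "p > 1" and n_gt: "\<bar>n\<bar> > 1" and q_eq: "q = p * n"
begin

lemma p_ne [simp]: "p \<noteq> 0" and n_ne [simp]: "n \<noteq> 0" and q_ne [simp]: "q \<noteq> 0"
  using p_gt n_gt by (auto simp: q_eq)

lemma G_presented: "G = presented_group UNIV (BS_rels p q)"
  by (simp add: G_eq BS_def)

lemma x_closed [simp]: "x \<in> carrier G" and t_closed [simp]: "t \<in> carrier G"
  by (simp_all add: x_eq t_eq BS_x_def BS_t_def G_presented pres_gen_closed)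

text \<open>The target is left open: besides \<open>G\<close> itself it will be the permutation
  group of the normal forms, the integers, and the group presented by the relations for
  automorphisms.\<close>

definition bs_hom :: "('b, 'm) monoid_scheme \<Rightarrow> 'b \<Rightarrow> 'b \<Rightarrow> bs_gen word set \<Rightarrow> 'b" where
  "bs_hom H a b = pres_hom UNIV (BS_rels p q) H (case_bs_gen a b)"

lemma eval_BS_rels:
  assumes "group H" "f \<in> UNIV \<rightarrow> carrier H" "(l, r) \<in> BS_rels p q"
  shows "eval_word H f l = eval_word H f r \<longleftrightarrow>
    f GenT \<otimes>\<^bsub>H\<^esub> f GenX [^]\<^bsub>H\<^esub> p \<otimes>\<^bsub>H\<^esub> inv\<^bsub>H\<^esub> (f GenT) = f GenX [^]\<^bsub>H\<^esub> q"
proof -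
  interpret H: group H by fact
  have c: "f GenX \<in> carrier H" "f GenT \<in> carrier H" using assms(2) by auto
  have *: "w \<in> lists (UNIV \<times> UNIV)" for w :: "bs_gen word" by (simp add: lists_UNIV)
  show ?thesis
    using assms(3) c
    by (auto simp: BS_rels_def H.eval_word_append[OF assms(2) * *] H.eval_word_inv[OF assms(2) *]
        H.eval_word_letter H.eval_word_letter_pow H.m_assoc)
qed

lemma bs_hom:
  assumes "group H" "a \<in> carrier H" "b \<in> carrier H"
    and "b \<otimes>\<^bsub>H\<^esub> a [^]\<^bsub>H\<^esub> p \<otimes>\<^bsub>H\<^esub> inv\<^bsub>H\<^esub> b = a [^]\<^bsub>H\<^esub> q"
  shows "bs_hom H a b \<in> hom G H" "bs_hom H a b x = a" "bs_hom H a b t = b"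
proof -
  have f: "case_bs_gen a b \<in> UNIV \<rightarrow> carrier H" using assms by (auto split: bs_gen.split)
  have r: "eval_word H (case_bs_gen a b) l = eval_word H (case_bs_gen a b) r"
    if "(l, r) \<in> BS_rels p q" for l r
    using eval_BS_rels[OF assms(1) f that] assms(4) by simp
  show "bs_hom H a b \<in> hom G H"
    unfolding bs_hom_def G_presented by (rule pres_hom_hom[OF assms(1) f r])
  show "bs_hom H a b x = a" "bs_hom H a b t = b"
    unfolding bs_hom_def x_eq t_eq BS_x_def BS_t_def
    using pres_hom_gen[OF assms(1) f r, of "BS_rels p q"] by simp_all
qed

lemma bs_hom_extensional: "bs_hom H a b \<in> extensional (carrier G)"
  unfolding bs_hom_def pres_hom_def G_presented by simp

lemma bs_rel: "t \<otimes> x [^] p \<otimes> inv t = x [^] q"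
proof -
  have f: "pres_gen UNIV (BS_rels p q) \<in> UNIV \<rightarrow> carrier G"
    by (simp add: G_presented pres_gen_closed)
  obtain l r where lr: "(l, r) \<in> BS_rels p q" by (auto simp: BS_rels_def)
  have "eval_word G (pres_gen UNIV (BS_rels p q)) l = eval_word G (pres_gen UNIV (BS_rels p q)) r"
    unfolding G_presented by (rule presented_group_rel[OF lr]) (simp_all add: lists_UNIV)
  then show ?thesis
    using eval_BS_rels[OF is_group f lr] by (simp add: x_eq t_eq BS_x_def BS_t_def)
qed

lemma generate_xt: "generate G {x, t} = carrier G"
proof -
  have "range (pres_gen UNIV (BS_rels p q)) = {x, t}"
    by (simp add: range_bs_gen x_eq t_eq BS_x_def BS_t_def)
  then show ?thesis using generate_presented_group[of UNIV "BS_rels p q"] by (simp add: G_presented)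
qed

lemma G_induct [consumes 1, case_names one x t inv mult]:
  assumes "g \<in> carrier G" "P \<one>" "P x" "P t"
    and i: "\<And>g. g \<in> carrier G \<Longrightarrow> P g \<Longrightarrow> P (inv g)"
    and m: "\<And>g h. g \<in> carrier G \<Longrightarrow> h \<in> carrier G \<Longrightarrow> P g \<Longrightarrow> P h \<Longrightarrow> P (g \<otimes> h)"
  shows "P g"
proof -
  have "g \<in> generate G {x, t}" using assms(1) generate_xt by simp
  then have "g \<in> carrier G \<and> P g"
    by (induction rule: generate.induct) (auto simp: assms(2-4) i m)
  then show ?thesis by simp
qed

lemma hom_eqI:
  assumes H: "group H" and h: "h \<in> hom G H" and k: "k \<in> hom G H" and "h x = k x" "h t = k t"
    and g: "g \<in> carrier G"
  shows "h g = k g"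
  using hom_eq_on_generate[OF is_group H h k, of "{x, t}" g] assms by (auto simp: generate_xt)

lemma mod_ne [simp]: "bs_mod p q e \<noteq> 0"
  by (simp add: bs_mod_def)

text \<open>The pair \<open>(L, a)\<close> stands for the group element spelled by \<open>L\<close>
  times \<open>x^a\<close>, and \<open>L\<close> alone for the coset of
  \<open>\<langle>x\<rangle>\<close>, a vertex of the tree. Keeping \<open>a\<close> makes the
  action on pairs the regular one.\<close>

definition NF :: "((int \<times> bool) list \<times> int) set" where
  "NF = {(L, a). nf_valid p q L}"

definition nf_x :: "int \<Rightarrow> (int \<times> bool) list \<times> int \<Rightarrow> (int \<times> bool) list \<times> int" where
  "nf_x k = (\<lambda>v\<in>NF. (nf_shift p q k (fst v), nf_carry p q k (fst v) + snd v))"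

definition nf_t :: "bool \<Rightarrow> (int \<times> bool) list \<times> int \<Rightarrow> (int \<times> bool) list \<times> int" where
  "nf_t e = (\<lambda>v\<in>NF. (nf_stable e (fst v), snd v))"

lemma nf_x_add: "v \<in> NF \<Longrightarrow> nf_x j (nf_x k v) = nf_x (j + k) v"
  using nf_shift_add[OF p_ne q_ne, of j k "fst v"]
  by (auto simp: nf_x_def NF_def nf_valid_shift add.assoc)

lemma nf_x_0: "v \<in> NF \<Longrightarrow> nf_x 0 v = v"
  by (auto simp: nf_x_def NF_def nf_shift_0)

lemma nf_x_closed: "v \<in> NF \<Longrightarrow> nf_x k v \<in> NF"
  by (auto simp: nf_x_def NF_def nf_valid_shift)

lemma nf_t_closed: "v \<in> NF \<Longrightarrow> nf_t e v \<in> NF"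
  by (auto simp: nf_t_def NF_def nf_valid_stable)

lemma nf_x_Bij: "nf_x k \<in> Bij NF"
proof -
  have "bij_betw (nf_x k) NF NF"
    by (rule bij_betw_byWitness[where f' = "nf_x (- k)"]) (auto simp: nf_x_add nf_x_0 nf_x_closed)
  then show ?thesis by (simp add: Bij_def nf_x_def)
qed

lemma nf_t_Bij: "nf_t e \<in> Bij NF"
proof -
  have *: "nf_t (\<not> e) (nf_t e v) = v" if "v \<in> NF" for v e
    using that nf_stable_inverse[of p q "fst v" e] nf_t_closed[OF that]
    by (auto simp: nf_t_def NF_def nf_valid_stable)
  have "bij_betw (nf_t e) NF NF"
    using *[of _ "\<not> e"]
    by (intro bij_betw_byWitness[where f' = "nf_t (\<not> e)"]) (auto simp: * nf_t_closed)
  then show ?thesis by (simp add: Bij_def nf_t_def)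
qed

lemma nf_x_mult: "nf_x j \<otimes>\<^bsub>BijGroup NF\<^esub> nf_x k = nf_x (j + k)"
proof -
  have "compose NF (nf_x j) (nf_x k) = nf_x (j + k)"
    by (rule extensionalityI[where A = NF]) (auto simp: compose_def nf_x_add, simp add: nf_x_def)
  then show ?thesis by (simp add: mult_BijGroup nf_x_Bij)
qed

lemma nf_x_pow: "nf_x 1 [^]\<^bsub>BijGroup NF\<^esub> k = nf_x k"
proof -
  interpret group_hom integer_group "BijGroup NF" nf_x
    by (auto simp: group_hom_def group_hom_axioms_def group_BijGroup nf_x_Bij nf_x_mult intro!: homI)
  show ?thesis using hom_int_pow[of 1 k] by simp
qed

text \<open>The relation \<open>t x^p = x^q t\<close> on lists. A shift by \<open>q\<close> passes a
  leading \<open>(0, True)\<close> with carry \<open>p\<close>, and a shift by \<open>p\<close> does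
  not alter the exponent of a leading letter of sign \<open>False\<close>, so both sides cancel in
  the same cases.\<close>

lemma nf_stable_shift:
  assumes "nf_valid p q L"
  shows "nf_stable True (nf_shift p q p L) = nf_shift p q q (nf_stable True L)"
    and "nf_carry p q p L = nf_carry p q q (nf_stable True L)"
proof -
  have "nf_stable True (nf_shift p q p L) = nf_shift p q q (nf_stable True L) \<and>
    nf_carry p q p L = nf_carry p q q (nf_stable True L)"
  proof (cases rule: nf_cases[where L = L and e = True])
    case (other r L')
    then have "r mod p = r" using assms by (simp add: nf_valid_Cons bs_mod_def)
    then show ?thesis using other by (simp add: bs_mod_def)
  qed (simp_all add: bs_mod_def)
  then show "nf_stable True (nf_shift p q p L) = nf_shift p q q (nf_stable True L)"
    "nf_carry p q p L = nf_carry p q q (nf_stable True L)" by auto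
qed

definition act :: "bs_gen word set \<Rightarrow> (int \<times> bool) list \<times> int \<Rightarrow> (int \<times> bool) list \<times> int" where
  "act = bs_hom (BijGroup NF) (nf_x 1) (nf_t True)"

lemma act: "act \<in> hom G (BijGroup NF)" "act x = nf_x 1" "act t = nf_t True"
proof -
  interpret H: group "BijGroup NF" by (rule group_BijGroup)
  have "compose NF (nf_t True) (nf_x p) = compose NF (nf_x q) (nf_t True)"
  proof (rule extensionalityI[where A = NF])
    fix v assume v: "v \<in> NF"
    then have "nf_valid p q (fst v)" by (auto simp: NF_def)
    then show "compose NF (nf_t True) (nf_x p) v = compose NF (nf_x q) (nf_t True) v"
      using v nf_x_closed[of v p] nf_t_closed[of v True]
      by (simp add: compose_def nf_x_def nf_t_def nf_stable_shift)
  qed auto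
  then have "nf_t True \<otimes>\<^bsub>BijGroup NF\<^esub> nf_x 1 [^]\<^bsub>BijGroup NF\<^esub> p
      = nf_x 1 [^]\<^bsub>BijGroup NF\<^esub> q \<otimes>\<^bsub>BijGroup NF\<^esub> nf_t True"
    by (simp add: nf_x_pow mult_BijGroup nf_x_Bij nf_t_Bij)
  then have *: "nf_t True \<otimes>\<^bsub>BijGroup NF\<^esub> nf_x 1 [^]\<^bsub>BijGroup NF\<^esub> p \<otimes>\<^bsub>BijGroup NF\<^esub> inv\<^bsub>BijGroup NF\<^esub> nf_t True
      = nf_x 1 [^]\<^bsub>BijGroup NF\<^esub> q"
    by (intro H.conj_eq_iff[THEN iffD2]) (simp_all add: nf_x_pow nf_x_Bij nf_t_Bij)
  show "act \<in> hom G (BijGroup NF)" "act x = nf_x 1" "act t = nf_t True"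
    using bs_hom[OF group_BijGroup _ _ *] unfolding act_def by (simp_all add: nf_x_Bij nf_t_Bij)
qed

sublocale act: group_hom G "BijGroup NF" act
  using act(1) by (simp add: group_hom_def group_hom_axioms_def group_BijGroup)

declare act.hom_mult [simp del] act.hom_inv [simp del]

lemma act_Bij: "g \<in> carrier G \<Longrightarrow> act g \<in> Bij NF"
  using act.hom_closed by simp

lemma act_closed: "g \<in> carrier G \<Longrightarrow> v \<in> NF \<Longrightarrow> act g v \<in> NF"
  using Bij_imp_funcset[OF act_Bij] by auto

lemma act_mult: "g \<in> carrier G \<Longrightarrow> h \<in> carrier G \<Longrightarrow> v \<in> NF \<Longrightarrow> act (g \<otimes> h) v = act g (act h v)"
  by (simp add: act.hom_mult mult_BijGroup act_Bij compose_eq)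

lemma act_one: "v \<in> NF \<Longrightarrow> act \<one> v = v"
  by simp

lemma act_inv: "g \<in> carrier G \<Longrightarrow> v \<in> NF \<Longrightarrow> act g (act (inv g) v) = v"
  by (simp flip: act_mult)

lemma act_x_pow: "act (x [^] k) = nf_x k"
  by (simp add: act.hom_int_pow act nf_x_pow)

lemma tree_dist_act:
  assumes "g \<in> carrier G" "v \<in> NF" "w \<in> NF"
  shows "tree_dist (fst (act g v)) (fst (act g w)) = tree_dist (fst v) (fst w)"
proof -
  have "\<forall>v\<in>NF. \<forall>w\<in>NF. tree_dist (fst (act g v)) (fst (act g w)) = tree_dist (fst v) (fst w)"
    using assms(1)
  proof (induction rule: G_induct)
    case x
    then show ?case
      by (auto simp: act nf_x_def NF_def tree_dist_def lcp_nf_shift)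
  next
    case t
    then show ?case
      by (auto simp: act nf_t_def NF_def tree_dist_nf_stable)
  next
    case (inv g)
    show ?case
    proof (intro ballI)
      fix v w assume "v \<in> NF" "w \<in> NF"
      then show "tree_dist (fst (act (inv g) v)) (fst (act (inv g) w)) = tree_dist (fst v) (fst w)"
        using inv(2)[rule_format, of "act (inv g) v" "act (inv g) w"] inv(1)
        by (simp add: act_inv act_closed)
    qed
  next
    case (mult g h)
    then show ?case by (simp add: act_mult act_closed)
  qed (simp add: act_one del: act.hom_one)
  then show ?thesis using assms by simp
qed

section \<open>The orbit of the root: vertices, lengths and overlaps\<close>

definition vertex :: "bs_gen word set \<Rightarrow> (int \<times> bool) list" where
  "vertex g = fst (act g ([], 0))"

definition xpart :: "bs_gen word set \<Rightarrow> int" where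
  "xpart g = snd (act g ([], 0))"

definition len :: "bs_gen word set \<Rightarrow> int" where
  "len g = int (length (vertex g))"

text \<open>The Gromov product of the two vertices with respect to the root.\<close>

definition overlap :: "bs_gen word set \<Rightarrow> bs_gen word set \<Rightarrow> int" where
  "overlap g h = int (lcp (vertex g) (vertex h))"

lemma base_NF [simp]: "([], a) \<in> NF"
  by (simp add: NF_def)

lemma vertex_valid: "g \<in> carrier G \<Longrightarrow> nf_valid p q (vertex g)"
  using act_closed[of g "([], 0)"] by (auto simp: vertex_def NF_def)

text \<open>Elements act by isometries, so the length of \<open>inv g \<otimes> h\<close> is the
  distance between the vertices of \<open>g\<close> and \<open>h\<close>. Every computation of
  cancellation goes through this formula.\<close>

lemma len_inv_mult:
  assumes "g \<in> carrier G" "h \<in> carrier G"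
  shows "len (inv g \<otimes> h) = len g + len h - 2 * overlap g h"
proof -
  have "tree_dist (fst (act (inv g) (act h ([], 0)))) (fst (act (inv g) (act g ([], 0))))
      = tree_dist (vertex h) (vertex g)"
    using tree_dist_act[of "inv g" "act h ([], 0)" "act g ([], 0)"] assms
    by (simp add: act_closed vertex_def)
  moreover have "act (inv g) (act g ([], 0)) = ([], 0)"
    using assms by (simp flip: act_mult)
  moreover have "act (inv g) (act h ([], 0)) = act (inv g \<otimes> h) ([], 0)"
    using assms by (simp add: act_mult)
  ultimately show ?thesis
    by (simp add: tree_dist_def len_def overlap_def vertex_def lcp_commute)
qed

lemma overlap_ultrametric: "min (overlap g k) (overlap k h) \<le> overlap g h"
  using lcp_ultrametric[of "vertex g" "vertex k" "vertex h"] by (simp add: overlap_def)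

lemma overlap_commute: "overlap g h = overlap h g"
  by (simp add: overlap_def lcp_commute)

lemma overlap_le: "overlap g h \<le> len g" "overlap g h \<le> len h" "0 \<le> overlap g h"
  using lcp_le[of "vertex g" "vertex h"] by (simp_all add: overlap_def len_def)

lemma overlap_self: "overlap g g = len g"
  by (simp add: overlap_def len_def)

lemma len_nonneg: "0 \<le> len g"
  by (simp add: len_def)

lemma vertex_one [simp]: "vertex \<one> = []"
  by (simp add: vertex_def)

lemma len_one [simp]: "len \<one> = 0"
  by (simp add: len_def)

lemma overlap_one [simp]: "overlap g \<one> = 0" "overlap \<one> g = 0"
  by (simp_all add: overlap_def)

lemma len_inv: "g \<in> carrier G \<Longrightarrow> len (inv g) = len g"
  using len_inv_mult[of g \<one>] by simp

lemma len_mult: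
  "g \<in> carrier G \<Longrightarrow> h \<in> carrier G \<Longrightarrow> len (g \<otimes> h) = len g + len h - 2 * overlap (inv g) h"
  using len_inv_mult[of "inv g" h] by (simp add: len_inv)

lemma vertex_x_pow_mult: "g \<in> carrier G \<Longrightarrow> vertex (x [^] k \<otimes> g) = nf_shift p q k (vertex g)"
  by (simp add: vertex_def act_mult act_x_pow nf_x_def act_closed)

lemma xpart_x_pow_mult:
  "g \<in> carrier G \<Longrightarrow> xpart (x [^] k \<otimes> g) = nf_carry p q k (vertex g) + xpart g"
  by (simp add: xpart_def vertex_def act_mult act_x_pow nf_x_def act_closed)

lemma vertex_x_pow [simp]: "vertex (x [^] (k::int)) = []"
  using vertex_x_pow_mult[of \<one> k] by simp

lemma xpart_x_pow [simp]: "xpart (x [^] (k::int)) = k"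
  using xpart_x_pow_mult[of \<one> k] by (simp add: xpart_def)

lemma vertex_t_mult: "g \<in> carrier G \<Longrightarrow> vertex (t \<otimes> g) = nf_stable True (vertex g)"
  by (simp add: vertex_def act_mult act nf_t_def act_closed)

lemma vertex_t_inv_mult:
  assumes "g \<in> carrier G"
  shows "vertex (inv t \<otimes> g) = nf_stable False (vertex g)"
proof -
  have "vertex g = nf_stable True (vertex (inv t \<otimes> g))"
    using vertex_t_mult[of "inv t \<otimes> g"] assms by simp
  then show ?thesis using nf_stable_inverse[OF vertex_valid, of "inv t \<otimes> g" True] assms by simp
qed

lemma len_x_pow_mult: "g \<in> carrier G \<Longrightarrow> len (x [^] (k::int) \<otimes> g) = len g"
  by (simp add: len_def vertex_x_pow_mult)

lemma overlap_x_pow_mult: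
  "g \<in> carrier G \<Longrightarrow> h \<in> carrier G \<Longrightarrow>
    overlap (x [^] (k::int) \<otimes> g) (x [^] k \<otimes> h) = overlap g h"
  by (simp add: overlap_def vertex_x_pow_mult lcp_nf_shift vertex_valid)

text \<open>Powers of \<open>x\<close> fix the root, so both elements move the root to vertices at
  distance 0.\<close>

lemma vertex_mult_x_pow:
  assumes "g \<in> carrier G"
  shows "vertex (g \<otimes> x [^] (k::int)) = vertex g"
proof -
  have "tree_dist (fst (act g (act (x [^] k) ([], 0)))) (vertex g) = 0"
    using tree_dist_act[of g "act (x [^] k) ([], 0)" "([], 0)"] assms
    by (simp add: act_closed act_x_pow nf_x_def vertex_def tree_dist_def)
  then have "tree_dist (vertex (g \<otimes> x [^] k)) (vertex g) = 0"
    using assms by (simp add: vertex_def act_mult)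
  then show ?thesis
    using lcp_le[of "vertex (g \<otimes> x [^] k)" "vertex g"] lcp_full[of "vertex (g \<otimes> x [^] k)" "vertex g"]
    by (simp add: tree_dist_def)
qed

lemma len_mult_x_pow: "g \<in> carrier G \<Longrightarrow> len (g \<otimes> x [^] (k::int)) = len g"
  by (simp add: len_def vertex_mult_x_pow)

section \<open>Normal form expansion of group elements\<close>

lemma bs_rel_t: "t \<otimes> x [^] (p * k) = x [^] (q * k) \<otimes> t"
proof -
  have "(t \<otimes> x [^] p \<otimes> inv t) [^] k = x [^] (q * k)" by (simp add: bs_rel int_pow_pow)
  then have "t \<otimes> x [^] (p * k) \<otimes> inv t = x [^] (q * k)" by (simp add: conj_int_pow int_pow_pow)
  then show ?thesis by (simp add: conj_eq_iff)
qed

lemma bs_rel_t_inv: "inv t \<otimes> x [^] (q * k) = x [^] (p * k) \<otimes> inv t"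
proof -
  have "inv t \<otimes> (t \<otimes> x [^] (p * k)) \<otimes> inv t = inv t \<otimes> (x [^] (q * k) \<otimes> t) \<otimes> inv t"
    by (simp only: bs_rel_t)
  then show ?thesis by (simp add: m_assoc)
qed

definition stable :: "bool \<Rightarrow> bs_gen word set" where
  "stable e = (if e then t else inv t)"

lemma stable_closed [simp]: "stable e \<in> carrier G"
  by (simp add: stable_def)

lemma stable_cancel: "g \<in> carrier G \<Longrightarrow> stable e \<otimes> (stable (\<not> e) \<otimes> g) = g"
  by (simp add: stable_def)

lemma x_pow_stable: "x [^] (k * bs_mod p q e) \<otimes> stable e = stable e \<otimes> x [^] (k * bs_mod p q (\<not> e))"
  using bs_rel_t[of k] bs_rel_t_inv[of k] by (simp add: bs_mod_def stable_def mult.commute)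

fun nf_prod :: "(int \<times> bool) list \<Rightarrow> bs_gen word set" where
  "nf_prod [] = \<one>"
| "nf_prod ((r, e) # L) = x [^] r \<otimes> stable e \<otimes> nf_prod L"

lemma nf_prod_closed [simp]: "nf_prod L \<in> carrier G"
  by (induction L rule: nf_prod.induct) auto

lemma x_pow_nf_prod: "x [^] k \<otimes> nf_prod L = nf_prod (nf_shift p q k L) \<otimes> x [^] nf_carry p q k L"
proof (induction L arbitrary: k rule: nf_prod.induct)
  case (2 r e L)
  define m d where "m = bs_mod p q e" and "d = (r + k) div m"
  have "x [^] k \<otimes> nf_prod ((r, e) # L) = x [^] (k + r) \<otimes> stable e \<otimes> nf_prod L"
    by (simp add: int_pow_mult m_assoc)
  also have "k + r = (r + k) mod m + d * m" unfolding d_def by simp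
  also have "x [^] ((r + k) mod m + d * m) \<otimes> stable e \<otimes> nf_prod L
      = x [^] ((r + k) mod m) \<otimes> (x [^] (d * m) \<otimes> stable e) \<otimes> nf_prod L"
    by (simp add: int_pow_mult m_assoc)
  also have "x [^] (d * m) \<otimes> stable e = stable e \<otimes> x [^] (d * bs_mod p q (\<not> e))"
    unfolding m_def by (rule x_pow_stable)
  also have "x [^] ((r + k) mod m) \<otimes> (stable e \<otimes> x [^] (d * bs_mod p q (\<not> e))) \<otimes> nf_prod L
      = x [^] ((r + k) mod m) \<otimes> stable e \<otimes> (x [^] (d * bs_mod p q (\<not> e)) \<otimes> nf_prod L)"
    by (simp add: m_assoc)
  also have "\<dots> = x [^] ((r + k) mod m) \<otimes> stable e \<otimes> (nf_prod (nf_shift p q (d * bs_mod p q (\<not> e)) L)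
      \<otimes> x [^] nf_carry p q (d * bs_mod p q (\<not> e)) L)"
    by (simp only: 2)
  finally show ?case by (simp add: m_assoc flip: m_def d_def)
qed simp

lemma nf_prod_stable:
  "nf_prod (nf_stable e L) = stable e \<otimes> nf_prod L"
  by (cases rule: nf_cases[where L = L and e = e]) (auto simp: stable_cancel m_assoc)

definition nf_value :: "(int \<times> bool) list \<times> int \<Rightarrow> bs_gen word set" where
  "nf_value v = nf_prod (fst v) \<otimes> x [^] snd v"

text \<open>Evaluating normal forms is equivariant for left multiplication. Applied to the base
  point it recovers each group element from its vertex and its exponent.\<close>

lemma nf_value_act:
  assumes "g \<in> carrier G" "v \<in> NF"
  shows "nf_value (act g v) = g \<otimes> nf_value v"
proof -
  have "\<forall>v\<in>NF. nf_value (act g v) = g \<otimes> nf_value v"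
    using assms(1)
  proof (induction rule: G_induct)
    case one
    then show ?case by (simp add: nf_value_def)
  next
    case x
    have "x \<otimes> nf_prod L = nf_prod (nf_shift p q 1 L) \<otimes> x [^] nf_carry p q 1 L" for L
      using x_pow_nf_prod[of 1] by simp
    then show ?case
      by (simp add: nf_value_def act nf_x_def int_pow_mult flip: m_assoc)
  next
    case t
    then show ?case
      by (simp add: nf_value_def act nf_t_def nf_prod_stable stable_def m_assoc)
  next
    case (inv g)
    show ?case
    proof
      fix v assume v: "v \<in> NF"
      then have "nf_value v = g \<otimes> nf_value (act (inv g) v)"
        using inv by (metis act_closed act_inv inv_closed)
      then show "nf_value (act (inv g) v) = inv g \<otimes> nf_value v"
        using inv by (simp add: nf_value_def)
    qed
  next
    case (mult g h)
    then show ?case by (simp add: act_mult act_closed m_assoc) (simp add: nf_value_def m_assoc)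
  qed
  then show ?thesis using assms by simp
qed

lemma nf_expansion: "g \<in> carrier G \<Longrightarrow> g = nf_prod (vertex g) \<otimes> x [^] xpart g"
  using nf_value_act[of g "([], 0)"] by (simp add: nf_value_def vertex_def xpart_def)

lemma vertex_Nil: "g \<in> carrier G \<Longrightarrow> vertex g = [] \<Longrightarrow> g = x [^] xpart g"
  using nf_expansion[of g] by simp

lemma len_eq_0: "g \<in> carrier G \<Longrightarrow> len g = 0 \<Longrightarrow> g = x [^] xpart g"
  using vertex_Nil[of g] by (simp add: len_def)

lemma x_pow_inj: "x [^] (j::int) = x [^] k \<longleftrightarrow> j = k"
  using xpart_x_pow by metis

text \<open>The exponent sum of \<open>t\<close>.\<close>

definition height :: "bs_gen word set \<Rightarrow> int" where
  "height = bs_hom integer_group 0 1"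

lemma height: "height \<in> hom G integer_group" "height x = 0" "height t = 1"
  using bs_hom[of integer_group 0 1] unfolding height_def by simp_all

sublocale height: group_hom G integer_group height
  using height(1) by (simp add: group_hom_def group_hom_axioms_def)

lemma height_mult: "g \<in> carrier G \<Longrightarrow> h \<in> carrier G \<Longrightarrow> height (g \<otimes> h) = height g + height h"
  by simp

lemma height_x_pow [simp]: "height (x [^] (k::int)) = 0"
  by (simp add: height.hom_int_pow height)

text \<open>Each letter of the normal form changes the height by one, up or down.\<close>

lemma height_len:
  assumes "g \<in> carrier G"
  shows "\<bar>height g\<bar> \<le> len g" "even (height g + len g)"
proof -
  have "\<bar>height (nf_prod L)\<bar> \<le> int (length L) \<and> even (height (nf_prod L) + int (length L))" for L
    by (induction L rule: nf_prod.induct) (auto simp: stable_def height)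
  moreover have "height g = height (nf_prod (vertex g))"
    using nf_expansion[OF assms] height_mult[of "nf_prod (vertex g)" "x [^] xpart g"] by simp
  ultimately show "\<bar>height g\<bar> \<le> len g" "even (height g + len g)" by (simp_all add: len_def)
qed

end

lemma nf_valid_take: "nf_valid p q L \<Longrightarrow> nf_valid p q (take m L)"
proof (induction L arbitrary: m)
  case (Cons l L)
  obtain r e where l: "l = (r, e)" by force
  show ?case
  proof (cases m)
    case (Suc k)
    have "take k L \<noteq> (0, \<not> e) # L'" for L'
      using Cons.prems by (cases L; cases k) (auto simp: l nf_valid_Cons)
    then show ?thesis using Cons by (simp add: l nf_valid_Cons Suc)
  qed simp
qed simp

lemma lcp_take: "m \<le> length L \<Longrightarrow> lcp (take m L) L = m"
proof (induction L arbitrary: m)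
  case (Cons a L)
  then show ?case by (cases m) auto
qed simp

text \<open>This will contradict an exponential lower bound and a linear upper bound on the lengths
  of the same elements.\<close>

lemma exp_dominates_linear:
  fixes A C :: int
  shows "\<exists>k. A * int k + C < 2 ^ k"
proof -
  \<comment> \<open>\<open>B\<close> exceeds \<open>\<bar>A\<bar> + \<bar>C\<bar>\<close>, so that
    \<open>B * B\<close> bounds the linear term, and is at least 5, from where on squares stay below
    powers of two.\<close>
  define B where "B = nat \<bar>A\<bar> + nat \<bar>C\<bar> + 5"
  have sq: "k\<^sup>2 < 2 ^ k" if "5 \<le> k" for k :: nat
    using that
  proof (induction k rule: dec_induct)
    case (step k)
    have "(Suc k)\<^sup>2 = k\<^sup>2 + 2 * k + 1" by (simp add: power2_eq_square)
    moreover have "5 * k \<le> k * k" using step(1) by (rule mult_le_mono1)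
    then have "2 * k + 1 \<le> k\<^sup>2" using step(1) unfolding power2_eq_square by linarith
    ultimately show ?case using step by simp
  qed simp
  have "A * int B + C \<le> \<bar>A\<bar> * int B + \<bar>C\<bar> * 1"
    by (intro add_mono mult_right_mono) auto
  also have "\<dots> \<le> \<bar>A\<bar> * int B + \<bar>C\<bar> * int B"
    by (intro add_mono mult_left_mono) (auto simp: B_def)
  also have "\<dots> \<le> int B * int B" by (auto simp: B_def simp flip: distrib_right intro!: mult_right_mono)
  also have "int B * int B = int (B\<^sup>2)" by (simp add: power2_eq_square)
  also have "int (B\<^sup>2) < int (2 ^ B)" using sq[of B] by (simp only: of_nat_less_iff) (simp add: B_def)
  finally show ?thesis by auto
qed

context bs
begin

subsection \<open>Cancellation in products\<close>

definition starts :: "bs_gen word set \<Rightarrow> int \<Rightarrow> bool \<Rightarrow> bool" where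
  "starts g r e \<longleftrightarrow> (\<exists>L. vertex g = (r, e) # L)"

lemma starts_unique: "starts g r e \<Longrightarrow> starts g r' e' \<Longrightarrow> r = r' \<and> e = e'"
  by (auto simp: starts_def)

lemma starts_exists: "len g \<noteq> 0 \<Longrightarrow> \<exists>r e. starts g r e"
  by (cases "vertex g") (auto simp: starts_def len_def)

lemma starts_len: "starts g r e \<Longrightarrow> 1 \<le> len g"
  by (auto simp: starts_def len_def)

lemma starts_mod: "g \<in> carrier G \<Longrightarrow> starts g r e \<Longrightarrow> r mod bs_mod p q e = r"
  using vertex_valid[of g] by (auto simp: starts_def nf_valid_Cons)

lemma starts_x_pow:
  "g \<in> carrier G \<Longrightarrow> starts g r e \<Longrightarrow> starts (x [^] (k::int) \<otimes> g) ((r + k) mod bs_mod p q e) e"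
  by (auto simp: starts_def vertex_x_pow_mult)

lemma starts_mult_x_pow:
  "g \<in> carrier G \<Longrightarrow> starts (g \<otimes> x [^] (k::int)) r e \<longleftrightarrow> starts g r e"
  by (simp add: starts_def vertex_mult_x_pow)

lemma starts_overlap: "1 \<le> overlap g h \<Longrightarrow> starts g r e \<Longrightarrow> starts h r e"
  by (cases "vertex h") (auto simp: starts_def overlap_def split: if_splits)

lemma overlap_starts: "starts g r e \<Longrightarrow> starts h r e \<Longrightarrow> 1 \<le> overlap g h"
  by (auto simp: starts_def overlap_def)

lemma overlap_starts_ne: "starts g r e \<Longrightarrow> starts h r' e' \<Longrightarrow> (r, e) \<noteq> (r', e') \<Longrightarrow> overlap g h = 0"
  by (auto simp: starts_def overlap_def)

text \<open>The criterion behind every ping-pong argument: if the geodesics of \<open>inv g\<close>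
  and \<open>h\<close> leave the root along different edges, then nothing cancels, and the geodesic
  of the product begins with that of \<open>g\<close>.\<close>

lemma mult_no_cancel:
  assumes g: "g \<in> carrier G" and h: "h \<in> carrier G"
    and "starts (inv g) r e" "starts h r' e'" "(r, e) \<noteq> (r', e')"
  shows "len (g \<otimes> h) = len g + len h" "starts g a b \<Longrightarrow> starts (g \<otimes> h) a b"
proof -
  show l: "len (g \<otimes> h) = len g + len h"
    using overlap_starts_ne[OF assms(3-5)] len_mult[OF g h] by simp
  \<comment> \<open>Multiplying back by \<open>inv g\<close> gives \<open>h\<close>, so the overlap
    of \<open>g\<close> with the product is all of \<open>g\<close>.\<close>
  have "len (inv g \<otimes> (g \<otimes> h)) = len g + len (g \<otimes> h) - 2 * overlap g (g \<otimes> h)"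
    using g h by (intro len_inv_mult) auto
  then have "overlap g (g \<otimes> h) = len g" using g h l by simp
  then show "starts (g \<otimes> h) a b" if "starts g a b"
    using starts_overlap[of g "g \<otimes> h" a b] starts_len[of g] that by simp
qed

text \<open>The equation says that \<open>x^k\<close> fixes the vertex of \<open>g\<close>, hence
  the first edge on the way to it; the edges of sign \<open>e\<close> at the root are permuted
  cyclically by \<open>x\<close>, with period \<open>bs_mod p q e\<close>.\<close>

lemma mod_dvd_of_fixed:
  assumes "g \<in> carrier G" "starts g r e" "x [^] (k::int) \<otimes> g = g \<otimes> x [^] (j::int)"
  shows "bs_mod p q e dvd k"
proof -
  have "(r + k) mod bs_mod p q e = r"
    using starts_unique starts_x_pow[OF assms(1,2), of k] starts_mult_x_pow[OF assms(1), of j] assms by metis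
  then have "(r + k) mod bs_mod p q e = r mod bs_mod p q e"
    using starts_mod[OF assms(1,2)] by simp
  then show ?thesis
    using mod_eq_dvd_iff[of "r + k" "bs_mod p q e" r] by simp
qed

lemma q_not_dvd_p: "\<not> q dvd p"
proof
  assume "q dvd p"
  then have "\<bar>q\<bar> \<le> p" using dvd_imp_le_int[of p q] p_gt by simp
  moreover have "p * 1 < p * \<bar>n\<bar>" using n_gt p_gt by (intro mult_strict_left_mono) auto
  ultimately show False using p_gt by (simp add: q_eq abs_mult)
qed

lemma mod_not_dvd_1: "\<not> bs_mod p q e dvd 1"
proof -
  have "1 * 1 < p * \<bar>n\<bar>" using p_gt n_gt by (intro mult_strict_mono) auto
  then show ?thesis using p_gt by (simp add: bs_mod_def q_eq abs_mult)
qed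

lemma vertex_t: "vertex t = [(0, True)]"
  using vertex_t_mult[of \<one>] by simp

lemma len_t: "len t = 1"
  by (simp add: len_def vertex_t)

text \<open>No modulus divides 1, so \<open>x\<close> fixes no edge at the root and the root is its
  only fixed vertex. The assumption says that \<open>x\<close> fixes the vertex of
  \<open>inv g\<close>.\<close>

lemma conj_x_eq_pow:
  assumes "g \<in> carrier G" "g \<otimes> x \<otimes> inv g = x [^] (b::int)"
  shows "\<exists>j::int. g = x [^] j" "b = 1"
proof -
  have "g \<otimes> x = x [^] b \<otimes> g" using assms conj_eq_iff by simp
  then have "inv g \<otimes> (g \<otimes> x) \<otimes> inv g = inv g \<otimes> (x [^] b \<otimes> g) \<otimes> inv g" by simp
  then have c: "x [^] (1::int) \<otimes> inv g = inv g \<otimes> x [^] b" using assms(1) by (simp add: m_assoc)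
  have "len (inv g) = 0"
  proof (rule ccontr)
    assume "len (inv g) \<noteq> 0"
    then obtain r e where "starts (inv g) r e" using starts_exists by blast
    then have "bs_mod p q e dvd 1" using mod_dvd_of_fixed[OF _ _ c] assms(1) by simp
    then show False using mod_not_dvd_1 by blast
  qed
  then have "len g = 0" using len_inv assms(1) by simp
  then obtain j :: int where j: "g = x [^] j" using len_eq_0[OF assms(1)] by blast
  then show "\<exists>j::int. g = x [^] j" by blast
  have "x [^] b = x [^] j \<otimes> x [^] (1::int) \<otimes> x [^] (- j)"
    using assms(2) by (simp add: j int_pow_neg)
  also have "\<dots> = x [^] (1::int)"
    by (simp only: int_pow_mult[OF x_closed, symmetric]) simp
  finally show "b = 1" by (simp only: x_pow_inj)
qed

subsection \<open>Lengths of powers\<close>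

lemma overlap_power:
  assumes "g \<in> carrier G"
  shows "2 * overlap g (g [^] Suc k) = len g + len (g [^] Suc k) - len (g [^] k)"
proof -
  have "inv g \<otimes> g [^] Suc k = g [^] k"
    using assms nat_pow_Suc2[of g k] by (simp del: nat_pow_Suc Group.nat_pow_Suc)
  then show ?thesis using len_inv_mult[of g "g [^] Suc k"] assms by simp
qed

lemma len_power_Suc:
  assumes "g \<in> carrier G"
  shows "len (g [^] Suc k) = len g + len (g [^] k) - 2 * overlap (inv g) (g [^] k)"
  using len_mult[OF assms, of "g [^] k"] assms nat_pow_Suc2[of g k] by (simp del: nat_pow_Suc Group.nat_pow_Suc)

text \<open>The hyperbolic case: \<open>overlap g (inv g)\<close> is the distance of the root from
  the axis of \<open>g\<close>, and \<open>len g - 2 * overlap g (inv g)\<close> is the translation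
  length.\<close>

lemma len_power_hyperbolic:
  assumes g: "g \<in> carrier G" and o: "2 * overlap g (inv g) < len g"
  shows "len (g [^] Suc k) = int (Suc k) * (len g - 2 * overlap g (inv g)) + 2 * overlap g (inv g)"
    and "overlap g (g [^] Suc k) > overlap g (inv g)"
proof -
  define d c where "d = len g" and "c = overlap g (inv g)"
  have "len (g [^] Suc k) = int (Suc k) * (d - 2 * c) + 2 * c \<and> overlap g (g [^] Suc k) > c"
  proof (induction k)
    case 0
    show ?case using g o overlap_le(3)[of g "inv g"] by (simp add: d_def c_def overlap_self)
  next
    case (Suc k)
    \<comment> \<open>\<open>g\<close> and its power agree beyond depth \<open>c\<close>, while
      \<open>g\<close> and \<open>inv g\<close> part at depth \<open>c\<close>; the ultrametric
      inequality, used in both directions, gives the overlap of the other pair.\<close>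
    have "overlap (inv g) (g [^] Suc k) = c"
      using overlap_ultrametric[of "inv g" g "g [^] Suc k"]
        overlap_ultrametric[of "inv g" "g [^] Suc k" g] Suc overlap_commute[of "g [^] Suc k" g]
      unfolding c_def overlap_commute[of "inv g" g] by linarith
    then have l: "len (g [^] Suc (Suc k)) = int (Suc (Suc k)) * (d - 2 * c) + 2 * c"
      using len_power_Suc[OF g, of "Suc k"] Suc by (simp only: d_def) (simp add: algebra_simps)
    have "2 * overlap g (g [^] Suc (Suc k)) = 2 * (d - c)"
      using overlap_power[OF g, of "Suc k"] Suc l by (simp only: d_def) (simp add: algebra_simps)
    then show ?case using l o by (simp add: d_def c_def)
  qed
  then show "len (g [^] Suc k) = int (Suc k) * (len g - 2 * overlap g (inv g)) + 2 * overlap g (inv g)"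
    "overlap g (g [^] Suc k) > overlap g (inv g)" by (simp_all add: d_def c_def)
qed

text \<open>The elliptic case: the first halves of the geodesics of \<open>g\<close> and
  \<open>inv g\<close> coincide, \<open>g\<close> fixes the midpoint, and its powers stay bounded.
  The recursion for lengths involves three consecutive powers, so the induction carries two of
  them.\<close>

lemma len_power_elliptic:
  assumes g: "g \<in> carrier G" and o: "len g \<le> 2 * overlap g (inv g)"
  shows "len (g [^] (k::nat)) \<le> len g"
proof -
  have "len (g [^] k) \<le> len g \<and> len (g [^] Suc k) \<le> len g"
  proof (induction k)
    case (Suc k)
    have "len (g [^] Suc k) \<le> 2 * overlap g (g [^] Suc k)"
      using overlap_power[OF g, of k] Suc by linarith
    moreover have "len (g [^] Suc k) \<le> 2 * overlap (inv g) g"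
      using o Suc by (simp add: overlap_commute del: nat_pow_Suc Group.nat_pow_Suc)
    ultimately have "len (g [^] Suc k) \<le> 2 * overlap (inv g) (g [^] Suc k)"
      using overlap_ultrametric[of "inv g" g "g [^] Suc k"] by linarith
    then show ?case using len_power_Suc[OF g, of "Suc k"] Suc by linarith
  qed (use g len_nonneg in auto)
  then show ?thesis by simp
qed

text \<open>The heights of the powers grow linearly and bound their lengths from below, whereas
  elliptic elements have powers of bounded length.\<close>

lemma hyperbolic_if_height:
  assumes g: "g \<in> carrier G" and h: "height g \<noteq> 0"
  shows "2 * overlap g (inv g) < len g"
proof (rule ccontr)
  assume "\<not> 2 * overlap g (inv g) < len g"
  then have *: "len (g [^] k) \<le> len g" for k :: nat using len_power_elliptic[OF g] by simp
  define k where "k = Suc (nat (len g))"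
  have "height (g [^] k) = int k * height g"
    using height.hom_nat_pow[OF g, of k] by simp
  then have "int k * 1 \<le> \<bar>height (g [^] k)\<bar>"
    unfolding abs_mult using h by (simp only: abs_mult) (intro mult_mono, auto)
  also have "\<dots> \<le> len g" using height_len(1)[of "g [^] k"] *[of k] g by simp
  finally show False using len_nonneg[of g] by (simp add: k_def)
qed

lemma vertex_nf_prod: "nf_valid p q L \<Longrightarrow> vertex (nf_prod L) = L"
proof (induction L)
  case (Cons l L)
  obtain r e where l: "l = (r, e)" by force
  have v: "nf_valid p q L" "r mod bs_mod p q e = r" "\<forall>L'. L \<noteq> (0, \<not> e) # L'"
    using Cons.prems by (auto simp: l nf_valid_Cons)
  have "vertex (stable e \<otimes> nf_prod L) = nf_stable e L"
    using Cons.IH[OF v(1)] by (cases e) (simp_all add: stable_def vertex_t_mult vertex_t_inv_mult)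
  also have "nf_stable e L = (0, e) # L"
    using v(3) by (cases rule: nf_cases[where L = L and e = e]) auto
  finally have "vertex (x [^] r \<otimes> (stable e \<otimes> nf_prod L)) = nf_shift p q r ((0, e) # L)"
    by (simp add: vertex_x_pow_mult)
  moreover have "r div bs_mod p q e = 0"
    using v(2) mult_div_mod_eq[of "bs_mod p q e" r] by simp
  ultimately show ?case using v by (simp add: l m_assoc nf_shift_0)
qed simp

text \<open>The midpoint of the geodesic from the root to its image is fixed by \<open>g\<close>.
  Even length makes it a vertex, and then \<open>g\<close> is conjugate into the stabiliser of the
  root.\<close>

lemma elliptic_conj:
  assumes g: "g \<in> carrier G" and o: "len g \<le> 2 * overlap g (inv g)" and ev: "even (len g)"
  shows "\<exists>u\<in>carrier G. \<exists>i::int. g = u \<otimes> x [^] i \<otimes> inv u"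
proof -
  obtain m where m: "length (vertex g) = 2 * m" using ev by (auto simp: len_def)
  \<comment> \<open>The element \<open>u\<close> takes the root to the midpoint; what follows shows
    that \<open>u\<close> and \<open>g u\<close> have the same vertex.\<close>
  define u where "u = nf_prod (take m (vertex g))"
  have u: "u \<in> carrier G" by (simp add: u_def)
  have vu: "vertex u = take m (vertex g)"
    unfolding u_def using g by (intro vertex_nf_prod nf_valid_take vertex_valid)
  have lens: "len g = 2 * int m" "len u = int m" using m by (simp_all add: len_def vu)
  have ug: "overlap u g = int m" by (simp add: overlap_def vu lcp_take m)
  have "int m \<le> overlap u (inv g)"
    using overlap_ultrametric[of u g "inv g"] ug o lens by linarith
  then have "overlap (inv g) u = int m"
    using overlap_le(1)[of u "inv g"] lens by (simp add: overlap_commute)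
  then have lgu: "len (g \<otimes> u) = int m" using len_mult[OF g u] lens by simp
  have "overlap g (g \<otimes> u) = int m"
    using len_inv_mult[of g "g \<otimes> u"] g u lgu lens by simp
  then have "int m \<le> overlap u (g \<otimes> u)"
    using overlap_ultrametric[of u g "g \<otimes> u"] ug by simp
  then have "len (inv u \<otimes> (g \<otimes> u)) = 0"
    using len_inv_mult[of u "g \<otimes> u"] len_nonneg[of "inv u \<otimes> (g \<otimes> u)"] g u lgu lens by simp
  then obtain i :: int where i: "inv u \<otimes> (g \<otimes> u) = x [^] i"
    using len_eq_0[of "inv u \<otimes> (g \<otimes> u)"] g u by auto
  then have "u \<otimes> x [^] i \<otimes> inv u = u \<otimes> (inv u \<otimes> (g \<otimes> u)) \<otimes> inv u" by simp
  also have "\<dots> = g" using g u by (simp add: m_assoc)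
  finally show ?thesis using u by metis
qed

lemma len_mult_le:
  assumes "g \<in> carrier G" "h \<in> carrier G"
  shows "len (g \<otimes> h) \<le> len g + len h"
  using len_mult[OF assms] overlap_le(3)[of "inv g" h] by linarith

text \<open>The element \<open>a^(p*n^k)\<close> is the conjugate of \<open>a^p\<close> by
  \<open>b^k\<close>, so its length grows at most linearly in \<open>k\<close>. For hyperbolic
  \<open>a\<close> the length would be at least \<open>p \<bar>n\<bar>^k\<close>. The length of
  \<open>a\<close> is even because \<open>p \<noteq> q\<close> forces height 0.\<close>

lemma elliptic_of_bs_rel:
  assumes a: "a \<in> carrier G" and b: "b \<in> carrier G"
    and rel: "b \<otimes> a [^] p \<otimes> inv b = a [^] q"
  shows "\<exists>u\<in>carrier G. \<exists>i::int. a = u \<otimes> x [^] i \<otimes> inv u"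
proof -
  have "height (b \<otimes> a [^] p \<otimes> inv b) = height (a [^] q)" by (simp only: rel)
  then have "p * height a = q * height a" using a b by (simp add: height.hom_int_pow)
  then have "height a = 0" using n_gt by (auto simp: q_eq)
  then have ev: "even (len a)" using height_len(2)[OF a] by simp
  have "len a \<le> 2 * overlap a (inv a)"
  proof (rule ccontr)
    assume "\<not> len a \<le> 2 * overlap a (inv a)"
    then have hyp: "2 * overlap a (inv a) < len a" by simp
    have lower: "int k \<le> len (a [^] k)" for k :: nat
    proof (cases k)
      case (Suc m)
      define Y where "Y = int (Suc m) * (len a - 2 * overlap a (inv a))"
      have "int (Suc m) * 1 \<le> Y"
        unfolding Y_def using hyp by (intro mult_left_mono) auto
      then have "int (Suc m) \<le> Y" by (simp only: mult_1_right)
      moreover have "Y \<le> len (a [^] Suc m)"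
        unfolding len_power_hyperbolic(1)[OF a hyp] Y_def using overlap_le(3)[of a "inv a"] by simp
      ultimately show ?thesis unfolding Suc by (rule order_trans)
    qed (simp add: len_nonneg)
    have lower': "\<bar>j\<bar> \<le> len (a [^] j)" for j :: int
    proof (cases j rule: int_cases2)
      case (nonneg m)
      then show ?thesis using lower[of m] by (simp add: int_pow_int)
    next
      case (nonpos m)
      then show ?thesis using lower[of m] a by (simp add: int_pow_neg_int len_inv)
    qed
    \<comment> \<open>Conjugation by \<open>b\<close> multiplies the exponent by \<open>n\<close>
      and adds at most \<open>2 * len b\<close> to the length.\<close>
    have upper: "len (a [^] (p * n ^ k)) \<le> 2 * len b * int k + len (a [^] p)" for k :: nat
    proof (induction k)
      case (Suc k)
      have "a [^] (p * n ^ Suc k) = (a [^] q) [^] (n ^ k)"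
        using a by (simp add: int_pow_pow q_eq mult.assoc)
      also have "\<dots> = b \<otimes> a [^] (p * n ^ k) \<otimes> inv b"
        unfolding rel[symmetric] using a b by (simp add: conj_int_pow int_pow_pow)
      finally have e: "a [^] (p * n ^ Suc k) = b \<otimes> a [^] (p * n ^ k) \<otimes> inv b" .
      have "len (b \<otimes> a [^] (p * n ^ k) \<otimes> inv b) \<le> len b + len (a [^] (p * n ^ k)) + len b"
        using len_mult_le[of "b \<otimes> a [^] (p * n ^ k)" "inv b"] len_mult_le[of b "a [^] (p * n ^ k)"]
          a b len_inv[of b] by simp
      then show ?case using Suc unfolding e by (simp add: algebra_simps)
    qed simp
    obtain k where k: "2 * len b * int k + len (a [^] p) < 2 ^ k"
      using exp_dominates_linear by blast
    have "(2::int) ^ k \<le> \<bar>n\<bar> ^ k" using n_gt by (intro power_mono) auto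
    moreover have "\<bar>n\<bar> ^ k \<le> p * \<bar>n\<bar> ^ k" using p_gt by (simp add: mult_le_cancel_right1)
    moreover have "p * \<bar>n\<bar> ^ k = \<bar>p * n ^ k\<bar>" using p_gt by (simp add: abs_mult power_abs)
    ultimately have "2 ^ k \<le> \<bar>p * n ^ k\<bar>" by linarith
    then show False using k upper[of k] lower'[of "p * n ^ k"] by linarith
  qed
  then show ?thesis by (rule elliptic_conj[OF a _ ev])
qed

subsection \<open>The subgroup generated by a stable letter and \<open>x\<^sup>p\<close>\<close>

definition x_powers :: "bs_gen word set set" where
  "x_powers = range (\<lambda>k::int. x [^] k)"

lemma subgroup_x_powers: "subgroup x_powers G"
  unfolding x_powers_def using subgroup_of_powers[OF x_closed] by (simp add: full_SetCompr_eq)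

text \<open>If \<open>\<tau>\<close> conjugates \<open>x^p\<close> to \<open>x^q\<close>, these
  elements form the subgroup generated by \<open>\<tau>\<close> and \<open>x^p\<close>, a quotient
  of \<open>BS(1,n)\<close>. Positive powers of \<open>\<tau>\<close> can be moved to the right and
  negative ones to the left, which gives this form.\<close>

definition affine :: "bs_gen word set \<Rightarrow> bs_gen word set set" where
  "affine \<tau> = {inv (\<tau> [^] j) \<otimes> x [^] (p * i) \<otimes> \<tau> [^] k |(j::nat) (i::int) (k::nat). True}"

lemma stable_pow:
  assumes "\<tau> \<in> carrier G" "\<tau> \<otimes> x [^] p \<otimes> inv \<tau> = x [^] q"
  shows "\<tau> [^] (k::nat) \<otimes> x [^] (p * i) = x [^] (p * (i * n ^ k)) \<otimes> \<tau> [^] k"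
proof (induction k)
  case (Suc k)
  have r: "\<tau> \<otimes> x [^] (p * c) = x [^] (q * c) \<otimes> \<tau>" for c
  proof -
    have "(\<tau> \<otimes> x [^] p \<otimes> inv \<tau>) [^] c = x [^] (q * c)" by (simp add: assms int_pow_pow)
    then show ?thesis using assms(1) by (simp add: conj_int_pow int_pow_pow conj_eq_iff)
  qed
  have "\<tau> [^] Suc k \<otimes> x [^] (p * i) = \<tau> \<otimes> (\<tau> [^] k \<otimes> x [^] (p * i))"
    using assms(1) nat_pow_Suc2[of \<tau> k] by (simp add: m_assoc del: nat_pow_Suc Group.nat_pow_Suc)
  also have "\<dots> = (\<tau> \<otimes> x [^] (p * (i * n ^ k))) \<otimes> \<tau> [^] k"
    using assms(1) by (simp add: Suc m_assoc)
  also have "\<tau> \<otimes> x [^] (p * (i * n ^ k)) = x [^] (p * (i * n ^ Suc k)) \<otimes> \<tau>"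
    using r[of "i * n ^ k"] by (simp add: q_eq mult_ac)
  also have "x [^] (p * (i * n ^ Suc k)) \<otimes> \<tau> \<otimes> \<tau> [^] k = x [^] (p * (i * n ^ Suc k)) \<otimes> (\<tau> \<otimes> \<tau> [^] k)"
    using assms(1) by (simp add: m_assoc)
  also have "\<tau> \<otimes> \<tau> [^] k = \<tau> [^] Suc k"
    using assms(1) nat_pow_Suc2[of \<tau> k] by (simp del: nat_pow_Suc Group.nat_pow_Suc)
  finally show ?case .
qed simp

lemma nat_pow_mult_inv:
  assumes "g \<in> carrier G" "j \<le> (k::nat)"
  shows "g [^] k \<otimes> inv (g [^] j) = g [^] (k - j)" "g [^] j \<otimes> inv (g [^] k) = inv (g [^] (k - j))"
proof -
  have k: "g [^] k = g [^] (k - j) \<otimes> g [^] j" using assms by (simp add: nat_pow_mult)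
  show "g [^] k \<otimes> inv (g [^] j) = g [^] (k - j)"
    using assms by (simp add: k m_assoc)
  then have "inv (g [^] k \<otimes> inv (g [^] j)) = inv (g [^] (k - j))" by simp
  then show "g [^] j \<otimes> inv (g [^] k) = inv (g [^] (k - j))"
    using assms by (simp add: inv_mult_group)
qed

lemma subgroup_affine:
  assumes \<tau>: "\<tau> \<in> carrier G" and rel: "\<tau> \<otimes> x [^] p \<otimes> inv \<tau> = x [^] q"
  shows "subgroup (affine \<tau>) G"
proof (rule subgroupI)
  show "affine \<tau> \<subseteq> carrier G" using \<tau> by (auto simp: affine_def)
  show "affine \<tau> \<noteq> {}" by (auto simp: affine_def)
next
  fix s assume "s \<in> affine \<tau>"
  then obtain j k :: nat and i where s: "s = inv (\<tau> [^] j) \<otimes> x [^] (p * i) \<otimes> \<tau> [^] k"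
    by (auto simp: affine_def)
  then have "inv s = inv (\<tau> [^] k) \<otimes> x [^] (p * (- i)) \<otimes> \<tau> [^] j"
    using \<tau> by (simp add: inv_mult_group m_assoc int_pow_neg)
  then show "inv s \<in> affine \<tau>" unfolding affine_def by blast
next
  fix s s' assume "s \<in> affine \<tau>" "s' \<in> affine \<tau>"
  then obtain j k j' k' :: nat and i i' where s: "s = inv (\<tau> [^] j) \<otimes> x [^] (p * i) \<otimes> \<tau> [^] k"
    and s': "s' = inv (\<tau> [^] j') \<otimes> x [^] (p * i') \<otimes> \<tau> [^] k'"
    by (auto simp: affine_def)
  show "s \<otimes> s' \<in> affine \<tau>"
  \<comment> \<open>The inner factor \<open>\<tau>^k \<tau>^-j'\<close> is a power of
    \<open>\<tau>\<close> with exponent of either sign; it is moved outwards to the right or to the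
    left, multiplying an exponent of \<open>x^p\<close> by a power of \<open>n\<close>.\<close>
  proof (cases "j' \<le> k")
    case True
    define m where "m = k - j'"
    have "s \<otimes> s' = inv (\<tau> [^] j) \<otimes> x [^] (p * i) \<otimes> (\<tau> [^] k \<otimes> inv (\<tau> [^] j')) \<otimes> x [^] (p * i') \<otimes> \<tau> [^] k'"
      using \<tau> by (simp add: s s' m_assoc)
    also have "\<tau> [^] k \<otimes> inv (\<tau> [^] j') = \<tau> [^] m" using nat_pow_mult_inv[OF \<tau> True] by (simp add: m_def)
    also have "inv (\<tau> [^] j) \<otimes> x [^] (p * i) \<otimes> \<tau> [^] m \<otimes> x [^] (p * i') \<otimes> \<tau> [^] k'
        = inv (\<tau> [^] j) \<otimes> x [^] (p * i) \<otimes> (\<tau> [^] m \<otimes> x [^] (p * i')) \<otimes> \<tau> [^] k'"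
      using \<tau> by (simp add: m_assoc)
    also have "\<tau> [^] m \<otimes> x [^] (p * i') = x [^] (p * (i' * n ^ m)) \<otimes> \<tau> [^] m"
      by (rule stable_pow[OF \<tau> rel])
    also have "inv (\<tau> [^] j) \<otimes> x [^] (p * i) \<otimes> (x [^] (p * (i' * n ^ m)) \<otimes> \<tau> [^] m) \<otimes> \<tau> [^] k'
        = inv (\<tau> [^] j) \<otimes> (x [^] (p * i) \<otimes> x [^] (p * (i' * n ^ m))) \<otimes> (\<tau> [^] m \<otimes> \<tau> [^] k')"
      using \<tau> by (simp add: m_assoc)
    also have "\<dots> = inv (\<tau> [^] j) \<otimes> x [^] (p * (i + i' * n ^ m)) \<otimes> \<tau> [^] (m + k')"
      using \<tau> by (simp add: nat_pow_mult distrib_left flip: int_pow_mult)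
    finally show ?thesis unfolding affine_def by blast
  next
    case False
    define m where "m = j' - k"
    have "x [^] (p * i) \<otimes> inv (\<tau> [^] m) = inv (\<tau> [^] m) \<otimes> (\<tau> [^] m \<otimes> x [^] (p * i)) \<otimes> inv (\<tau> [^] m)"
      using \<tau> by (simp add: m_assoc)
    also have "\<dots> = inv (\<tau> [^] m) \<otimes> x [^] (p * (i * n ^ m))"
      unfolding stable_pow[OF \<tau> rel] using \<tau> by (simp add: m_assoc)
    finally have r: "x [^] (p * i) \<otimes> inv (\<tau> [^] m) = inv (\<tau> [^] m) \<otimes> x [^] (p * (i * n ^ m))" .
    have "s \<otimes> s' = inv (\<tau> [^] j) \<otimes> x [^] (p * i) \<otimes> (\<tau> [^] k \<otimes> inv (\<tau> [^] j')) \<otimes> x [^] (p * i') \<otimes> \<tau> [^] k'"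
      using \<tau> by (simp add: s s' m_assoc)
    also have "\<tau> [^] k \<otimes> inv (\<tau> [^] j') = inv (\<tau> [^] m)"
      using nat_pow_mult_inv(2)[OF \<tau>, of k j'] False by (simp add: m_def)
    also have "inv (\<tau> [^] j) \<otimes> x [^] (p * i) \<otimes> inv (\<tau> [^] m) \<otimes> x [^] (p * i') \<otimes> \<tau> [^] k'
        = inv (\<tau> [^] j) \<otimes> (x [^] (p * i) \<otimes> inv (\<tau> [^] m)) \<otimes> x [^] (p * i') \<otimes> \<tau> [^] k'"
      using \<tau> by (simp add: m_assoc)
    also have "\<dots> = (inv (\<tau> [^] j) \<otimes> inv (\<tau> [^] m)) \<otimes> (x [^] (p * (i * n ^ m)) \<otimes> x [^] (p * i')) \<otimes> \<tau> [^] k'"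
      using \<tau> by (simp add: m_assoc r)
    also have "\<dots> = inv (\<tau> [^] (m + j)) \<otimes> x [^] (p * (i * n ^ m + i')) \<otimes> \<tau> [^] k'"
      using \<tau> by (simp add: distrib_left flip: int_pow_mult inv_mult_group nat_pow_mult)
    finally show ?thesis unfolding affine_def by blast
  qed
qed

lemma affine_mem:
  assumes "\<tau> \<in> carrier G"
  shows "\<tau> \<in> affine \<tau>" "x [^] (p * i) \<in> affine \<tau>"
proof -
  have "\<tau> = inv (\<tau> [^] (0::nat)) \<otimes> x [^] (p * 0) \<otimes> \<tau> [^] (1::nat)" using assms by simp
  then show "\<tau> \<in> affine \<tau>" unfolding affine_def by blast
  have "x [^] (p * i) = inv (\<tau> [^] (0::nat)) \<otimes> x [^] (p * i) \<otimes> \<tau> [^] (0::nat)" using assms by simp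
  then show "x [^] (p * i) \<in> affine \<tau>" unfolding affine_def by blast
qed

text \<open>If the last step of the geodesic to \<open>\<tau>\<close> were to cancel in \<open>\<tau>\<^sup>-\<^sup>j x\<^sup>p\<^sup>i \<tau>\<^sup>k\<close>, then
  \<open>\<tau>\<^sup>-\<^sup>j x\<^sup>p\<^sup>i \<tau>\<^sup>j \<tau>\<close> would be shorter than \<open>\<tau>\<close>. In a product of minimal length, the root of the tree is
  therefore a leaf of the subtree spanned by the orbit of the root under the subgroup.\<close>

lemma affine_starts:
  assumes \<tau>: "\<tau> \<in> carrier G" and rel: "\<tau> \<otimes> x [^] p \<otimes> inv \<tau> = x [^] q" and ht: "height \<tau> \<noteq> 0"
    and st: "starts \<tau> 0 False" "starts (inv \<tau>) 0 False"
    and minimal: "\<And>j i. len \<tau> \<le> len (inv (\<tau> [^] (j::nat)) \<otimes> x [^] (p * i) \<otimes> \<tau> [^] j \<otimes> \<tau>)"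
    and s: "s \<in> affine \<tau>" "s \<notin> x_powers"
  shows "starts s 0 False"
proof -
  obtain j k :: nat and i where s_eq: "s = inv (\<tau> [^] j) \<otimes> x [^] (p * i) \<otimes> \<tau> [^] k"
    using s(1) by (auto simp: affine_def)
  define d c where "d = len \<tau>" and "c = overlap \<tau> (inv \<tau>)"
  have hyp: "2 * c < d" using hyperbolic_if_height[OF \<tau> ht] by (simp add: d_def c_def)
  have c: "1 \<le> c" unfolding c_def by (rule overlap_starts[OF st])
  have len_pow: "len (\<tau> [^] m) = int m * (d - 2 * c) + 2 * c" if "m > 0" for m :: nat
    using len_power_hyperbolic(1)[OF \<tau>, of "m - 1"] hyp that by (simp add: d_def c_def)
  have starts_pow: "starts (\<tau> [^] m) 0 False" if "m > 0" for m :: nat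
  proof -
    have "1 \<le> overlap \<tau> (\<tau> [^] Suc (m - 1))"
      using len_power_hyperbolic(2)[OF \<tau>, of "m - 1"] hyp c unfolding d_def c_def by linarith
    then show ?thesis using starts_overlap[OF _ st(1)] that by simp
  qed
  have overlap_pow: "2 * overlap (\<tau> [^] a) (\<tau> [^] b) = len (\<tau> [^] a) + len (\<tau> [^] b) - len (\<tau> [^] (b - a))"
    if "a \<le> b" for a b :: nat
  proof -
    have "inv (\<tau> [^] a) \<otimes> \<tau> [^] b = \<tau> [^] (b - a)"
    proof -
      have "\<tau> [^] b = \<tau> [^] a \<otimes> \<tau> [^] (b - a)" using \<tau> that by (simp add: nat_pow_mult)
      then show ?thesis using \<tau> by simp
    qed
    then show ?thesis using len_inv_mult[of "\<tau> [^] a" "\<tau> [^] b"] \<tau> by simp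
  qed
  have hypi: "2 * overlap (inv \<tau>) (inv (inv \<tau>)) < len (inv \<tau>)"
    using hyp \<tau> by (simp add: d_def c_def len_inv overlap_commute)
  have starts_inv_pow: "starts (inv (\<tau> [^] m)) 0 False" if "m > 0" for m :: nat
  proof -
    have "1 \<le> overlap (inv \<tau>) (inv \<tau> [^] Suc (m - 1))"
      using len_power_hyperbolic(2)[OF _ hypi, of "m - 1"] c \<tau> overlap_commute[of \<tau> "inv \<tau>"]
      unfolding d_def c_def by fastforce
    then show ?thesis using starts_overlap[OF _ st(2)] that \<tau> nat_pow_inv[OF \<tau>, of m] by simp
  qed
  \<comment> \<open>Edges of sign \<open>False\<close> at the root count modulo \<open>p\<close>, so
    \<open>x^(p*i)\<close> fixes them.\<close>
  have shift: "starts (x [^] (p * i) \<otimes> g) 0 False" if "starts g 0 False" "g \<in> carrier G" for g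
    using starts_x_pow[OF that(2,1), of "p * i"] by (simp add: bs_mod_def)
  consider "j = 0" "k = 0" | "j = 0" "k > 0" | "j > 0" "k = 0" | "j > 0" "k > 0" by blast
  then show ?thesis
  proof cases
    case 1
    then have "s = x [^] (p * i)" using s_eq by simp
    then show ?thesis using s(2) by (simp add: x_powers_def)
  next
    case 2
    then show ?thesis using s_eq shift[OF starts_pow] \<tau> by simp
  next
    case 3
    then show ?thesis using s_eq starts_inv_pow \<tau> by (simp add: starts_mult_x_pow)
  next
    case 4
    define h where "h = x [^] (p * i) \<otimes> \<tau> [^] k"
    have h: "h \<in> carrier G" using \<tau> by (simp add: h_def)
    have s_h: "s = inv (\<tau> [^] j) \<otimes> h" using \<tau> by (simp add: s_eq h_def m_assoc)
    have len_h: "len h = len (\<tau> [^] k)" using \<tau> by (simp add: h_def len_x_pow_mult)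
    have ls: "len s = len (\<tau> [^] j) + len h - 2 * overlap (\<tau> [^] j) h"
      unfolding s_h using \<tau> h by (intro len_inv_mult) auto
    have "inv (inv (\<tau> [^] j)) \<otimes> s = h" using \<tau> h by (simp add: s_h)
    then have os: "2 * overlap (inv (\<tau> [^] j)) s = len (\<tau> [^] j) + len s - len h"
      using len_inv_mult[of "inv (\<tau> [^] j)" s] \<tau> h s_h len_inv by simp
    show ?thesis
    \<comment> \<open>Unless \<open>\<tau>^-j\<close> cancels completely, its first edge survives as
      the first edge of \<open>s\<close>.\<close>
    proof (cases "overlap (\<tau> [^] j) h < len (\<tau> [^] j)")
      case True
      then have "1 \<le> overlap (inv (\<tau> [^] j)) s" using os ls by linarith
      then show ?thesis using starts_overlap[OF _ starts_inv_pow] 4 by blast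
    next
      case False
      then have full: "overlap (\<tau> [^] j) h = len (\<tau> [^] j)"
        using overlap_le(1)[of "\<tau> [^] j" h] by linarith
      have "len (\<tau> [^] j) \<le> len (\<tau> [^] k)" using full overlap_le(2)[of "\<tau> [^] j" h] len_h by simp
      then have "int j * (d - 2 * c) \<le> int k * (d - 2 * c)" using len_pow 4 by simp
      then have "j \<le> k" using hyp by simp
      moreover have "j \<noteq> k"
      proof
        assume "j = k"
        then have "len s = 0" using ls full len_h by simp
        then have "s \<in> x_powers"
          using len_eq_0[of s] s_h h \<tau> unfolding x_powers_def by (metis inv_closed m_closed nat_pow_closed rangeI)
        then show False using s(2) by simp
      qed
      ultimately have jk: "j < k" by simp
      \<comment> \<open>Lowering the power of \<open>\<tau>\<close> from \<open>k\<close> to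
        \<open>j + 1\<close> keeps the path as far as it enters the overlap estimate. The product
        \<open>inv (\<tau> [^] j) \<otimes> h'\<close> then cancels so much that its length drops
        below \<open>d\<close>, against minimality.\<close>
      define h' where "h' = x [^] (p * i) \<otimes> \<tau> [^] Suc j"
      have h': "h' \<in> carrier G" using \<tau> by (simp add: h'_def)
      have "overlap h h' = overlap (\<tau> [^] k) (\<tau> [^] Suc j)"
        using \<tau> by (simp add: h_def h'_def overlap_x_pow_mult del: nat_pow_Suc Group.nat_pow_Suc)
      moreover have "2 * overlap (\<tau> [^] k) (\<tau> [^] Suc j) \<ge> 2 * (int (Suc j) * (d - 2 * c) + c)"
      proof -
        have e: "2 * overlap (\<tau> [^] k) (\<tau> [^] Suc j)
            = len (\<tau> [^] Suc j) + len (\<tau> [^] k) - len (\<tau> [^] (k - Suc j))"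
          using overlap_pow[of "Suc j" k] jk by (simp only: overlap_commute[of "\<tau> [^] k"])
        have "len (\<tau> [^] (k - Suc j)) \<le> int (k - Suc j) * (d - 2 * c) + 2 * c"
          using len_pow[of "k - Suc j"] c by (cases "k - Suc j") (simp_all del: nat_pow_Suc Group.nat_pow_Suc)
        moreover have "int (k - Suc j) = int k - int (Suc j)" using jk by simp
        moreover have "len (\<tau> [^] k) = int k * (d - 2 * c) + 2 * c" using len_pow 4 by simp
        moreover have "len (\<tau> [^] Suc j) = int (Suc j) * (d - 2 * c) + 2 * c" using len_pow[of "Suc j"] by simp
        ultimately show ?thesis unfolding e by (simp add: algebra_simps)
      qed
      ultimately have o1: "int (Suc j) * (d - 2 * c) + c \<le> overlap h h'" by simp
      have o2: "overlap (\<tau> [^] j) h = int j * (d - 2 * c) + 2 * c" using full len_pow 4 by simp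
      have "min (int j * (d - 2 * c) + 2 * c) (int (Suc j) * (d - 2 * c) + c) \<le> overlap (\<tau> [^] j) h'"
        using overlap_ultrametric[of "\<tau> [^] j" h h'] o1 o2 by linarith
      then have "int j * (d - 2 * c) + c + 1 \<le> overlap (\<tau> [^] j) h'"
        using hyp c by (simp add: distrib_right)
      moreover have "len h' = int (Suc j) * (d - 2 * c) + 2 * c"
        using len_pow[of "Suc j"] \<tau> by (simp add: h'_def len_x_pow_mult del: nat_pow_Suc Group.nat_pow_Suc)
      moreover have "len (\<tau> [^] j) = int j * (d - 2 * c) + 2 * c" using len_pow 4 by simp
      ultimately have "len (inv (\<tau> [^] j) \<otimes> h') < d"
        using len_inv_mult[of "\<tau> [^] j" h'] \<tau> h' by (simp add: distrib_right)
      moreover have "inv (\<tau> [^] j) \<otimes> h' = inv (\<tau> [^] j) \<otimes> x [^] (p * i) \<otimes> \<tau> [^] j \<otimes> \<tau>"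
        using \<tau> by (simp add: h'_def m_assoc)
      ultimately show ?thesis using minimal[of j i] by (simp add: d_def)
    qed
  qed
qed

text \<open>An element of length one that starts with \<open>t^-1\<close> has the form
  \<open>t^-1 x^b\<close>, and its inverse starts with \<open>t\<close>.\<close>

lemma starts_both_len:
  assumes "g \<in> carrier G" "starts g 0 False" "starts (inv g) 0 False"
  shows "2 \<le> len g"
proof (rule ccontr)
  assume "\<not> 2 \<le> len g"
  moreover obtain L where L: "vertex g = (0, False) # L" using assms(2) by (auto simp: starts_def)
  ultimately have "length L = 0" by (cases L) (auto simp: len_def)
  then have "vertex g = [(0, False)]" using L by simp
  then have "g = inv t \<otimes> x [^] xpart g"
    using nf_expansion[OF assms(1)] by (simp add: stable_def)
  then have "inv g = x [^] (- xpart g) \<otimes> t"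
    by (metis int_pow_closed int_pow_neg inv_closed inv_inv inv_mult_group t_closed x_closed)
  then have "vertex (inv g) = nf_shift p q (- xpart g) [(0, True)]"
    using vertex_x_pow_mult[OF t_closed, of "- xpart g"] by (simp add: vertex_t)
  then show False using assms(3) by (simp add: starts_def)
qed

text \<open>Ping-pong at the root. Elements of \<open>B\<close> outside
  \<open>\<langle>x\<rangle>\<close> and their inverses leave along the edge
  \<open>(0, False)\<close>; a power of \<open>x\<close> outside \<open>B\<close> moves that edge to
  another one, so consecutive syllables do not cancel.\<close>

lemma alternating_starts:
  assumes "subgroup B G" and pB: "\<And>i. x [^] (p * i) \<in> B"
    and st: "\<And>s. s \<in> B \<Longrightarrow> s \<notin> x_powers \<Longrightarrow> starts s 0 False"
    and g: "g \<in> alternating G x_powers B"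
  shows "2 \<le> len g" "starts (inv g) 0 False"
proof -
  interpret B: subgroup B G by fact
  have sc: "s \<in> carrier G" if "s \<in> B" for s using that by simp
  have sti: "starts (inv s) 0 False" if "s \<in> B" "s \<notin> x_powers" for s
    using st[of "inv s"] that subgroup.m_inv_closed[OF subgroup_x_powers, of "inv s"] by auto
  have ls: "2 \<le> len s" if "s \<in> B" "s \<notin> x_powers" for s
    using starts_both_len[OF _ st[OF that] sti[OF that]] that by simp
  have inv_a: "inv (a \<otimes> s) = inv s \<otimes> x [^] (- k)" if "a = x [^] k" "s \<in> B" for a s and k :: int
    using that by (simp add: inv_mult_group int_pow_neg)
  have "g \<in> carrier G \<and> 2 \<le> len g \<and> starts (inv g) 0 False" using g
  proof induction
    case (base a s)
    then obtain k :: int where k: "a = x [^] k" by (auto simp: x_powers_def)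
    show ?case using base ls[of s] sti[of s] inv_a[OF k, of s] by (simp add: k len_x_pow_mult starts_mult_x_pow)
  next
    case (step g a s)
    then obtain k :: int where k: "a = x [^] k" by (auto simp: x_powers_def)
    \<comment> \<open>All powers of \<open>x^p\<close> belong to \<open>B\<close>, while
      \<open>a\<close> does not.\<close>
    have nd: "\<not> p dvd k" using pB step(3) by (auto simp: k dvd_def)
    have st_as: "starts (a \<otimes> s) (k mod p) False"
      using starts_x_pow[OF _ st[of s], of k] step by (simp add: k bs_mod_def)
    have st_ias: "starts (inv (a \<otimes> s)) 0 False"
      using sti[of s] step by (simp add: inv_a[OF k] starts_mult_x_pow)
    have ne: "(0, False) \<noteq> (k mod p, False)" "(k mod p, False) \<noteq> (0, False)" using nd by (simp_all add: dvd_eq_mod_eq_0)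
    have as: "a \<otimes> s \<in> carrier G" "g \<in> carrier G" using step k by auto
    have "len (g \<otimes> (a \<otimes> s)) = len g + len (a \<otimes> s)"
      using mult_no_cancel(1)[OF as(2,1) _ st_as ne(1)] step by simp
    moreover have "starts (inv (a \<otimes> s) \<otimes> inv g) 0 False"
      using mult_no_cancel(2)[of "inv (a \<otimes> s)" "inv g" "k mod p" False 0 False 0 False]
        as st_as st_ias step.IH ne by simp
    ultimately show ?case
      using step as starts_len[OF st_as] by (simp add: inv_mult_group)
  qed
  then show "2 \<le> len g" "starts (inv g) 0 False" by auto
qed

end

section \<open>Automorphism groups\<close>

context group
begin

lemma carrier_AutoGroup [simp]: "carrier (AutoGroup G) = auto G"
  by (simp add: AutoGroup_def)

lemma auto_hom: "\<alpha> \<in> auto G \<Longrightarrow> \<alpha> \<in> hom G G"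
  by (simp add: auto_def)

lemma auto_closed: "\<alpha> \<in> auto G \<Longrightarrow> g \<in> carrier G \<Longrightarrow> \<alpha> g \<in> carrier G"
  using auto_hom hom_in_carrier by metis

lemma auto_group_hom: "\<alpha> \<in> auto G \<Longrightarrow> group_hom G G \<alpha>"
  by (simp add: group_hom_def group_hom_axioms_def auto_hom)

lemma auto_surj: "\<alpha> \<in> auto G \<Longrightarrow> \<alpha> ` carrier G = carrier G"
  by (simp add: auto_def Bij_def bij_betw_def)

lemma auto_mult:
  "\<alpha> \<in> auto G \<Longrightarrow> \<beta> \<in> auto G \<Longrightarrow> \<alpha> \<otimes>\<^bsub>AutoGroup G\<^esub> \<beta> = compose (carrier G) \<alpha> \<beta>"
  by (simp add: AutoGroup_def BijGroup_def auto_def)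

lemma auto_mult_apply:
  "\<alpha> \<in> auto G \<Longrightarrow> \<beta> \<in> auto G \<Longrightarrow> g \<in> carrier G \<Longrightarrow> (\<alpha> \<otimes>\<^bsub>AutoGroup G\<^esub> \<beta>) g = \<alpha> (\<beta> g)"
  by (simp add: auto_mult compose_eq)

lemma auto_mult_closed: "\<alpha> \<in> auto G \<Longrightarrow> \<beta> \<in> auto G \<Longrightarrow> \<alpha> \<otimes>\<^bsub>AutoGroup G\<^esub> \<beta> \<in> auto G"
  using monoid.m_closed[OF group.is_monoid[OF AutoGroup]] by simp

lemma auto_inv_closed: "\<alpha> \<in> auto G \<Longrightarrow> inv\<^bsub>AutoGroup G\<^esub> \<alpha> \<in> auto G"
  using group.inv_closed[OF AutoGroup] by simp

lemma one_AutoGroup: "\<one>\<^bsub>AutoGroup G\<^esub> = (\<lambda>g\<in>carrier G. g)"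
  by (simp add: AutoGroup_def)

lemma auto_inv_apply:
  assumes "\<alpha> \<in> auto G" "g \<in> carrier G"
  shows "\<alpha> ((inv\<^bsub>AutoGroup G\<^esub> \<alpha>) g) = g" "(inv\<^bsub>AutoGroup G\<^esub> \<alpha>) (\<alpha> g) = g"
proof -
  interpret A: group "AutoGroup G" by (rule AutoGroup)
  have a: "\<alpha> \<in> carrier (AutoGroup G)" using assms by simp
  show "\<alpha> ((inv\<^bsub>AutoGroup G\<^esub> \<alpha>) g) = g" "(inv\<^bsub>AutoGroup G\<^esub> \<alpha>) (\<alpha> g) = g"
    using A.r_inv[OF a] A.l_inv[OF a] auto_mult_apply[OF assms(1) auto_inv_closed[OF assms(1)] assms(2)]
      auto_mult_apply[OF auto_inv_closed[OF assms(1)] assms(1) assms(2)] assms(2)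
    by (simp_all add: one_AutoGroup)
qed

lemma auto_eqI:
  assumes "\<alpha> \<in> auto G" "\<beta> \<in> auto G" "\<And>g. g \<in> carrier G \<Longrightarrow> \<alpha> g = \<beta> g"
  shows "\<alpha> = \<beta>"
  using assms by (intro extensionalityI[where A = "carrier G"]) (auto simp: auto_def Bij_def)

lemma conj_auto_apply: "h \<in> carrier G \<Longrightarrow> conj_auto G g h = g \<otimes> h \<otimes> inv g"
  by (simp add: conj_auto_def)

lemma conj_auto_in_auto:
  assumes g: "g \<in> carrier G"
  shows "conj_auto G g \<in> auto G"
proof -
  have "bij_betw (conj_auto G g) (carrier G) (carrier G)"
    using g by (intro bij_betw_byWitness[where f' = "conj_auto G (inv g)"])
      (auto simp: conj_auto_apply m_assoc)
  moreover have "conj_auto G g \<in> hom G G"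
    using g by (auto intro!: homI simp: conj_auto_apply m_assoc)
  ultimately show ?thesis by (simp add: auto_def Bij_def conj_auto_def)
qed

lemma conj_auto_hom: "conj_auto G \<in> hom G (AutoGroup G)"
proof (rule homI)
  fix g h assume gh: "g \<in> carrier G" "h \<in> carrier G"
  show "conj_auto G (g \<otimes> h) = conj_auto G g \<otimes>\<^bsub>AutoGroup G\<^esub> conj_auto G h"
    using gh by (intro auto_eqI auto_mult_closed conj_auto_in_auto)
      (auto simp: auto_mult_apply conj_auto_in_auto conj_auto_apply m_assoc inv_mult_group)
qed (simp add: conj_auto_in_auto)

lemma conj_conj_auto:
  assumes \<alpha>: "\<alpha> \<in> auto G" and g: "g \<in> carrier G"
  shows "\<alpha> \<otimes>\<^bsub>AutoGroup G\<^esub> conj_auto G g = conj_auto G (\<alpha> g) \<otimes>\<^bsub>AutoGroup G\<^esub> \<alpha>"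
proof -
  interpret \<alpha>: group_hom G G \<alpha> by (rule auto_group_hom[OF \<alpha>])
  show ?thesis
    using assms by (intro auto_eqI auto_mult_closed conj_auto_in_auto)
      (auto simp: auto_mult_apply conj_auto_in_auto conj_auto_apply)
qed

lemma conj_auto_cancel:
  assumes u: "u \<in> carrier G" and \<alpha>: "\<alpha> \<in> auto G"
  shows "conj_auto G u \<otimes>\<^bsub>AutoGroup G\<^esub> (conj_auto G (inv u) \<otimes>\<^bsub>AutoGroup G\<^esub> \<alpha>) = \<alpha>"
proof (rule auto_eqI)
  fix g assume "g \<in> carrier G"
  moreover from this have "\<alpha> g \<in> carrier G" using \<alpha> by (simp add: auto_closed)
  ultimately show "(conj_auto G u \<otimes>\<^bsub>AutoGroup G\<^esub> (conj_auto G (inv u) \<otimes>\<^bsub>AutoGroup G\<^esub> \<alpha>)) g = \<alpha> g"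
    using u \<alpha> by (simp add: auto_mult_apply auto_mult_closed conj_auto_in_auto conj_auto_apply m_assoc)
qed (use assms in \<open>simp_all add: auto_mult_closed conj_auto_in_auto\<close>)

lemma Inn_normal: "Inn G \<lhd> AutoGroup G"
proof -
  interpret A: group "AutoGroup G" by (rule AutoGroup)
  interpret c: group_hom G "AutoGroup G" "conj_auto G"
    by (simp add: group_hom_def group_hom_axioms_def AutoGroup conj_auto_hom)
  have "subgroup (Inn G) (AutoGroup G)"
    unfolding Inn_def by (rule c.img_is_subgroup)
  moreover have "\<alpha> \<otimes>\<^bsub>AutoGroup G\<^esub> h \<otimes>\<^bsub>AutoGroup G\<^esub> inv\<^bsub>AutoGroup G\<^esub> \<alpha> \<in> Inn G"
    if \<alpha>: "\<alpha> \<in> carrier (AutoGroup G)" and h: "h \<in> Inn G" for \<alpha> h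
  proof -
    obtain g where g: "g \<in> carrier G" "h = conj_auto G g" using h by (auto simp: Inn_def)
    have "\<alpha> g \<in> carrier G" "conj_auto G (\<alpha> g) \<in> carrier (AutoGroup G)"
      using \<alpha> g by (simp_all add: auto_closed conj_auto_in_auto)
    then show ?thesis
      using \<alpha> g A.m_assoc[of "conj_auto G (\<alpha> g)" \<alpha> "inv\<^bsub>AutoGroup G\<^esub> \<alpha>"] A.r_inv[of \<alpha>] A.inv_closed[of \<alpha>]
      by (simp add: conj_conj_auto Inn_def)
  qed
  ultimately show ?thesis by (simp add: A.normal_inv_iff)
qed

end

context bs
begin

section \<open>Explicit automorphisms of the Baumslag-Solitar group\<close>

lemma auto_eq_on_generators:
  assumes "\<alpha> \<in> auto G" "\<beta> \<in> auto G" "\<alpha> x = \<beta> x" "\<alpha> t = \<beta> t"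
  shows "\<alpha> = \<beta>"
  by (rule auto_eqI[OF assms(1,2)], rule hom_eqI[OF is_group auto_hom[OF assms(1)] auto_hom[OF assms(2)] assms(3,4)])

lemma auto_of_inverse:
  assumes \<alpha>: "\<alpha> \<in> hom G G" and \<beta>: "\<beta> \<in> hom G G" and "\<alpha> \<in> extensional (carrier G)"
    and i: "\<alpha> (\<beta> x) = x" "\<alpha> (\<beta> t) = t" "\<beta> (\<alpha> x) = x" "\<beta> (\<alpha> t) = t"
  shows "\<alpha> \<in> auto G"
proof -
  have id: "id \<in> hom G G" by (rule homI) auto
  have c: "\<alpha> \<circ> \<beta> \<in> hom G G" "\<beta> \<circ> \<alpha> \<in> hom G G" by (rule Group.hom_compose[OF \<beta> \<alpha>], rule Group.hom_compose[OF \<alpha> \<beta>])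
  have "(\<alpha> \<circ> \<beta>) g = id g" "(\<beta> \<circ> \<alpha>) g = id g" if "g \<in> carrier G" for g
    using hom_eqI[OF is_group c(1) id _ _ that] hom_eqI[OF is_group c(2) id _ _ that] i by simp_all
  then have "bij_betw \<alpha> (carrier G) (carrier G)"
    using hom_in_carrier[OF \<alpha>] hom_in_carrier[OF \<beta>]
    by (intro bij_betw_byWitness[where f' = \<beta>]) auto
  then show ?thesis using assms by (simp add: auto_def Bij_def)
qed

text \<open>These elements form an abelian group isomorphic to \<open>Z[1/n]\<close>, in which
  \<open>wroot k i\<close> corresponds to \<open>i / n^k\<close>; the integers are the powers of
  \<open>x^p\<close>.\<close>

definition wroot :: "nat \<Rightarrow> int \<Rightarrow> bs_gen word set" where
  "wroot k i = inv (t [^] k) \<otimes> x [^] (p * i) \<otimes> t [^] k"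

lemma wroot_closed [simp]: "wroot k i \<in> carrier G"
  by (simp add: wroot_def)

lemma t_pow_x_pow: "t [^] (k::nat) \<otimes> x [^] (p * i) = x [^] (p * (i * n ^ k)) \<otimes> t [^] k"
  by (rule stable_pow[OF t_closed bs_rel])

lemma wroot_0 [simp]: "wroot 0 i = x [^] (p * i)"
  by (simp add: wroot_def)

lemma wroot_zero [simp]: "wroot k 0 = \<one>"
  by (simp add: wroot_def)

lemma wroot_add: "wroot k i \<otimes> wroot k j = wroot k (i + j)"
  by (simp add: wroot_def m_assoc distrib_left int_pow_mult)

lemma wroot_inv: "inv (wroot k i) = wroot k (- i)"
  using wroot_add[of k i "- i"] by (intro inv_equality) (simp_all add: wroot_add)

lemma wroot_lift: "wroot (k + m) (i * n ^ m) = wroot k i"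
proof -
  have "wroot (k + m) (i * n ^ m) = inv (t [^] m \<otimes> t [^] k) \<otimes> (x [^] (p * (i * n ^ m)) \<otimes> t [^] m) \<otimes> t [^] k"
    by (simp add: wroot_def nat_pow_mult m_assoc add.commute)
  also have "x [^] (p * (i * n ^ m)) \<otimes> t [^] m = t [^] m \<otimes> x [^] (p * i)"
    by (rule t_pow_x_pow[symmetric])
  finally show ?thesis by (simp add: wroot_def inv_mult_group m_assoc)
qed

lemma wroot_common:
  "\<exists>m i' j'. wroot k i = wroot m i' \<and> wroot l j = wroot m j'"
  using wroot_lift[of k l i] wroot_lift[of l k j] by (metis add.commute)

lemma wroot_comm: "wroot k i \<otimes> wroot l j = wroot l j \<otimes> wroot k i"
  using wroot_common[of k i l j] by (metis wroot_add add.commute)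

lemma t_wroot: "t \<otimes> wroot k i = wroot k (i * n) \<otimes> t"
proof -
  have c: "t \<otimes> t [^] k = t [^] k \<otimes> t"
    using nat_pow_Suc2[of t k] nat_pow_Suc[of t k] by simp
  have "t \<otimes> inv (t [^] k) = inv (t [^] k) \<otimes> (t [^] k \<otimes> t) \<otimes> inv (t [^] k)"
    by (simp add: m_assoc)
  also have "\<dots> = inv (t [^] k) \<otimes> t" by (simp add: m_assoc flip: c)
  finally have "t \<otimes> wroot k i = inv (t [^] k) \<otimes> (t \<otimes> x [^] (p * i)) \<otimes> t [^] k"
    by (simp add: wroot_def flip: m_assoc)
  also have "t \<otimes> x [^] (p * i) = x [^] (p * (i * n)) \<otimes> t"
    using t_pow_x_pow[of 1 i] by simp
  also have "inv (t [^] k) \<otimes> (x [^] (p * (i * n)) \<otimes> t) \<otimes> t [^] k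
      = inv (t [^] k) \<otimes> x [^] (p * (i * n)) \<otimes> (t \<otimes> t [^] k)"
    by (simp add: m_assoc)
  finally show ?thesis by (simp add: wroot_def c m_assoc)
qed

lemma t_pow_wroot: "t [^] (l::nat) \<otimes> wroot k i = wroot k (i * n ^ l) \<otimes> t [^] l"
proof (induction l arbitrary: i)
  case (Suc l)
  have "t [^] Suc l \<otimes> wroot k i = t [^] l \<otimes> (t \<otimes> wroot k i)" by (simp add: m_assoc)
  also have "\<dots> = (t [^] l \<otimes> wroot k (i * n)) \<otimes> t" by (simp add: t_wroot m_assoc)
  finally show ?case by (simp add: Suc m_assoc mult.assoc)
qed simp

lemma wroot_t_pow: "\<exists>c. (wroot k i \<otimes> t) [^] (l::nat) = wroot k c \<otimes> t [^] l"
proof (induction l)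
  case 0
  then show ?case by (intro exI[of _ 0]) simp
next
  case (Suc l)
  then obtain c where c: "(wroot k i \<otimes> t) [^] l = wroot k c \<otimes> t [^] l" by blast
  have "(wroot k i \<otimes> t) [^] Suc l = wroot k c \<otimes> (t [^] l \<otimes> wroot k i) \<otimes> t"
    by (simp add: c m_assoc)
  also have "\<dots> = (wroot k c \<otimes> wroot k (i * n ^ l)) \<otimes> t [^] Suc l"
    by (simp add: t_pow_wroot m_assoc)
  finally show ?case by (auto simp only: wroot_add)
qed

lemma wroot_x_pow: "wroot k i \<otimes> x [^] (p * j) = x [^] (p * j) \<otimes> wroot k i"
  using wroot_comm[of k i 0 j] by simp

text \<open>The image of \<open>t^l\<close> is \<open>wroot k c \<otimes> t^l\<close> for some
  \<open>c\<close>, and the additional factor commutes with \<open>x^(p*j)\<close>, so it disappears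
  in the conjugate.\<close>

lemma wroot_fixed:
  assumes \<alpha>: "\<alpha> \<in> hom G G" and "\<alpha> x = x" "\<alpha> t = wroot k i \<otimes> t"
  shows "\<alpha> (wroot l j) = wroot l j"
proof -
  interpret group_hom G G \<alpha> using \<alpha> by (simp add: group_hom_def group_hom_axioms_def)
  obtain c where c: "(wroot k i \<otimes> t) [^] l = wroot k c \<otimes> t [^] l" using wroot_t_pow by blast
  have "\<alpha> (wroot l j) = inv (wroot k c \<otimes> t [^] l) \<otimes> x [^] (p * j) \<otimes> (wroot k c \<otimes> t [^] l)"
    unfolding wroot_def[of l] by (simp add: hom_nat_pow hom_int_pow assms c)
  also have "\<dots> = inv (t [^] l) \<otimes> (inv (wroot k c) \<otimes> (x [^] (p * j) \<otimes> wroot k c)) \<otimes> t [^] l"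
    by (simp add: inv_mult_group m_assoc)
  also have "x [^] (p * j) \<otimes> wroot k c = wroot k c \<otimes> x [^] (p * j)" by (simp add: wroot_x_pow)
  finally show ?thesis by (simp add: wroot_def)
qed

text \<open>The common form of the powers of \<open>\<psi>\<close> and of the
  \<open>\<phi>_k\<close>. It respects the defining relation when \<open>u\<close> commutes with
  \<open>x^q = t x^p t^-1\<close>.\<close>

definition shear :: "bs_gen word set \<Rightarrow> bs_gen word set \<Rightarrow> bs_gen word set" where
  "shear u = bs_hom G x (u \<otimes> t)"

lemma shear_hom:
  assumes u: "u \<in> carrier G" and c: "u \<otimes> x [^] q = x [^] q \<otimes> u"
  shows "shear u \<in> hom G G" "shear u x = x" "shear u t = u \<otimes> t"
proof -
  have "u \<otimes> t \<otimes> x [^] p \<otimes> inv (u \<otimes> t) = u \<otimes> (t \<otimes> x [^] p \<otimes> inv t) \<otimes> inv u"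
    using u by (simp add: inv_mult_group m_assoc)
  also have "\<dots> = x [^] q"
    unfolding bs_rel using u c by (intro conj_eq_iff[THEN iffD2]) simp_all
  finally have rel: "u \<otimes> t \<otimes> x [^] p \<otimes> inv (u \<otimes> t) = x [^] q" .
  show "shear u \<in> hom G G" "shear u x = x" "shear u t = u \<otimes> t"
    unfolding shear_def using bs_hom[OF is_group x_closed _ rel] u by simp_all
qed

lemma shear_extensional: "shear u \<in> extensional (carrier G)"
  unfolding shear_def by (rule bs_hom_extensional)

definition psi :: "int \<Rightarrow> bs_gen word set \<Rightarrow> bs_gen word set" where
  "psi k = shear (x [^] k)"

definition phi :: "nat \<Rightarrow> int \<Rightarrow> bs_gen word set \<Rightarrow> bs_gen word set" where
  "phi k i = shear (wroot k i)"

lemma x_pow_comm: "x [^] (j::int) \<otimes> x [^] (k::int) = x [^] k \<otimes> x [^] j"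
  using int_pow_mult[OF x_closed, of j k] int_pow_mult[OF x_closed, of k j] by (simp add: add.commute)

lemma conj_auto_x_pow: "conj_auto G (x [^] (k::int)) x = x"
  unfolding conj_auto_apply[OF x_closed] using x_pow_comm[of k 1]
  by (intro conj_eq_iff[THEN iffD2]) simp_all

lemma psi_hom: "psi k \<in> hom G G" "psi k x = x" "psi k t = x [^] k \<otimes> t"
  unfolding psi_def by (rule shear_hom; simp add: x_pow_comm)+

lemma phi_hom: "phi k i \<in> hom G G" "phi k i x = x" "phi k i t = wroot k i \<otimes> t"
proof -
  have "wroot k i \<otimes> x [^] q = x [^] q \<otimes> wroot k i"
    unfolding q_eq by (rule wroot_x_pow)
  then show "phi k i \<in> hom G G" "phi k i x = x" "phi k i t = wroot k i \<otimes> t"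
    unfolding phi_def by (rule shear_hom[OF wroot_closed])+
qed

lemma hom_fix_x_pow:
  assumes "\<alpha> \<in> hom G G" "\<alpha> x = x"
  shows "\<alpha> (x [^] (k::int)) = x [^] k"
  using hom_int_pow[OF assms(1) x_closed is_group is_group] assms(2) by simp

lemma psi_comp: "psi j (x [^] k \<otimes> t) = x [^] (j + k) \<otimes> t"
proof -
  have "psi j (x [^] k \<otimes> t) = x [^] k \<otimes> (x [^] j \<otimes> t)"
    using hom_mult[OF psi_hom(1), of "x [^] k" t j]
    by (simp add: psi_hom(3) hom_fix_x_pow[OF psi_hom(1,2)])
  also have "\<dots> = x [^] (k + j) \<otimes> t" by (simp add: int_pow_mult m_assoc)
  finally show ?thesis by (simp only: add.commute)
qed

lemma phi_comp: "phi k i (wroot k j \<otimes> t) = wroot k (i + j) \<otimes> t"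
proof -
  have "phi k i (wroot k j \<otimes> t) = wroot k j \<otimes> (wroot k i \<otimes> t)"
    using hom_mult[OF phi_hom(1), of "wroot k j" t k i]
    by (simp add: phi_hom(3) wroot_fixed[OF phi_hom])
  also have "\<dots> = wroot k (j + i) \<otimes> t" by (simp flip: m_assoc add: wroot_add)
  finally show ?thesis by (simp only: add.commute)
qed

lemma psi_auto [simp]: "psi k \<in> auto G"
  by (rule auto_of_inverse[where \<beta> = "psi (- k)"])
    (simp_all add: psi_hom psi_comp, simp add: psi_def shear_extensional)

lemma phi_auto [simp]: "phi k i \<in> auto G"
  by (rule auto_of_inverse[where \<beta> = "phi k (- i)"])
    (simp_all add: phi_hom phi_comp, simp add: phi_def shear_extensional)

lemma psi_mult: "psi j \<otimes>\<^bsub>AutoGroup G\<^esub> psi k = psi (j + k)"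
  by (rule auto_eq_on_generators) (simp_all add: auto_mult_closed auto_mult_apply psi_comp psi_hom(2,3))

lemma phi_mult: "phi k i \<otimes>\<^bsub>AutoGroup G\<^esub> phi k j = phi k (i + j)"
  by (rule auto_eq_on_generators) (simp_all add: auto_mult_closed auto_mult_apply phi_comp phi_hom(2,3))

lemma phi_lift: "phi (k + m) (i * n ^ m) = phi k i"
  by (simp add: phi_def wroot_lift)

lemma phi_0: "phi 0 i = psi (p * i)"
  by (simp add: phi_def psi_def)

lemma psi_zero: "psi 0 = \<one>\<^bsub>AutoGroup G\<^esub>" and phi_zero: "phi k 0 = \<one>\<^bsub>AutoGroup G\<^esub>"
proof -
  interpret A: group "AutoGroup G" by (rule AutoGroup)
  show "psi 0 = \<one>\<^bsub>AutoGroup G\<^esub>" using A.l_cancel_one[of "psi 0" "psi 0"] psi_mult[of 0 0] by simp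
  show "phi k 0 = \<one>\<^bsub>AutoGroup G\<^esub>" using A.l_cancel_one[of "phi k 0" "phi k 0"] phi_mult[of k 0 0] by simp
qed

lemma psi_pow: "psi j [^]\<^bsub>AutoGroup G\<^esub> (k::int) = psi (j * k)"
proof -
  interpret h: group_hom integer_group "AutoGroup G" "\<lambda>k. psi (j * k)"
    by (auto simp: group_hom_def group_hom_axioms_def AutoGroup psi_mult distrib_left intro!: homI)
  show ?thesis using h.hom_int_pow[of 1 k] by simp
qed

lemma phi_pow: "phi l j [^]\<^bsub>AutoGroup G\<^esub> (k::int) = phi l (j * k)"
proof -
  interpret h: group_hom integer_group "AutoGroup G" "\<lambda>k. phi l (j * k)"
    by (auto simp: group_hom_def group_hom_axioms_def AutoGroup phi_mult distrib_left intro!: homI)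
  show ?thesis using h.hom_int_pow[of 1 k] by simp
qed

definition iota :: "bs_gen word set \<Rightarrow> bs_gen word set" where
  "iota = bs_hom G (inv x) t"

lemma iota_hom: "iota \<in> hom G G" "iota x = inv x" "iota t = t"
proof -
  have inv_x: "inv x [^] k = x [^] (k * -1)" for k :: int by (simp add: int_pow_inv int_pow_neg)
  have rel: "t \<otimes> inv x [^] p \<otimes> inv t = inv x [^] q"
    unfolding inv_x by (intro conj_eq_iff[THEN iffD2] bs_rel_t) simp_all
  show "iota \<in> hom G G" "iota x = inv x" "iota t = t"
    unfolding iota_def using bs_hom[OF is_group _ t_closed rel] by simp_all
qed

lemma iota_auto [simp]: "iota \<in> auto G"
proof (rule auto_of_inverse[where \<beta> = iota])
  interpret group_hom G G iota using iota_hom(1) by (simp add: group_hom_def group_hom_axioms_def)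
  show "iota (iota x) = x" "iota (iota x) = x" "iota (iota t) = t" "iota (iota t) = t"
    by (simp_all add: iota_hom(2,3))
qed (simp_all add: iota_hom(1), simp add: iota_def bs_hom_extensional)

lemma iota_mult: "iota \<otimes>\<^bsub>AutoGroup G\<^esub> iota = \<one>\<^bsub>AutoGroup G\<^esub>"
proof -
  interpret group_hom G G iota using iota_hom(1) by (simp add: group_hom_def group_hom_axioms_def)
  show ?thesis
    using id_in_auto
    by (intro auto_eq_on_generators) (simp_all add: auto_mult_closed auto_mult_apply iota_hom(2,3) one_AutoGroup)
qed

lemma BS_map_eq: "BS_map p q a b = bs_hom G a b"
  by (simp add: BS_map_def bs_hom_def flip: G_eq)

lemma aut_val_eq:
  "aut_val p q Cx = conj_auto G x" "aut_val p q Ct = conj_auto G t"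
  "aut_val p q Psi = psi 1" "aut_val p q Iota = iota" "aut_val p q (Phi k) = phi k 1"
proof -
  show "aut_val p q Cx = conj_auto G x" "aut_val p q Ct = conj_auto G t" "aut_val p q Iota = iota"
    by (simp_all add: BS_iota_def iota_def BS_map_eq flip: G_eq x_eq t_eq)
  show "aut_val p q Psi = psi 1"
    by (simp add: BS_psi_def psi_def shear_def BS_map_eq flip: G_eq x_eq t_eq)
  have "t [^] (- int k) \<otimes> x [^] p \<otimes> t [^] int k \<otimes> t = wroot k 1 \<otimes> t"
    by (simp add: wroot_def int_pow_neg_int int_pow_int)
  then show "aut_val p q (Phi k) = phi k 1"
    by (simp add: BS_phi_def phi_def shear_def BS_map_eq flip: G_eq x_eq t_eq)
qed

lemma aut_val_auto: "aut_val p q g \<in> auto G"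
  by (cases g) (simp_all add: aut_val_eq conj_auto_in_auto del: aut_val.simps)

subsection \<open>Generators of the automorphism group\<close>

definition aut_span :: "(bs_gen word set \<Rightarrow> bs_gen word set) set" where
  "aut_span = generate (AutoGroup G) (aut_val p q ` aut_gens)"

lemma subgroup_aut_span: "subgroup aut_span (AutoGroup G)"
  unfolding aut_span_def by (rule group.generate_is_subgroup[OF AutoGroup]) (auto simp: aut_val_auto)

lemma aut_span_mult: "\<alpha> \<in> aut_span \<Longrightarrow> \<beta> \<in> aut_span \<Longrightarrow> \<alpha> \<otimes>\<^bsub>AutoGroup G\<^esub> \<beta> \<in> aut_span"
  by (rule subgroup.m_closed[OF subgroup_aut_span])

lemma aut_span_gen: "g \<in> aut_gens \<Longrightarrow> aut_val p q g \<in> aut_span"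
  unfolding aut_span_def by (auto intro: generate.incl)

lemma aut_span_pow: "\<alpha> \<in> aut_span \<Longrightarrow> \<alpha> [^]\<^bsub>AutoGroup G\<^esub> (k::int) \<in> aut_span"
  by (rule group.subgroup_int_pow_closed[OF AutoGroup subgroup_aut_span])

lemma psi_span: "psi k \<in> aut_span"
  using aut_span_pow[OF aut_span_gen[of Psi], of k] by (simp add: aut_gens_def aut_val_eq psi_pow del: aut_val.simps)

lemma iota_span: "iota \<in> aut_span"
  using aut_span_gen[of Iota] by (simp add: aut_gens_def aut_val_eq del: aut_val.simps)

lemma phi_span: "phi k i \<in> aut_span"
proof (cases "k = 0")
  case True
  then show ?thesis by (simp add: phi_0 psi_span)
next
  case False
  then have "Phi k \<in> aut_gens" by (simp add: aut_gens_def)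
  from aut_span_pow[OF aut_span_gen[OF this], of i] show ?thesis
    by (simp add: aut_val_eq phi_pow del: aut_val.simps)
qed

lemma conj_span: "g \<in> carrier G \<Longrightarrow> conj_auto G g \<in> aut_span"
proof -
  interpret c: group_hom G "AutoGroup G" "conj_auto G"
    by (simp add: group_hom_def group_hom_axioms_def AutoGroup conj_auto_hom)
  assume "g \<in> carrier G"
  then show ?thesis
  proof (induction rule: G_induct)
    case x
    then show ?case using aut_span_gen[of Cx] by (simp add: aut_gens_def aut_val_eq del: aut_val.simps)
  next
    case t
    then show ?case using aut_span_gen[of Ct] by (simp add: aut_gens_def aut_val_eq del: aut_val.simps)
  qed (simp_all add: subgroup.one_closed[OF subgroup_aut_span]
      subgroup.m_inv_closed[OF subgroup_aut_span] aut_span_mult)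
qed

lemma image_rel:
  assumes "\<alpha> \<in> auto G"
  shows "\<alpha> t \<otimes> \<alpha> x [^] p \<otimes> inv (\<alpha> t) = \<alpha> x [^] q"
proof -
  interpret group_hom G G \<alpha> by (rule auto_group_hom[OF assms])
  have "\<alpha> (t \<otimes> x [^] p \<otimes> inv t) = \<alpha> (x [^] q)" by (simp only: bs_rel)
  then show ?thesis by (simp add: hom_int_pow)
qed

text \<open>This is how surjectivity of an automorphism is exploited: the images of \<open>x\<close>
  and \<open>t\<close> lie in no proper subgroup.\<close>

lemma image_generate:
  assumes "\<alpha> \<in> auto G" "subgroup H G" "\<alpha> x \<in> H" "\<alpha> t \<in> H"
  shows "H = carrier G"
proof -
  interpret group_hom G G \<alpha> by (rule auto_group_hom[OF assms(1)])
  have "\<alpha> g \<in> H" if "g \<in> carrier G" for g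
    using that
    by (induction rule: G_induct)
      (simp_all add: assms(3,4) subgroup.one_closed[OF assms(2)] subgroup.m_inv_closed[OF assms(2)]
        subgroup.m_closed[OF assms(2)])
  then have "\<alpha> ` carrier G \<subseteq> H" by (rule image_subsetI)
  then have "carrier G \<subseteq> H" unfolding auto_surj[OF assms(1)] .
  then show ?thesis by (rule subset_antisym[OF subgroup.subset[OF assms(2)]])
qed

text \<open>Otherwise the whole image would lie in the kernel of the height.\<close>

lemma height_image_ne:
  assumes \<alpha>: "\<alpha> \<in> auto G" and "\<alpha> x = x"
  shows "height (\<alpha> t) \<noteq> 0"
proof
  assume 0: "height (\<alpha> t) = 0"
  define H where "H = kernel G integer_group height"
  have "subgroup H G" unfolding H_def by (rule height.subgroup_kernel)
  moreover have "\<alpha> x \<in> H" "\<alpha> t \<in> H" using 0 assms by (simp_all add: H_def kernel_def auto_closed height)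
  ultimately have "t \<in> H" using image_generate[OF \<alpha>, of H] by simp
  then show False by (simp add: H_def kernel_def height)
qed

text \<open>Substituting the image of \<open>t\<close> for \<open>t\<close> in a normal form
  produces no cancellation, so the length of the image is a multiple of the length of
  \<open>\<alpha> t\<close>. As \<open>t\<close> is itself an image and has length one, that length
  is one.\<close>

lemma len_image_up:
  assumes \<alpha>: "\<alpha> \<in> auto G" "\<alpha> x = x" and st: "starts (\<alpha> t) r True" "starts (inv (\<alpha> t)) 0 False"
  shows "len (\<alpha> t) = 1"
proof -
  interpret group_hom G G \<alpha> by (rule auto_group_hom[OF \<alpha>(1)])
  define \<tau> where "\<tau> = \<alpha> t"
  have \<tau>: "\<tau> \<in> carrier G" by (simp add: \<tau>_def)
  have x_fix: "\<alpha> (x [^] (k::int)) = x [^] k" for k by (rule hom_fix_x_pow[OF homh \<alpha>(2)])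
  define s where "s e = (if e then \<tau> else inv \<tau>)" for e
  have s: "s e \<in> carrier G" "inv (s e) = s (\<not> e)" "len (s e) = len \<tau>" "\<alpha> (stable e) = s e" for e
    using \<tau> by (simp_all add: s_def len_inv stable_def \<tau>_def)
  have st_s: "starts (s e) (if e then r else 0) e" for e using st by (simp add: s_def \<tau>_def)
  have "len (\<alpha> (nf_prod ((a, e) # L))) = int (length ((a, e) # L)) * len \<tau> \<and>
      starts (\<alpha> (nf_prod ((a, e) # L))) (((if e then r else 0) + a) mod bs_mod p q e) e"
    if "nf_valid p q ((a, e) # L)" for a e L
    using that
  proof (induction L arbitrary: a e)
    case Nil
    show ?case
      using starts_x_pow[OF s(1) st_s, of a] by (simp add: x_fix s len_x_pow_mult)
  next
    case (Cons l L)
    obtain a' e' where l: "l = (a', e')" by force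
    define h where "h = \<alpha> (nf_prod (l # L))"
    have h: "h \<in> carrier G" unfolding h_def by simp
    have v: "nf_valid p q ((a', e') # L)" "a' mod bs_mod p q e' = a'" "\<not> (a' = 0 \<and> e' \<noteq> e)"
      using Cons.prems by (auto simp: l nf_valid_Cons)
    have IH: "len h = int (Suc (length L)) * len \<tau>"
        "starts h (((if e' then r else 0) + a') mod bs_mod p q e') e'"
      using Cons.IH[OF v(1)] unfolding h_def l by auto
    \<comment> \<open>Equal first edges would force opposite signs and an exponent \<open>a'\<close>
      divisible by its modulus, hence 0: a pinch in the normal form.\<close>
    have ne: "(if \<not> e then r else 0, \<not> e) \<noteq> (((if e' then r else 0) + a') mod bs_mod p q e', e')"
    proof
      assume eq: "(if \<not> e then r else 0, \<not> e) = (((if e' then r else 0) + a') mod bs_mod p q e', e')"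
      then have e': "e' = (\<not> e)" by simp
      define b where "b = (if e' then r else 0)"
      have "b mod bs_mod p q e' = b"
        using starts_mod[OF s(1) st_s, of e'] by (simp add: b_def)
      moreover have "b = (b + a') mod bs_mod p q e'" using eq by (simp add: b_def e')
      ultimately have "(b + a') mod bs_mod p q e' = b mod bs_mod p q e'" by simp
      then have "bs_mod p q e' dvd a'" using mod_eq_dvd_iff[of "b + a'" "bs_mod p q e'" b] by simp
      then have "a' = 0" using v(2) by (simp add: dvd_eq_mod_eq_0)
      then show False using v(3) e' by simp
    qed
    have st_inv: "starts (inv (s e)) (if \<not> e then r else 0) (\<not> e)"
      unfolding s(2) by (rule st_s)
    have m: "len (s e \<otimes> h) = len \<tau> + len h" "starts (s e \<otimes> h) (if e then r else 0) e"
      using mult_no_cancel[OF s(1) h st_inv IH(2) ne] st_s s(3) by simp_all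
    have "\<alpha> (nf_prod ((a, e) # l # L)) = x [^] a \<otimes> (s e \<otimes> h)"
      unfolding nf_prod.simps(2)[of a e "l # L"] using h s by (simp add: x_fix m_assoc h_def)
    then show ?case
      using starts_x_pow[OF _ m(2), of a] m(1) IH(1) h s
      by (simp add: len_x_pow_mult distrib_right)
  qed
  note * = this
  obtain g where g: "g \<in> carrier G" "\<alpha> g = t" using auto_surj[OF \<alpha>(1)] t_closed by (metis imageE)
  have "\<alpha> g = \<alpha> (nf_prod (vertex g)) \<otimes> x [^] xpart g"
    by (subst nf_expansion[OF g(1)]) (simp add: x_fix)
  then have l1: "len (\<alpha> (nf_prod (vertex g))) = 1"
    using len_mult_x_pow[of "\<alpha> (nf_prod (vertex g))" "xpart g"] g by (simp add: len_t)
  then obtain a e L where v: "vertex g = (a, e) # L"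
    by (cases "vertex g") auto
  then have "int (length ((a, e) # L)) * len \<tau> = 1"
    using *[of a e L] vertex_valid[OF g(1)] l1 by simp
  then show ?thesis
    using len_nonneg[of \<tau>] by (auto simp: \<tau>_def zmult_eq_1_iff)
qed

text \<open>The element in the conclusion is the image of \<open>t\<close> under a product of \<open>\<alpha>\<close> with a power of \<open>\<phi>\<^sub>j\<close>.
  If it is never shorter, then by ping-pong \<open>x\<close> and \<open>\<alpha> t\<close> do not generate.\<close>

lemma shorten_down:
  assumes \<alpha>: "\<alpha> \<in> auto G" "\<alpha> x = x" and st: "starts (\<alpha> t) 0 False" "starts (inv (\<alpha> t)) 0 False"
  shows "\<exists>j i. len (inv (\<alpha> t [^] (j::nat)) \<otimes> x [^] (p * i) \<otimes> \<alpha> t [^] j \<otimes> \<alpha> t) < len (\<alpha> t)"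
proof (rule ccontr)
  assume no: "\<not> ?thesis"
  define \<tau> where "\<tau> = \<alpha> t"
  have \<tau>: "\<tau> \<in> carrier G" using \<alpha>(1) by (simp add: \<tau>_def auto_closed)
  have rel: "\<tau> \<otimes> x [^] p \<otimes> inv \<tau> = x [^] q" using image_rel[OF \<alpha>(1)] \<alpha>(2) by (simp add: \<tau>_def)
  have sg: "subgroup (affine \<tau>) G" by (rule subgroup_affine[OF \<tau> rel])
  have starts: "starts s 0 False" if "s \<in> affine \<tau>" "s \<notin> x_powers" for s
    by (rule affine_starts[OF \<tau> rel])
      (use that no st height_image_ne[OF \<alpha>] in \<open>auto simp: \<tau>_def not_less\<close>)
  have sub: "x_powers \<union> affine \<tau> \<subseteq> carrier G"
    using subgroup.subset[OF sg] subgroup.subset[OF subgroup_x_powers] by blast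
  have "x = x [^] (1::int)" by simp
  then have "x \<in> x_powers" unfolding x_powers_def by blast
  then have "generate G (x_powers \<union> affine \<tau>) = carrier G"
    using image_generate[OF \<alpha>(1) generate_is_subgroup[OF sub]] affine_mem(1)[OF \<tau>] \<alpha>(2)
    by (simp add: \<tau>_def generate.incl)
  then have "t \<in> generate G (x_powers \<union> affine \<tau>)" by simp
  then consider "t \<in> x_powers" | h a where "h \<in> alternating G x_powers (affine \<tau>)" "a \<in> x_powers" "t = h \<otimes> a"
    using alternating_exhaust[OF subgroup_x_powers sg] by blast
  then show False
  proof cases
    case 1
    then obtain k :: int where "t = x [^] k" by (auto simp: x_powers_def)
    then show False using vertex_t by simp
  next
    case (2 h a)
    have "2 \<le> len h" by (rule alternating_starts(1)[OF sg affine_mem(2)[OF \<tau>] starts 2(1)])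
    moreover have "len t = len h"
      using 2 alternating_closed[OF subgroup_x_powers sg 2(1)] by (auto simp: x_powers_def len_mult_x_pow)
    ultimately show False by (simp add: len_t)
  qed
qed

text \<open>Induction on the length of \<open>\<alpha> t\<close>. After normalising by an inner
  automorphism and a power of \<open>\<psi>\<close>, either the image of \<open>t\<close> has length
  one and \<open>\<alpha>\<close> is known, or some \<open>\<phi>_j^i\<close> shortens it.\<close>

lemma auto_fix_x_span:
  assumes "\<alpha> \<in> auto G" "\<alpha> x = x"
  shows "\<alpha> \<in> aut_span"
  using assms
proof (induction "nat (len (\<alpha> t))" arbitrary: \<alpha> rule: less_induct)
  case less
  interpret A: group "AutoGroup G" by (rule AutoGroup)
  have IH: "\<beta> \<in> aut_span" if "\<beta> \<in> auto G" "\<beta> x = x" "len (\<beta> t) < len (\<alpha> t)" for \<beta>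
    using less.hyps[of \<beta>] that len_nonneg[of "\<beta> t"] by simp
  have "len (\<alpha> t) \<noteq> 0"
    using height_image_ne[OF less.prems] height_len(1)[of "\<alpha> t"] less.prems by (auto simp: auto_closed)
  then obtain r e where st0: "starts (inv (\<alpha> t)) r e"
    using starts_exists[of "inv (\<alpha> t)"] less.prems by (auto simp: auto_closed len_inv)
  have at: "\<alpha> t \<in> carrier G" using less.prems by (simp add: auto_closed)
  \<comment> \<open>By the relation between the images, \<open>x^p\<close> fixes the vertex of
    \<open>inv (\<alpha> t)\<close>; since \<open>q\<close> does not divide \<open>p\<close>, the
    first edge there has sign \<open>False\<close>.\<close>
  have "\<alpha> t \<otimes> x [^] p = x [^] q \<otimes> \<alpha> t"
    using image_rel[OF less.prems(1)] less.prems(2) at by (simp add: conj_eq_iff)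
  then have "inv (\<alpha> t) \<otimes> (\<alpha> t \<otimes> x [^] p) \<otimes> inv (\<alpha> t) = inv (\<alpha> t) \<otimes> (x [^] q \<otimes> \<alpha> t) \<otimes> inv (\<alpha> t)"
    by (simp only:)
  then have "x [^] p \<otimes> inv (\<alpha> t) = inv (\<alpha> t) \<otimes> x [^] q" using at by (simp add: m_assoc)
  then have "bs_mod p q e dvd p" using mod_dvd_of_fixed[OF _ st0] at by simp
  then have e: "e = False" using q_not_dvd_p by (auto simp: bs_mod_def split: if_splits)
  \<comment> \<open>Conjugation by \<open>x^(-r)\<close> moves the first edge of the inverse image
    of \<open>t\<close> to residue 0 and keeps lengths.\<close>
  define \<beta> where "\<beta> = conj_auto G (x [^] (- r)) \<otimes>\<^bsub>AutoGroup G\<^esub> \<alpha>"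
  have ca: "conj_auto G (x [^] (k::int)) \<in> auto G" for k by (simp add: conj_auto_in_auto)
  have \<beta>: "\<beta> \<in> auto G" unfolding \<beta>_def using ca less.prems(1) by (rule auto_mult_closed)
  have inv_x_pow: "inv (x [^] (k::int)) = x [^] (- k)" for k by (simp add: int_pow_neg)
  have \<beta>x: "\<beta> x = x"
    using less.prems by (simp add: \<beta>_def auto_mult_apply ca conj_auto_x_pow)
  have \<beta>t: "\<beta> t = x [^] (- r) \<otimes> \<alpha> t \<otimes> x [^] r"
    using less.prems at by (simp add: \<beta>_def auto_mult_apply ca conj_auto_apply inv_x_pow)
  then have bt: "\<beta> t \<in> carrier G" using at by simp
  have len_\<beta>: "len (\<beta> t) = len (\<alpha> t)" using at by (simp add: \<beta>t len_mult_x_pow len_x_pow_mult)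
  have "inv (\<beta> t) = x [^] (- r) \<otimes> (inv (\<alpha> t) \<otimes> x [^] r)"
    using at by (simp add: \<beta>t inv_mult_group inv_x_pow)
  then have st1: "starts (inv (\<beta> t)) 0 False"
    using starts_x_pow[of "inv (\<alpha> t) \<otimes> x [^] r" r False "- r"] st0 at by (simp add: e starts_mult_x_pow)
  have "\<beta> \<in> aut_span"
  proof -
    obtain a e' where st2: "starts (\<beta> t) a e'"
      using starts_exists[of "\<beta> t"] len_\<beta> \<open>len (\<alpha> t) \<noteq> 0\<close> by auto
    show ?thesis
    proof (cases e')
      case True
      then have "len (\<beta> t) = 1" using len_image_up[OF \<beta> \<beta>x _ st1] st2 by simp
      then have "vertex (\<beta> t) = [(a, True)]" using st2 True by (auto simp: starts_def len_def)
      then obtain b :: int where b: "\<beta> t = x [^] a \<otimes> t \<otimes> x [^] b"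
        using nf_expansion[OF bt] by (auto simp: stable_def)
      \<comment> \<open>In \<open>x^a t x^b\<close> the right factor is produced by the conjugation
        by \<open>x^(-b)\<close>; this also puts \<open>x^(-b)\<close> on the left, which the
        exponent \<open>a + b\<close> compensates.\<close>
      have "\<beta> = conj_auto G (x [^] (- b)) \<otimes>\<^bsub>AutoGroup G\<^esub> psi (a + b)"
      proof (rule auto_eq_on_generators[OF \<beta>])
        show "conj_auto G (x [^] (- b)) \<otimes>\<^bsub>AutoGroup G\<^esub> psi (a + b) \<in> auto G"
          by (simp add: auto_mult_closed ca)
        show "\<beta> x = (conj_auto G (x [^] (- b)) \<otimes>\<^bsub>AutoGroup G\<^esub> psi (a + b)) x"
          by (simp add: \<beta>x auto_mult_apply ca psi_hom(2) conj_auto_x_pow)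
        have "x [^] (- b) \<otimes> (x [^] (a + b) \<otimes> t) \<otimes> x [^] b = (x [^] (- b) \<otimes> x [^] (a + b)) \<otimes> t \<otimes> x [^] b"
          by (simp add: m_assoc)
        also have "x [^] (- b) \<otimes> x [^] (a + b) = x [^] a" by (simp flip: int_pow_mult)
        finally show "\<beta> t = (conj_auto G (x [^] (- b)) \<otimes>\<^bsub>AutoGroup G\<^esub> psi (a + b)) t"
          by (simp add: b auto_mult_apply ca psi_hom(3) conj_auto_apply inv_x_pow)
      qed
      then show ?thesis using aut_span_mult[OF conj_span psi_span] by simp
    next
      case False
      \<comment> \<open>Precomposing with \<open>psi (- a)\<close> multiplies the image of
        \<open>t\<close> by \<open>x^(-a)\<close> on the left, which brings its first edge to
        residue 0. The inverse changes only by a power of \<open>x\<close> on the right and keeps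
        its first edge.\<close>
      define \<gamma> where "\<gamma> = \<beta> \<otimes>\<^bsub>AutoGroup G\<^esub> psi (- a)"
      have \<gamma>: "\<gamma> \<in> auto G" unfolding \<gamma>_def using \<beta> by (simp add: auto_mult_closed)
      have \<gamma>x: "\<gamma> x = x" using \<beta> \<beta>x by (simp add: \<gamma>_def auto_mult_apply psi_hom(2))
      have \<gamma>t: "\<gamma> t = x [^] (- a) \<otimes> \<beta> t"
        using hom_mult[OF auto_hom[OF \<beta>], of "x [^] (- a)" t] \<beta>
        by (simp add: \<gamma>_def auto_mult_apply psi_hom(3) hom_fix_x_pow[OF auto_hom[OF \<beta>] \<beta>x])
      have st_\<gamma>: "starts (\<gamma> t) 0 False"
        using starts_x_pow[OF bt st2, of "- a"] False by (simp add: \<gamma>t)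
      have st_\<gamma>i: "starts (inv (\<gamma> t)) 0 False"
        using st1 bt by (simp add: \<gamma>t inv_mult_group inv_x_pow starts_mult_x_pow)
      have len_\<gamma>: "len (\<gamma> t) = len (\<alpha> t)" using bt by (simp add: \<gamma>t len_x_pow_mult len_\<beta>)
      obtain j :: nat and i where ji:
        "len (inv (\<gamma> t [^] j) \<otimes> x [^] (p * i) \<otimes> \<gamma> t [^] j \<otimes> \<gamma> t) < len (\<gamma> t)"
        using shorten_down[OF \<gamma> \<gamma>x st_\<gamma> st_\<gamma>i] by (elim exE) (rule that)
      \<comment> \<open>As \<open>\<gamma>\<close> fixes \<open>x\<close>, this product sends
        \<open>t\<close> to exactly the shorter element just obtained.\<close>
      define \<delta> where "\<delta> = \<gamma> \<otimes>\<^bsub>AutoGroup G\<^esub> phi j i"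
      have \<delta>: "\<delta> \<in> auto G" unfolding \<delta>_def using \<gamma> by (simp add: auto_mult_closed)
      have \<delta>x: "\<delta> x = x" using \<gamma> \<gamma>x by (simp add: \<delta>_def auto_mult_apply phi_hom(2))
      interpret \<gamma>: group_hom G G \<gamma> by (rule auto_group_hom[OF \<gamma>])
      have "\<delta> t = inv (\<gamma> t [^] j) \<otimes> x [^] (p * i) \<otimes> \<gamma> t [^] j \<otimes> \<gamma> t"
        using \<gamma> by (simp add: \<delta>_def auto_mult_apply phi_hom(3) wroot_def \<gamma>.hom_nat_pow
            hom_fix_x_pow[OF auto_hom[OF \<gamma>] \<gamma>x])
      then have "\<delta> \<in> aut_span" using IH[OF \<delta> \<delta>x] ji len_\<gamma> by simp
      moreover have "\<delta> \<otimes>\<^bsub>AutoGroup G\<^esub> phi j (- i) = \<gamma>"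
        using A.m_assoc[of \<gamma> "phi j i" "phi j (- i)"] A.r_one[of \<gamma>] \<gamma>
        by (simp add: \<delta>_def phi_mult phi_zero)
      ultimately have "\<gamma> \<in> aut_span" using aut_span_mult[OF _ phi_span] by metis
      moreover have "\<gamma> \<otimes>\<^bsub>AutoGroup G\<^esub> psi a = \<beta>"
        using A.m_assoc[of \<beta> "psi (- a)" "psi a"] A.r_one[of \<beta>] \<beta>
        by (simp add: \<gamma>_def psi_mult psi_zero)
      ultimately show ?thesis using aut_span_mult[OF _ psi_span] by metis
    qed
  qed
  moreover have "conj_auto G (x [^] r) \<otimes>\<^bsub>AutoGroup G\<^esub> \<beta> = \<alpha>"
    using conj_auto_cancel[of "x [^] r" \<alpha>] less.prems by (simp add: \<beta>_def int_pow_neg)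
  ultimately show ?case using aut_span_mult[OF conj_span] by (metis int_pow_closed x_closed)
qed

text \<open>After an inner correction \<open>\<alpha>\<close> sends \<open>x\<close> to
  \<open>x^i\<close>. The inverse sends \<open>x\<close> to a conjugate of some \<open>x^j\<close>,
  so \<open>x\<close> is conjugate to \<open>x^(i*j)\<close> and \<open>i * j = 1\<close>; the case
  \<open>i = -1\<close> is reduced to \<open>i = 1\<close> by \<open>\<iota>\<close>.\<close>

theorem aut_span_eq: "aut_span = auto G"
proof
  interpret A: group "AutoGroup G" by (rule AutoGroup)
  show "aut_span \<subseteq> auto G" using subgroup.subset[OF subgroup_aut_span] by simp
  show "auto G \<subseteq> aut_span"
  proof
    fix \<alpha> assume \<alpha>: "\<alpha> \<in> auto G"
    have ell: "\<exists>u\<in>carrier G. \<exists>i::int. \<beta> x = u \<otimes> x [^] i \<otimes> inv u" if "\<beta> \<in> auto G" for \<beta>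
      using elliptic_of_bs_rel[OF _ _ image_rel[OF that]] that by (simp add: auto_closed)
    obtain u and i :: int where u: "u \<in> carrier G" "\<alpha> x = u \<otimes> x [^] i \<otimes> inv u" using ell[OF \<alpha>] by blast
    define \<beta> where "\<beta> = conj_auto G (inv u) \<otimes>\<^bsub>AutoGroup G\<^esub> \<alpha>"
    have cu: "conj_auto G (inv u) \<in> auto G" using u by (simp add: conj_auto_in_auto)
    have \<beta>: "\<beta> \<in> auto G" unfolding \<beta>_def by (rule auto_mult_closed[OF cu \<alpha>])
    have \<beta>x: "\<beta> x = x [^] i" using \<alpha> u cu by (simp add: \<beta>_def auto_mult_apply conj_auto_apply m_assoc)
    define \<gamma> where "\<gamma> = inv\<^bsub>AutoGroup G\<^esub> \<beta>"
    have \<gamma>: "\<gamma> \<in> auto G" unfolding \<gamma>_def by (rule auto_inv_closed[OF \<beta>])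
    obtain v and j :: int where v: "v \<in> carrier G" "\<gamma> x = v \<otimes> x [^] j \<otimes> inv v" using ell[OF \<gamma>] by blast
    interpret \<beta>: group_hom G G \<beta> by (rule auto_group_hom[OF \<beta>])
    have "x = \<beta> (\<gamma> x)" unfolding \<gamma>_def using auto_inv_apply(1)[OF \<beta>] by simp
    also have "\<dots> = \<beta> v \<otimes> x [^] (i * j) \<otimes> inv (\<beta> v)"
      using v by (simp add: \<beta>.hom_int_pow \<beta>x int_pow_pow)
    finally have "inv (\<beta> v) \<otimes> x \<otimes> inv (inv (\<beta> v))
        = inv (\<beta> v) \<otimes> (\<beta> v \<otimes> x [^] (i * j) \<otimes> inv (\<beta> v)) \<otimes> inv (inv (\<beta> v))" by (simp only:)
    then have "inv (\<beta> v) \<otimes> x \<otimes> inv (inv (\<beta> v)) = x [^] (i * j)" using v by (simp add: m_assoc)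
    then have "i * j = 1" using conj_x_eq_pow(2)[of "inv (\<beta> v)"] v by simp
    then have "i = 1 \<or> i = -1" by (auto simp: zmult_eq_1_iff)
    then have "\<beta> \<in> aut_span"
    proof
      assume "i = 1"
      then show ?thesis using auto_fix_x_span[OF \<beta>] \<beta>x by simp
    next
      assume i: "i = -1"
      define \<delta> where "\<delta> = \<beta> \<otimes>\<^bsub>AutoGroup G\<^esub> iota"
      have \<delta>: "\<delta> \<in> auto G" unfolding \<delta>_def using \<beta> by (simp add: auto_mult_closed)
      have "\<delta> x = x" using \<beta> by (simp add: \<delta>_def auto_mult_apply iota_hom(2) \<beta>x i int_pow_neg)
      then have "\<delta> \<in> aut_span" by (rule auto_fix_x_span[OF \<delta>])
      moreover have "\<delta> \<otimes>\<^bsub>AutoGroup G\<^esub> iota = \<beta>"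
        using A.m_assoc[of \<beta> iota iota] A.r_one[of \<beta>] \<beta> by (simp add: \<delta>_def iota_mult)
      ultimately show ?thesis using aut_span_mult[OF _ iota_span] by metis
    qed
    moreover have "conj_auto G u \<otimes>\<^bsub>AutoGroup G\<^esub> \<beta> = \<alpha>"
      unfolding \<beta>_def by (rule conj_auto_cancel[OF u(1) \<alpha>])
    ultimately show "\<alpha> \<in> aut_span" using aut_span_mult[OF conj_span[OF u(1)]] by metis
  qed
qed

end

text \<open>A homomorphism keeps the alternating shape if no factor falls into the opposite subgroup
  under it. It is used to pass from words to automorphisms.\<close>

lemma alternating_hom_image:
  fixes H :: "('c, 'k) monoid_scheme"
  assumes H: "group H" and K: "group K" and f: "f \<in> hom H K"
    and A: "subgroup A H" and B: "subgroup B H"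
    and "\<And>a. a \<in> A \<Longrightarrow> f a \<in> A'" "\<And>b. b \<in> B \<Longrightarrow> f b \<in> B'"
    and "\<And>a. a \<in> A \<Longrightarrow> f a \<in> B' \<Longrightarrow> a \<in> B" "\<And>b. b \<in> B \<Longrightarrow> f b \<in> A' \<Longrightarrow> b \<in> A"
    and h: "h \<in> alternating H A B"
  shows "f h \<in> alternating K A' B'"
proof -
  interpret H: group H by (rule H)
  note cA = subgroup.mem_carrier[OF A] and cB = subgroup.mem_carrier[OF B]
  show ?thesis using h
  proof induction
    case (base a b)
    have "f (a \<otimes>\<^bsub>H\<^esub> b) = f a \<otimes>\<^bsub>K\<^esub> f b" using f base cA cB by (simp add: hom_mult)
    moreover have "f a \<in> A'" "f b \<in> B'" "f b \<notin> A'" using assms(6-9) base by auto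
    ultimately show ?case by (simp add: alternating.base)
  next
    case (step g a b)
    have "g \<in> carrier H" by (rule H.alternating_closed[OF A B step(1)])
    then have "f (g \<otimes>\<^bsub>H\<^esub> (a \<otimes>\<^bsub>H\<^esub> b)) = f g \<otimes>\<^bsub>K\<^esub> (f a \<otimes>\<^bsub>K\<^esub> f b)"
      using f step cA cB by (simp add: hom_mult)
    moreover have "f a \<in> A'" "f b \<in> B'" "f b \<notin> A'" "f a \<notin> B'" using assms(6-9) step by auto
    ultimately show ?case using step.IH by (simp add: alternating.step)
  qed
qed

context group
begin

lemma subgroup_int_pow_range:
  assumes "g \<in> carrier G"
  shows "subgroup (range (\<lambda>k::int. g [^] k)) G"
  using subgroup_of_powers[OF assms] by (simp add: full_SetCompr_eq)

end

context bs
begin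

subsection \<open>Alternating products of automorphisms\<close>

lemma vertex_t_pow: "vertex (t [^] (k::nat)) = replicate k (0, True)"
proof (induction k)
  case (Suc k)
  have "vertex (t [^] Suc k) = nf_stable True (replicate k (0, True))"
    unfolding nat_pow_Suc2[OF t_closed] using vertex_t_mult[of "t [^] k"] Suc by simp
  also have "\<dots> = replicate (Suc k) (0, True)" by (cases k) simp_all
  finally show ?case .
qed simp

text \<open>Passing one letter \<open>t\<close> unchanged requires \<open>q\<close> to divide
  \<open>p * c\<close>, and it replaces \<open>c\<close> by \<open>c div n\<close>.\<close>

lemma nf_shift_replicate:
  "nf_shift p q (p * c) (replicate k (0, True)) = replicate k (0, True) \<Longrightarrow> n ^ k dvd c"
proof (induction k arbitrary: c)
  case (Suc k)
  then have "(p * c) mod (p * n) = 0" by (simp add: bs_mod_def q_eq)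
  then have "n dvd c" by (simp add: dvd_eq_mod_eq_0 mult_mod_right[symmetric])
  then obtain d where d: "c = n * d" by (auto simp: dvd_def)
  have "nf_shift p q (p * d) (replicate k (0, True)) = replicate k (0, True)"
    using Suc.prems by (simp add: bs_mod_def q_eq d mult.commute)
  then show ?case using Suc.IH by (simp add: d)
qed simp

lemma wroot_x_power: "n ^ k dvd c \<Longrightarrow> wroot k c = x [^] (p * (c div n ^ k))"
  using wroot_lift[of 0 k "c div n ^ k"] by simp

lemma wroot_in_x_powers:
  assumes "wroot k c \<in> x_powers"
  shows "n ^ k dvd c"
proof -
  obtain j :: int where "wroot k c = x [^] j" using assms by (auto simp: x_powers_def)
  then have "t [^] k \<otimes> (inv (t [^] k) \<otimes> (x [^] (p * c) \<otimes> t [^] k)) = t [^] k \<otimes> x [^] j"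
    by (simp add: wroot_def m_assoc)
  then have "x [^] (p * c) \<otimes> t [^] k = t [^] k \<otimes> x [^] j" by simp
  then have "vertex (x [^] (p * c) \<otimes> t [^] k) = vertex (t [^] k \<otimes> x [^] j)" by simp
  then have "nf_shift p q (p * c) (replicate k (0, True)) = replicate k (0, True)"
    by (simp add: vertex_x_pow_mult vertex_mult_x_pow vertex_t_pow)
  then show ?thesis by (rule nf_shift_replicate)
qed

definition psis :: "(bs_gen word set \<Rightarrow> bs_gen word set) set" where
  "psis = range psi"

definition phis :: "(bs_gen word set \<Rightarrow> bs_gen word set) set" where
  "phis = {phi k c |k c. True}"

text \<open>The two families meet only in the powers of \<open>\<psi>^p\<close>: an element
  \<open>t^-k x^(p*c) t^k\<close> that is a power of \<open>x\<close> makes \<open>x^(p*c)\<close>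
  fix the vertex of \<open>t^k\<close>.\<close>

lemma psi_eq_phi:
  assumes "psi i = phi k c"
  shows "p dvd i" "n ^ k dvd c" "wroot k c \<in> x_powers"
proof -
  have "x [^] i \<otimes> t = wroot k c \<otimes> t" using assms psi_hom(3)[of i] phi_hom(3)[of k c] by simp
  then have e: "x [^] i = wroot k c" by simp
  then show w: "wroot k c \<in> x_powers" by (auto simp: x_powers_def)
  show "n ^ k dvd c" by (rule wroot_in_x_powers[OF w])
  then have "x [^] i = x [^] (p * (c div n ^ k))" using e by (simp add: wroot_x_power)
  then have "i = p * (c div n ^ k)" by (simp only: x_pow_inj)
  then show "p dvd i" by simp
qed

lemma phi_eq_psi:
  assumes "n ^ k dvd c"
  shows "phi k c = psi (p * (c div n ^ k))"
  by (simp add: phi_def psi_def wroot_x_power[OF assms])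

text \<open>If \<open>h\<close> were not a power of \<open>x\<close>, then commuting with
  \<open>x^p\<close> would make its geodesic start downwards, and the last factor \<open>t\<close>
  is too short to change that. So \<open>h = x^k\<close>, and the first edge
  \<open>(0, True)\<close> means that \<open>q\<close> divides \<open>k\<close>.\<close>

lemma vertex_up_not_zero:
  assumes h: "h \<in> carrier G" and c: "h \<otimes> x [^] p = x [^] p \<otimes> h"
    and v: "vertex (h \<otimes> t) = (0, True) # L"
  shows "inv t \<otimes> (h \<otimes> t) \<in> x_powers"
proof -
  have st: "starts (h \<otimes> t) 0 True" using v by (simp add: starts_def)
  have l1: "len (h \<otimes> t) = len h + 1 - 2 * overlap (inv h) t"
    using len_mult[OF h t_closed] by (simp add: len_t)
  have "inv h \<otimes> (h \<otimes> t) = t" using h by simp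
  then have l2: "1 = len h + len (h \<otimes> t) - 2 * overlap h (h \<otimes> t)"
    using len_inv_mult[of h "h \<otimes> t"] h by (simp add: len_t)
  have o: "overlap (inv h) t \<le> 1" using overlap_le(2)[of "inv h" t] by (simp add: len_t)
  have lht: "1 \<le> len (h \<otimes> t)" using starts_len[OF st] .
  have "len h = 0"
  proof (rule ccontr)
    assume nz: "len h \<noteq> 0"
    then obtain r e where re: "starts h r e" using starts_exists by blast
    have "bs_mod p q e dvd p" using mod_dvd_of_fixed[OF h re, of p p] c by simp
    then have e: "\<not> e" using q_not_dvd_p by (auto simp: bs_mod_def)
    have "1 \<le> overlap h (h \<otimes> t)" using l1 l2 o lht nz len_nonneg[of h] by linarith
    then have "starts (h \<otimes> t) r e" by (rule starts_overlap[OF _ re])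
    then show False using starts_unique[OF st] e by blast
  qed
  then obtain k :: int where k: "h = x [^] k" using len_eq_0[OF h] by blast
  have "vertex (h \<otimes> t) = [(k mod q, True)]"
    using vertex_x_pow_mult[OF t_closed, of k] by (simp add: k vertex_t bs_mod_def)
  then have "q dvd k" using v by (simp add: dvd_eq_mod_eq_0)
  then obtain m where m: "k = q * m" by (auto simp: dvd_def)
  have "h \<otimes> t = t \<otimes> x [^] (p * m)" by (simp add: k m bs_rel_t)
  then show ?thesis by (simp add: x_powers_def)
qed

text \<open>Conjugation by \<open>t\<close> turns \<open>b\<close> into an element \<open>h\<close>
  that commutes with \<open>x^p\<close>. As \<open>b\<close> is no power of \<open>x\<close>, the
  path of \<open>h t\<close> does not start with \<open>(0, True)\<close>, and left multiplication
  by \<open>t^-1\<close> prepends \<open>(0, False)\<close>.\<close>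

lemma centralizer_starts:
  assumes b: "b \<in> carrier G" "b \<notin> x_powers" and c: "b \<otimes> wroot (Suc 0) 1 = wroot (Suc 0) 1 \<otimes> b"
  shows "starts b 0 False"
proof -
  define h where "h = t \<otimes> b \<otimes> inv t"
  have h: "h \<in> carrier G" using b by (simp add: h_def)
  have b_h: "b = inv t \<otimes> (h \<otimes> t)" using b by (simp add: h_def m_assoc)
  have w: "wroot (Suc 0) 1 = inv t \<otimes> x [^] p \<otimes> t" by (simp add: wroot_def)
  have "h \<otimes> x [^] p = t \<otimes> (b \<otimes> wroot (Suc 0) 1) \<otimes> inv t" using b by (simp add: h_def w m_assoc)
  also have "\<dots> = x [^] p \<otimes> h" unfolding c using b by (simp add: h_def w m_assoc)
  finally have hx: "h \<otimes> x [^] p = x [^] p \<otimes> h" .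
  have n0: "vertex (h \<otimes> t) \<noteq> (0, True) # L" for L
    using vertex_up_not_zero[OF h hx] b_h b(2) by metis
  have "vertex b = nf_stable False (vertex (h \<otimes> t))"
    using vertex_t_inv_mult[of "h \<otimes> t"] h b_h by simp
  also have "\<dots> = (0, False) # vertex (h \<otimes> t)"
    using n0 by (cases rule: nf_cases[where L = "vertex (h \<otimes> t)" and e = False]) auto
  finally show ?thesis by (simp add: starts_def)
qed

text \<open>The element \<open>t^-1 x^p t\<close> is fixed by \<open>\<psi>\<close> as well as by
  all \<open>\<phi>_k\<close>, because \<open>x\<close> commutes with \<open>x^p\<close>. Fixing it
  passes to products and still controls the images of all \<open>wroot k c\<close>, which commute
  with it.\<close>

definition fixers :: "(bs_gen word set \<Rightarrow> bs_gen word set) set" where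
  "fixers = {\<gamma> \<in> auto G. \<gamma> x = x \<and> \<gamma> (wroot (Suc 0) 1) = wroot (Suc 0) 1}"

lemma psi_fixers [simp]: "psi k \<in> fixers"
proof -
  interpret group_hom G G "psi k" by (rule auto_group_hom) simp
  have "psi k (wroot (Suc 0) 1) = inv t \<otimes> (x [^] (- k) \<otimes> x [^] p \<otimes> x [^] k) \<otimes> t"
    by (simp add: wroot_def psi_hom(3) hom_int_pow psi_hom(2) inv_mult_group m_assoc int_pow_neg)
  also have "x [^] (- k) \<otimes> x [^] p \<otimes> x [^] k = x [^] p"
    by (simp flip: int_pow_mult)
  finally show ?thesis by (simp add: fixers_def psi_hom(2)) (simp add: wroot_def)
qed

lemma phi_fixers [simp]: "phi k i \<in> fixers"
  by (simp add: fixers_def phi_hom(2) wroot_fixed[OF phi_hom])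

lemma fixers_mult: "\<alpha> \<in> fixers \<Longrightarrow> \<beta> \<in> fixers \<Longrightarrow> \<alpha> \<otimes>\<^bsub>AutoGroup G\<^esub> \<beta> \<in> fixers"
  by (simp add: fixers_def auto_mult_closed auto_mult_apply)

lemma fixers_image_starts:
  assumes \<gamma>: "\<gamma> \<in> fixers" and b: "wroot k c \<notin> x_powers"
  shows "starts (\<gamma> (wroot k c)) 0 False" "starts (inv (\<gamma> (wroot k c))) 0 False"
proof -
  have \<gamma>': "\<gamma> \<in> auto G" "\<gamma> x = x" "\<gamma> (wroot (Suc 0) 1) = wroot (Suc 0) 1" using \<gamma> by (auto simp: fixers_def)
  interpret group_hom G G \<gamma> by (rule auto_group_hom[OF \<gamma>'(1)])
  have inj: "inj_on \<gamma> (carrier G)" using \<gamma>'(1) by (simp add: auto_def Bij_def bij_betw_def)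
  have nx: "\<gamma> (wroot k c') \<notin> x_powers" if "wroot k c' \<notin> x_powers" for c'
  proof
    assume "\<gamma> (wroot k c') \<in> x_powers"
    then obtain j :: int where j: "\<gamma> (wroot k c') = x [^] j" by (auto simp: x_powers_def)
    then have "\<gamma> (wroot k c') = \<gamma> (x [^] j)" using hom_fix_x_pow[OF homh \<gamma>'(2)] by simp
    then have "wroot k c' = x [^] j" using inj_onD[OF inj] by simp
    then show False using that by (auto simp: x_powers_def)
  qed
  have comm: "\<gamma> (wroot k c') \<otimes> wroot (Suc 0) 1 = wroot (Suc 0) 1 \<otimes> \<gamma> (wroot k c')" for c'
    using wroot_comm[of k c' "Suc 0" 1] hom_mult[of "wroot k c'" "wroot (Suc 0) 1"] hom_mult[of "wroot (Suc 0) 1" "wroot k c'"]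
    by (simp add: \<gamma>'(3))
  show "starts (\<gamma> (wroot k c)) 0 False"
    by (rule centralizer_starts[OF _ nx[OF b] comm]) simp
  have b': "wroot k (- c) \<notin> x_powers"
    using b subgroup.m_inv_closed[OF subgroup_x_powers, of "wroot k (- c)"] by (auto simp: wroot_inv)
  have "starts (\<gamma> (wroot k (- c))) 0 False"
    by (rule centralizer_starts[OF _ nx[OF b'] comm]) simp
  then show "starts (inv (\<gamma> (wroot k c))) 0 False" by (simp flip: wroot_inv)
qed

text \<open>For \<open>\<gamma>' = \<gamma> \<psi>^i \<phi>_k^c\<close> the image of
  \<open>t\<close> is \<open>\<gamma> (\<psi>^i (wroot k c))\<close> times
  \<open>x^i \<gamma> t\<close>. The first factor and its inverse start with
  \<open>(0, False)\<close>; the second starts elsewhere, since \<open>p\<close> does not divide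
  \<open>i\<close> or since it starts with \<open>t\<close>. So the edge \<open>(0, False)\<close>
  persists.\<close>

lemma alternating_autos:
  assumes "\<gamma> \<in> alternating (AutoGroup G) psis phis"
  shows "\<gamma> \<in> fixers" "starts (\<gamma> t) 0 False"
proof -
  \<comment> \<open>One inductive step for both rules of \<open>alternating\<close>; the base rule
    is the case in which \<open>\<gamma>\<close> is the identity.\<close>
  have extend: "\<gamma>' \<in> fixers \<and> starts (\<gamma>' t) 0 False"
    if \<gamma>: "\<gamma> \<in> fixers" and ab: "a = psi i" "b = phi k c" "b \<notin> psis"
      and \<gamma>'_def: "\<gamma>' = \<gamma> \<otimes>\<^bsub>AutoGroup G\<^esub> (a \<otimes>\<^bsub>AutoGroup G\<^esub> b)"
      and st: "\<exists>e r. starts (x [^] i \<otimes> \<gamma> t) r e \<and> (r, e) \<noteq> (0, False)" for \<gamma> \<gamma>' a b i k c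
  proof -
    have \<gamma>a: "\<gamma> \<in> auto G" "\<gamma> x = x" using \<gamma> by (auto simp: fixers_def)
    interpret group_hom G G \<gamma> by (rule auto_group_hom[OF \<gamma>a(1)])
    have fix': "\<gamma>' \<in> fixers" unfolding \<gamma>'_def ab by (intro fixers_mult \<gamma> psi_fixers phi_fixers)
    have "wroot k c \<notin> x_powers"
    proof
      assume "wroot k c \<in> x_powers"
      then have "phi k c \<in> psis" using phi_eq_psi[OF wroot_in_x_powers] by (auto simp: psis_def)
      then show False using ab by simp
    qed
    moreover have "\<gamma> \<otimes>\<^bsub>AutoGroup G\<^esub> psi i \<in> fixers" by (intro fixers_mult \<gamma> psi_fixers)
    ultimately have u: "starts (\<gamma> (psi i (wroot k c))) 0 False" "starts (inv (\<gamma> (psi i (wroot k c)))) 0 False"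
      using fixers_image_starts[of "\<gamma> \<otimes>\<^bsub>AutoGroup G\<^esub> psi i" k c] \<gamma>a by (simp_all add: auto_mult_apply)
    interpret psi: group_hom G G "psi i" by (rule auto_group_hom) simp
    have "\<gamma>' t = \<gamma> (psi i (wroot k c \<otimes> t))"
      using \<gamma>a by (simp add: \<gamma>'_def ab auto_mult_apply auto_mult_closed phi_hom(3))
    also have "\<dots> = \<gamma> (psi i (wroot k c)) \<otimes> (x [^] i \<otimes> \<gamma> t)"
      by (simp add: psi_hom(3) hom_fix_x_pow[OF homh \<gamma>a(2)])
    finally have e: "\<gamma>' t = \<gamma> (psi i (wroot k c)) \<otimes> (x [^] i \<otimes> \<gamma> t)" .
    obtain r e where re: "starts (x [^] i \<otimes> \<gamma> t) r e" "(0, False) \<noteq> (r, e)" using st by metis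
    have "starts (\<gamma>' t) 0 False"
      unfolding e using mult_no_cancel(2)[OF _ _ u(2) re u(1)] by simp
    then show ?thesis using fix' by simp
  qed
  interpret A: group "AutoGroup G" by (rule AutoGroup)
  have one: "\<one>\<^bsub>AutoGroup G\<^esub> \<in> fixers" using psi_fixers[of 0] by (simp add: psi_zero)
  from assms have "\<gamma> \<in> fixers \<and> starts (\<gamma> t) 0 False"
  proof induction
    case (base a b)
    then obtain i k c where ab: "a = psi i" "b = phi k c" by (auto simp: psis_def phis_def)
    have "starts (x [^] i \<otimes> \<one>\<^bsub>AutoGroup G\<^esub> t) (i mod q) True"
      using vertex_x_pow_mult[OF t_closed, of i] by (simp add: starts_def one_AutoGroup vertex_t bs_mod_def)
    then have ex: "\<exists>e r. starts (x [^] i \<otimes> \<one>\<^bsub>AutoGroup G\<^esub> t) r e \<and> (r, e) \<noteq> (0, False)" by blast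
    have "a \<otimes>\<^bsub>AutoGroup G\<^esub> b = \<one>\<^bsub>AutoGroup G\<^esub> \<otimes>\<^bsub>AutoGroup G\<^esub> (a \<otimes>\<^bsub>AutoGroup G\<^esub> b)"
      using A.l_one[of "a \<otimes>\<^bsub>AutoGroup G\<^esub> b"] by (simp add: ab auto_mult_closed)
    from extend[OF one ab base(3) this ex] show ?case .
  next
    case (step g a b)
    then obtain i k c where ab: "a = psi i" "b = phi k c" by (auto simp: psis_def phis_def)
    have "\<not> p dvd i"
    proof
      assume "p dvd i"
      then have "a = phi 0 (i div p)" by (simp add: phi_0 ab)
      then show False using step(3) by (auto simp: phis_def)
    qed
    moreover have g: "g t \<in> carrier G" using step.IH by (auto simp: fixers_def auto_closed)
    ultimately have "starts (x [^] i \<otimes> g t) (i mod p) False" "i mod p \<noteq> 0"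
      using starts_x_pow[OF g, of 0 False i] step.IH by (simp_all add: bs_mod_def dvd_eq_mod_eq_0)
    then have ex: "\<exists>e r. starts (x [^] i \<otimes> g t) r e \<and> (r, e) \<noteq> (0, False)" by blast
    from step.IH have "g \<in> fixers" ..
    from extend[OF this ab step(5) HOL.refl ex] show ?case .
  qed
  then show "\<gamma> \<in> fixers" "starts (\<gamma> t) 0 False" by auto
qed

text \<open>Evaluation at \<open>x\<close> decides: with \<open>\<epsilon> = \<iota>\<close> the
  element \<open>g\<close> would conjugate \<open>x\<close> to \<open>x^(-1)\<close>, which is
  impossible, and otherwise \<open>g\<close> centralises \<open>x\<close> and is one of its powers.
  Evaluation at \<open>t\<close> gives the equation.\<close>

lemma trivial_product:
  assumes g: "g \<in> carrier G" and \<gamma>: "\<gamma> \<in> auto G" "\<gamma> x = x" and e: "\<epsilon> \<in> {\<one>\<^bsub>AutoGroup G\<^esub>, iota}"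
    and triv: "conj_auto G g \<otimes>\<^bsub>AutoGroup G\<^esub> \<gamma> \<otimes>\<^bsub>AutoGroup G\<^esub> \<epsilon> = \<one>\<^bsub>AutoGroup G\<^esub>"
  shows "\<epsilon> = \<one>\<^bsub>AutoGroup G\<^esub>" "\<exists>j::int. g = x [^] j \<and> x [^] j \<otimes> \<gamma> t = t \<otimes> x [^] j"
proof -
  have one: "\<one>\<^bsub>AutoGroup G\<^esub> \<in> auto G" using psi_auto[of 0] by (simp add: psi_zero)
  have cg: "conj_auto G g \<in> auto G" by (rule conj_auto_in_auto[OF g])
  have \<epsilon>: "\<epsilon> \<in> auto G" using e one by auto
  have ap: "g \<otimes> \<gamma> (\<epsilon> h) \<otimes> inv g = h" if "h \<in> carrier G" for h
  proof -
    have "(conj_auto G g \<otimes>\<^bsub>AutoGroup G\<^esub> \<gamma> \<otimes>\<^bsub>AutoGroup G\<^esub> \<epsilon>) h = h"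
      unfolding triv using that by (simp add: one_AutoGroup)
    then show ?thesis
      using that \<gamma> \<epsilon> cg by (simp add: auto_mult_apply auto_mult_closed auto_closed conj_auto_apply)
  qed
  interpret group_hom G G \<gamma> by (rule auto_group_hom[OF \<gamma>(1)])
  show e1: "\<epsilon> = \<one>\<^bsub>AutoGroup G\<^esub>"
  proof (rule ccontr)
    assume "\<epsilon> \<noteq> \<one>\<^bsub>AutoGroup G\<^esub>"
    then have "\<epsilon> = iota" using e by simp
    then have "g \<otimes> inv x \<otimes> inv g = x" using ap[of x] by (simp add: iota_hom(2) \<gamma>(2))
    then have "inv (g \<otimes> inv x \<otimes> inv g) = inv x" by simp
    then have "g \<otimes> x \<otimes> inv g = x [^] (- 1 :: int)" using g by (simp add: inv_mult_group m_assoc int_pow_neg)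
    then show False using conj_x_eq_pow(2)[OF g] by fastforce
  qed
  have "g \<otimes> x \<otimes> inv g = x [^] (1::int)" using ap[of x] by (simp add: e1 one_AutoGroup \<gamma>(2))
  then obtain j :: int where j: "g = x [^] j" using conj_x_eq_pow(1)[OF g] by blast
  have "g \<otimes> \<gamma> t \<otimes> inv g = t" using ap[of t] by (simp add: e1 one_AutoGroup)
  then have "g \<otimes> \<gamma> t = t \<otimes> g" using conj_eq_iff[OF g] by simp
  then show "\<exists>j::int. g = x [^] j \<and> x [^] j \<otimes> \<gamma> t = t \<otimes> x [^] j" using j by blast
qed

text \<open>The equation for the images of \<open>t\<close> would equate an element that starts
  downwards with \<open>t x^j\<close>, which starts upwards.\<close>

lemma trivial_product_alternating:
  assumes "g \<in> carrier G" "h \<in> alternating (AutoGroup G) psis phis" "\<epsilon> \<in> {\<one>\<^bsub>AutoGroup G\<^esub>, iota}"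
  shows "conj_auto G g \<otimes>\<^bsub>AutoGroup G\<^esub> (h \<otimes>\<^bsub>AutoGroup G\<^esub> psi i) \<otimes>\<^bsub>AutoGroup G\<^esub> \<epsilon> \<noteq> \<one>\<^bsub>AutoGroup G\<^esub>"
proof
  assume triv: "conj_auto G g \<otimes>\<^bsub>AutoGroup G\<^esub> (h \<otimes>\<^bsub>AutoGroup G\<^esub> psi i) \<otimes>\<^bsub>AutoGroup G\<^esub> \<epsilon> = \<one>\<^bsub>AutoGroup G\<^esub>"
  have h: "h \<in> auto G" "h x = x" "starts (h t) 0 False"
    using alternating_autos[OF assms(2)] by (simp_all add: fixers_def)
  interpret group_hom G G h by (rule auto_group_hom[OF h(1)])
  have "h \<otimes>\<^bsub>AutoGroup G\<^esub> psi i \<in> auto G" "(h \<otimes>\<^bsub>AutoGroup G\<^esub> psi i) x = x"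
    using h by (simp_all add: auto_mult_closed auto_mult_apply psi_hom(2))
  then obtain j :: int where j: "x [^] j \<otimes> (h \<otimes>\<^bsub>AutoGroup G\<^esub> psi i) t = t \<otimes> x [^] j"
    using trivial_product(2)[OF assms(1) _ _ assms(3) triv] by blast
  have "(h \<otimes>\<^bsub>AutoGroup G\<^esub> psi i) t = x [^] i \<otimes> h t"
    using h by (simp add: auto_mult_apply psi_hom(3) hom_fix_x_pow[OF homh h(2)])
  then have "starts ((h \<otimes>\<^bsub>AutoGroup G\<^esub> psi i) t) ((0 + i) mod bs_mod p q False) False"
    using starts_x_pow[OF _ h(3), of i] by simp
  from starts_x_pow[OF _ this, of j] obtain r where "starts (t \<otimes> x [^] j) r False"
    using j h by (auto simp: auto_mult_closed auto_closed)
  then show False by (simp add: starts_mult_x_pow) (simp add: starts_def vertex_t)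
qed

text \<open>Comparing first edges shows that \<open>q\<close> divides \<open>j + i\<close>; moving
  this multiple of \<open>q\<close> past \<open>t\<close> determines \<open>j\<close>.\<close>

lemma x_pow_t_eq:
  assumes "x [^] j \<otimes> (x [^] i \<otimes> t) = t \<otimes> x [^] j"
  shows "\<exists>m. j = p * m \<and> i = p * (n - 1) * m"
proof -
  have "x [^] (j + i) \<otimes> t = t \<otimes> x [^] j" using assms by (simp add: int_pow_mult m_assoc)
  note e = this
  have "vertex (x [^] (j + i) \<otimes> t) = [((j + i) mod q, True)]"
    by (simp only: vertex_x_pow_mult[OF t_closed] vertex_t) (simp add: bs_mod_def)
  moreover have "vertex (t \<otimes> x [^] j) = [(0, True)]"
    by (simp add: vertex_mult_x_pow vertex_t)
  ultimately have "(j + i) mod q = 0" unfolding e by simp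
  then obtain m where m: "j + i = q * m" by (auto simp: dvd_def simp flip: dvd_eq_mod_eq_0)
  then have "t \<otimes> x [^] (p * m) = t \<otimes> x [^] j" using e by (simp add: bs_rel_t)
  then have "x [^] (p * m) = x [^] j" by simp
  then have "j = p * m" by (simp only: x_pow_inj)
  then show ?thesis using m by (intro exI[of _ m]) (auto simp: q_eq algebra_simps)
qed

lemma trivial_product_psi:
  assumes "g \<in> carrier G" "\<epsilon> \<in> {\<one>\<^bsub>AutoGroup G\<^esub>, iota}"
    and "conj_auto G g \<otimes>\<^bsub>AutoGroup G\<^esub> psi i \<otimes>\<^bsub>AutoGroup G\<^esub> \<epsilon> = \<one>\<^bsub>AutoGroup G\<^esub>"
  shows "\<epsilon> = \<one>\<^bsub>AutoGroup G\<^esub>" "\<exists>m. g = x [^] (p * m) \<and> i = p * (n - 1) * m"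
  using trivial_product[OF assms(1) psi_auto psi_hom(2) assms(2,3)] x_pow_t_eq
  by (auto simp: psi_hom(3))

text \<open>Conjugating \<open>t\<close> by \<open>x^(p*m)\<close> gives
  \<open>x^(p*m - q*m) t\<close>. Together with \<open>x_pow_t_eq\<close> this shows that the inner
  powers of \<open>\<psi>\<close> are the multiples of \<open>p * (n - 1)\<close>.\<close>

lemma conj_auto_x_pow_eq_psi: "conj_auto G (x [^] (p * m)) = psi (- (p * (n - 1) * m))"
proof (rule auto_eq_on_generators)
  have "x [^] (p * m) \<otimes> t \<otimes> x [^] (- (p * m)) = x [^] (p * m) \<otimes> (t \<otimes> x [^] (p * (- m)))"
    by (simp add: m_assoc)
  also have "\<dots> = (x [^] (p * m) \<otimes> x [^] (q * (- m))) \<otimes> t"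
    unfolding bs_rel_t by (simp add: m_assoc)
  also have "x [^] (p * m) \<otimes> x [^] (q * (- m)) = x [^] (- (p * (n - 1) * m))"
    by (simp add: q_eq algebra_simps flip: int_pow_mult)
  finally show "conj_auto G (x [^] (p * m)) t = psi (- (p * (n - 1) * m)) t"
    by (simp add: conj_auto_apply psi_hom(3) int_pow_neg)
qed (simp_all add: conj_auto_in_auto conj_auto_x_pow psi_hom(2))

end

section \<open>The presentation of the automorphism group\<close>

context bs
begin

text \<open>The defining relations as equations in an arbitrary group, bracketed as
  \<open>eval_word\<close> evaluates the words. They are established for the automorphisms and then
  exploited in the presented group.\<close>

definition aut_relations :: "('b, 'm) monoid_scheme \<Rightarrow> (aut_gen \<Rightarrow> 'b) \<Rightarrow> bool" where
  "aut_relations H f \<longleftrightarrow>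
     f Ct \<otimes>\<^bsub>H\<^esub> (f Cx [^]\<^bsub>H\<^esub> p \<otimes>\<^bsub>H\<^esub> inv\<^bsub>H\<^esub> f Ct) = f Cx [^]\<^bsub>H\<^esub> q \<and>
     inv\<^bsub>H\<^esub> f Iota = f Iota \<and>
     f Iota \<otimes>\<^bsub>H\<^esub> (f Cx \<otimes>\<^bsub>H\<^esub> f Iota) = inv\<^bsub>H\<^esub> f Cx \<and>
     f Iota \<otimes>\<^bsub>H\<^esub> (f Ct \<otimes>\<^bsub>H\<^esub> f Iota) = f Ct \<and>
     f Iota \<otimes>\<^bsub>H\<^esub> (f Psi \<otimes>\<^bsub>H\<^esub> f Iota) = inv\<^bsub>H\<^esub> f Psi \<and>
     f Psi [^]\<^bsub>H\<^esub> p = f (Phi 1) [^]\<^bsub>H\<^esub> n \<and>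
     f Psi [^]\<^bsub>H\<^esub> (p * (n - 1)) = f Cx [^]\<^bsub>H\<^esub> (- p) \<and>
     f Psi \<otimes>\<^bsub>H\<^esub> (f Cx \<otimes>\<^bsub>H\<^esub> inv\<^bsub>H\<^esub> f Psi) = f Cx \<and>
     f Psi \<otimes>\<^bsub>H\<^esub> (f Ct \<otimes>\<^bsub>H\<^esub> inv\<^bsub>H\<^esub> f Psi) = f Cx \<otimes>\<^bsub>H\<^esub> f Ct \<and>
     (\<forall>k\<ge>1. f Iota \<otimes>\<^bsub>H\<^esub> (f (Phi k) \<otimes>\<^bsub>H\<^esub> f Iota) = inv\<^bsub>H\<^esub> f (Phi k)) \<and>
     (\<forall>k\<ge>1. f (Phi k) \<otimes>\<^bsub>H\<^esub> (f Cx \<otimes>\<^bsub>H\<^esub> inv\<^bsub>H\<^esub> f (Phi k)) = f Cx) \<and>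
     (\<forall>k\<ge>1. f (Phi k) \<otimes>\<^bsub>H\<^esub> (f Ct \<otimes>\<^bsub>H\<^esub> inv\<^bsub>H\<^esub> f (Phi k))
        = f Ct [^]\<^bsub>H\<^esub> (- int k) \<otimes>\<^bsub>H\<^esub> (f Cx [^]\<^bsub>H\<^esub> p \<otimes>\<^bsub>H\<^esub> f Ct [^]\<^bsub>H\<^esub> (int k + 1))) \<and>
     (\<forall>k\<ge>1. f (Phi (k + 1)) [^]\<^bsub>H\<^esub> n = f (Phi k))"

lemma aut_gens_simps [simp]:
  "Cx \<in> aut_gens" "Ct \<in> aut_gens" "Psi \<in> aut_gens" "Iota \<in> aut_gens" "Phi k \<in> aut_gens \<longleftrightarrow> 1 \<le> k"
  by (auto simp: aut_gens_def)

lemma aut_rels_lists: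
  assumes "(l, r) \<in> aut_rels p n q"
  shows "l \<in> lists (aut_gens \<times> UNIV)" "r \<in> lists (aut_gens \<times> UNIV)"
  using assms
  by (auto simp: aut_rels_def Let_def letter_lists word_inv_lists word_pow_lists)

lemma aut_relations_iff:
  fixes H :: "('b, 'm) monoid_scheme"
  assumes H: "group H" and f: "f \<in> aut_gens \<rightarrow> carrier H"
  shows "aut_relations H f \<longleftrightarrow> (\<forall>(l, r)\<in>aut_rels p n q. eval_word H f l = eval_word H f r)"
proof -
  interpret H: group H by (rule H)
  have c: "f a \<in> carrier H" if "a \<in> aut_gens" for a using f that by auto
  show ?thesis
    unfolding aut_relations_def aut_rels_def Let_def ball_Un
    by (simp add: H.eval_word_append[OF f] H.eval_word_inv[OF f] H.eval_word_pow[OF f]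
        H.eval_word_letter c letter_lists word_inv_lists word_pow_lists
        setcompr_eq_image ball_simps(9) del: One_nat_def)
qed

lemma auto_conj_conj:
  assumes "\<alpha> \<in> auto G" "g \<in> carrier G"
  shows "\<alpha> \<otimes>\<^bsub>AutoGroup G\<^esub> (conj_auto G g \<otimes>\<^bsub>AutoGroup G\<^esub> inv\<^bsub>AutoGroup G\<^esub> \<alpha>) = conj_auto G (\<alpha> g)"
proof -
  interpret A: group "AutoGroup G" by (rule AutoGroup)
  have c: "conj_auto G (\<alpha> g) \<in> auto G" "conj_auto G g \<in> auto G"
    using assms by (simp_all add: conj_auto_in_auto auto_closed)
  have "\<alpha> \<otimes>\<^bsub>AutoGroup G\<^esub> (conj_auto G g \<otimes>\<^bsub>AutoGroup G\<^esub> inv\<^bsub>AutoGroup G\<^esub> \<alpha>)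
      = conj_auto G (\<alpha> g) \<otimes>\<^bsub>AutoGroup G\<^esub> \<alpha> \<otimes>\<^bsub>AutoGroup G\<^esub> inv\<^bsub>AutoGroup G\<^esub> \<alpha>"
    using A.m_assoc[of \<alpha> "conj_auto G g" "inv\<^bsub>AutoGroup G\<^esub> \<alpha>"] assms c
    by (simp add: conj_conj_auto auto_inv_closed)
  also have "\<dots> = conj_auto G (\<alpha> g)"
    using A.m_assoc[of "conj_auto G (\<alpha> g)" \<alpha> "inv\<^bsub>AutoGroup G\<^esub> \<alpha>"] A.r_inv[of \<alpha>] A.r_one c assms
    by (simp add: auto_inv_closed)
  finally show ?thesis .
qed

lemma iota_not_one: "iota \<noteq> \<one>\<^bsub>AutoGroup G\<^esub>"
proof
  assume "iota = \<one>\<^bsub>AutoGroup G\<^esub>"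
  then have "inv x = x" using iota_hom(2) by (simp add: one_AutoGroup)
  then have "x [^] (- 1 :: int) = x [^] (1 :: int)" by (simp add: int_pow_neg)
  then show False by (simp only: x_pow_inj)
qed

lemma iota_inv: "inv\<^bsub>AutoGroup G\<^esub> iota = iota"
  using group.inv_equality[OF AutoGroup iota_mult] by simp

lemma iota_psi: "iota \<otimes>\<^bsub>AutoGroup G\<^esub> (psi k \<otimes>\<^bsub>AutoGroup G\<^esub> iota) = psi (- k)"
proof -
  interpret i: group_hom G G iota by (rule auto_group_hom) simp
  interpret s: group_hom G G "psi k" by (rule auto_group_hom) simp
  show ?thesis
    by (rule auto_eq_on_generators)
      (simp_all add: auto_mult_closed auto_mult_apply iota_hom(2,3) psi_hom(2,3) i.hom_int_pow
        int_pow_inv int_pow_neg)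
qed

lemma iota_phi: "iota \<otimes>\<^bsub>AutoGroup G\<^esub> (phi k i \<otimes>\<^bsub>AutoGroup G\<^esub> iota) = phi k (- i)"
proof -
  interpret i: group_hom G G iota by (rule auto_group_hom) simp
  interpret s: group_hom G G "phi k i" by (rule auto_group_hom) simp
  have "iota (wroot k i) = wroot k (- i)"
    by (simp add: wroot_def i.hom_int_pow i.hom_nat_pow iota_hom(2,3) int_pow_inv int_pow_neg)
  then show ?thesis
    by (intro auto_eq_on_generators)
      (simp_all add: auto_mult_closed auto_mult_apply iota_hom(2,3) phi_hom(2,3))
qed

lemma psi_inv: "inv\<^bsub>AutoGroup G\<^esub> psi k = psi (- k)"
  using group.inv_equality[OF AutoGroup, of "psi (- k)" "psi k"] by (simp add: psi_mult psi_zero)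

lemma phi_inv: "inv\<^bsub>AutoGroup G\<^esub> phi k i = phi k (- i)"
  using group.inv_equality[OF AutoGroup, of "phi k (- i)" "phi k i"] by (simp add: phi_mult phi_zero)

lemma aut_relations_auto: "aut_relations (AutoGroup G) (aut_val p q)"
proof -
  interpret c: group_hom G "AutoGroup G" "conj_auto G"
    by (simp add: group_hom_def group_hom_axioms_def AutoGroup conj_auto_hom)
  have 1: "conj_auto G t \<otimes>\<^bsub>AutoGroup G\<^esub> (conj_auto G x [^]\<^bsub>AutoGroup G\<^esub> p \<otimes>\<^bsub>AutoGroup G\<^esub> inv\<^bsub>AutoGroup G\<^esub> conj_auto G t)
      = conj_auto G x [^]\<^bsub>AutoGroup G\<^esub> q"
  proof -
    have "conj_auto G (t \<otimes> (x [^] p \<otimes> inv t)) = conj_auto G (x [^] q)"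
      using bs_rel by (simp add: m_assoc)
    then show ?thesis by (simp add: c.hom_int_pow)
  qed
  have iota_c: "iota \<otimes>\<^bsub>AutoGroup G\<^esub> (conj_auto G g \<otimes>\<^bsub>AutoGroup G\<^esub> iota) = conj_auto G (iota g)"
    if "g \<in> carrier G" for g
    using auto_conj_conj[OF iota_auto that] by (simp add: iota_inv)
  have 6: "psi 1 [^]\<^bsub>AutoGroup G\<^esub> p = phi 1 1 [^]\<^bsub>AutoGroup G\<^esub> n"
    using phi_lift[of 0 1 1] by (simp add: psi_pow phi_pow phi_0)
  have 7: "psi 1 [^]\<^bsub>AutoGroup G\<^esub> (p * (n - 1)) = conj_auto G x [^]\<^bsub>AutoGroup G\<^esub> (- p)"
    using conj_auto_x_pow_eq_psi[of "- 1"] by (simp add: psi_pow c.hom_int_pow)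
  have 12: "phi k 1 \<otimes>\<^bsub>AutoGroup G\<^esub> (conj_auto G t \<otimes>\<^bsub>AutoGroup G\<^esub> inv\<^bsub>AutoGroup G\<^esub> phi k 1)
      = conj_auto G t [^]\<^bsub>AutoGroup G\<^esub> (- int k) \<otimes>\<^bsub>AutoGroup G\<^esub>
        (conj_auto G x [^]\<^bsub>AutoGroup G\<^esub> p \<otimes>\<^bsub>AutoGroup G\<^esub> conj_auto G t [^]\<^bsub>AutoGroup G\<^esub> (int k + 1))" for k
  proof -
    have "wroot k 1 \<otimes> t = t [^] (- int k) \<otimes> (x [^] p \<otimes> t [^] (int k + 1))"
      by (simp add: wroot_def int_pow_neg_int int_pow_int int_pow_mult m_assoc)
    then have e: "conj_auto G (wroot k 1 \<otimes> t) = conj_auto G (t [^] (- int k) \<otimes> (x [^] p \<otimes> t [^] (int k + 1)))"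
      by (simp only:)
    show ?thesis
      unfolding auto_conj_conj[OF phi_auto t_closed] phi_hom(3) e
      by (simp only: c.hom_mult c.hom_int_pow m_closed int_pow_closed x_closed t_closed)
  qed
  have 13: "phi (k + 1) 1 [^]\<^bsub>AutoGroup G\<^esub> n = phi k 1" for k
    unfolding phi_pow using phi_lift[of k 1 1] by (simp only: power_one_right mult_1_left)
  have 3: "iota \<otimes>\<^bsub>AutoGroup G\<^esub> (conj_auto G x \<otimes>\<^bsub>AutoGroup G\<^esub> iota) = inv\<^bsub>AutoGroup G\<^esub> conj_auto G x"
    unfolding iota_c[OF x_closed] iota_hom(2) by simp
  have 4: "iota \<otimes>\<^bsub>AutoGroup G\<^esub> (conj_auto G t \<otimes>\<^bsub>AutoGroup G\<^esub> iota) = conj_auto G t"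
    unfolding iota_c[OF t_closed] iota_hom(3) ..
  have 8: "psi 1 \<otimes>\<^bsub>AutoGroup G\<^esub> (conj_auto G x \<otimes>\<^bsub>AutoGroup G\<^esub> inv\<^bsub>AutoGroup G\<^esub> psi 1) = conj_auto G x"
    unfolding auto_conj_conj[OF psi_auto x_closed] psi_hom(2) ..
  have 9: "psi 1 \<otimes>\<^bsub>AutoGroup G\<^esub> (conj_auto G t \<otimes>\<^bsub>AutoGroup G\<^esub> inv\<^bsub>AutoGroup G\<^esub> psi 1)
      = conj_auto G x \<otimes>\<^bsub>AutoGroup G\<^esub> conj_auto G t"
    unfolding auto_conj_conj[OF psi_auto t_closed] psi_hom(3) by simp
  have 11: "phi k 1 \<otimes>\<^bsub>AutoGroup G\<^esub> (conj_auto G x \<otimes>\<^bsub>AutoGroup G\<^esub> inv\<^bsub>AutoGroup G\<^esub> phi k 1) = conj_auto G x" for k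
    unfolding auto_conj_conj[OF phi_auto x_closed] phi_hom(2) ..
  show ?thesis
    unfolding aut_relations_def aut_val_eq
    by (intro conjI allI impI 1 3 4 6 7 8 9 11 12 13 iota_inv
        iota_psi[of 1, folded psi_inv] iota_phi[of _ 1, folded phi_inv])
qed

section \<open>The presented group and its map onto the automorphism group\<close>

abbreviation PA :: "aut_gen word set monoid" where
  "PA \<equiv> presented_group aut_gens (aut_rels p n q)"

abbreviation pgen :: "aut_gen \<Rightarrow> aut_gen word set" where
  "pgen \<equiv> pres_gen aut_gens (aut_rels p n q)"

abbreviation pres_map :: "aut_gen word set \<Rightarrow> bs_gen word set \<Rightarrow> bs_gen word set" where
  "pres_map \<equiv> pres_hom aut_gens (aut_rels p n q) (AutoGroup G) (aut_val p q)"

lemma pgen_funcset: "pgen \<in> aut_gens \<rightarrow> carrier PA"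
  by (auto simp: pres_gen_closed)

lemma aut_relations_PA: "aut_relations PA pgen"
  unfolding aut_relations_iff[OF group_presented_group pgen_funcset]
proof (rule ballI, clarify)
  fix l r assume lr: "(l, r) \<in> aut_rels p n q"
  show "eval_word PA pgen l = eval_word PA pgen r"
    by (rule presented_group_rel[OF lr aut_rels_lists[OF lr]])
qed

lemma aut_val_funcset: "aut_val p q \<in> aut_gens \<rightarrow> carrier (AutoGroup G)"
  by (simp add: aut_val_auto)

lemma aut_rels_auto:
  "(l, r) \<in> aut_rels p n q \<Longrightarrow> eval_word (AutoGroup G) (aut_val p q) l = eval_word (AutoGroup G) (aut_val p q) r"
  using aut_relations_auto unfolding aut_relations_iff[OF AutoGroup aut_val_funcset] by blast

lemma pres_map_hom: "pres_map \<in> hom PA (AutoGroup G)"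
  by (rule pres_hom_hom[OF AutoGroup aut_val_funcset aut_rels_auto])

lemma pres_map_gen: "a \<in> aut_gens \<Longrightarrow> pres_map (pgen a) = aut_val p q a"
  by (rule pres_hom_gen[OF AutoGroup aut_val_funcset aut_rels_auto])

lemma pres_map_surj: "pres_map ` carrier PA = carrier (AutoGroup G)"
proof -
  have "pres_map ` carrier PA = generate (AutoGroup G) (pres_map ` pgen ` aut_gens)"
    by (rule hom_image_generate_eq[OF group_presented_group AutoGroup pres_map_hom])
      (auto simp: pres_gen_closed generate_presented_group)
  also have "pres_map ` pgen ` aut_gens = aut_val p q ` aut_gens"
    unfolding image_image by (rule image_cong) (simp_all add: pres_map_gen)
  also have "generate (AutoGroup G) (aut_val p q ` aut_gens) = carrier (AutoGroup G)"
    using aut_span_eq by (simp add: aut_span_def)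
  finally show ?thesis .
qed

end

context bs
begin

interpretation PA: group PA
  by (rule group_presented_group)

interpretation Aut: group "AutoGroup G"
  by (rule AutoGroup)

interpretation pm: group_hom PA "AutoGroup G" pres_map
  by (simp add: group_hom_def group_hom_axioms_def group_presented_group AutoGroup pres_map_hom)

lemma pgen_closed [simp]: "a \<in> aut_gens \<Longrightarrow> pgen a \<in> carrier PA"
  by (rule pres_gen_closed)

lemmas PA_relations = aut_relations_PA[unfolded aut_relations_def]

lemma PA_rel:
  "pgen Ct \<otimes>\<^bsub>PA\<^esub> pgen Cx [^]\<^bsub>PA\<^esub> p \<otimes>\<^bsub>PA\<^esub> inv\<^bsub>PA\<^esub> pgen Ct = pgen Cx [^]\<^bsub>PA\<^esub> q"
  "inv\<^bsub>PA\<^esub> pgen Iota = pgen Iota"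
  "pgen Psi [^]\<^bsub>PA\<^esub> p = pgen (Phi 1) [^]\<^bsub>PA\<^esub> n"
  "pgen Psi [^]\<^bsub>PA\<^esub> (p * (n - 1)) = pgen Cx [^]\<^bsub>PA\<^esub> (- p)"
  "1 \<le> k \<Longrightarrow> pgen (Phi (k + 1)) [^]\<^bsub>PA\<^esub> n = pgen (Phi k)"
  using PA_relations by (simp_all add: PA.m_assoc)

text \<open>The abstract counterpart of \<open>g \<mapsto> c_g\<close>, well defined by the first
  relation. Its image is the subgroup generated by \<open>Cx\<close> and \<open>Ct\<close>.\<close>

definition kappa :: "bs_gen word set \<Rightarrow> aut_gen word set" where
  "kappa = bs_hom PA (pgen Cx) (pgen Ct)"

lemma kappa: "kappa \<in> hom G PA" "kappa x = pgen Cx" "kappa t = pgen Ct"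
  unfolding kappa_def using bs_hom[OF group_presented_group _ _ PA_rel(1)] by simp_all

interpretation kappa: group_hom G PA kappa
  by (simp add: group_hom_def group_hom_axioms_def group_presented_group kappa)

lemma pres_map_kappa:
  assumes "g \<in> carrier G"
  shows "pres_map (kappa g) = conj_auto G g"
proof -
  have "(pres_map \<circ> kappa) g = conj_auto G g"
    by (rule hom_eqI[OF AutoGroup Group.hom_compose[OF kappa(1) pres_map_hom] conj_auto_hom])
      (simp_all add: assms kappa pres_map_gen aut_val_eq del: aut_val.simps)
  then show ?thesis by simp
qed

lemma conj_PA_hom:
  assumes "m \<in> carrier PA"
  shows "(\<lambda>g. m \<otimes>\<^bsub>PA\<^esub> kappa g \<otimes>\<^bsub>PA\<^esub> inv\<^bsub>PA\<^esub> m) \<in> hom G PA"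
  using assms by (intro homI) (simp_all add: PA.m_assoc)

text \<open>Both sides are homomorphisms in \<open>g\<close>, so \<open>x\<close> and
  \<open>t\<close> suffice; there, for \<open>Psi\<close>, \<open>Iota\<close> and
  \<open>Phi k\<close>, the claim is a defining relation.\<close>

lemma twist_gen:
  assumes a: "a \<in> aut_gens" and g: "g \<in> carrier G"
  shows "pgen a \<otimes>\<^bsub>PA\<^esub> kappa g \<otimes>\<^bsub>PA\<^esub> inv\<^bsub>PA\<^esub> pgen a = kappa (aut_val p q a g)"
proof -
  have "aut_val p q a \<in> hom G G" by (rule auto_hom[OF aut_val_auto])
  then have h2: "kappa \<circ> aut_val p q a \<in> hom G PA" by (rule Group.hom_compose[OF _ kappa(1)])
  have "pgen a \<otimes>\<^bsub>PA\<^esub> kappa x \<otimes>\<^bsub>PA\<^esub> inv\<^bsub>PA\<^esub> pgen a = kappa (aut_val p q a x) \<and>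
    pgen a \<otimes>\<^bsub>PA\<^esub> kappa t \<otimes>\<^bsub>PA\<^esub> inv\<^bsub>PA\<^esub> pgen a = kappa (aut_val p q a t)"
  proof (cases a)
    case Cx
    show ?thesis unfolding Cx aut_val_eq by (simp add: conj_auto_apply kappa)
  next
    case Ct
    show ?thesis unfolding Ct aut_val_eq by (simp add: conj_auto_apply kappa)
  next
    case Psi
    show ?thesis unfolding Psi aut_val_eq psi_hom using PA_relations by (simp add: kappa PA.m_assoc)
  next
    case Iota
    show ?thesis unfolding Iota aut_val_eq iota_hom using PA_relations by (simp add: kappa PA.m_assoc)
  next
    case (Phi k)
    have k: "1 \<le> k" using a by (simp add: Phi)
    have "kappa (wroot k 1 \<otimes> t) = pgen Ct [^]\<^bsub>PA\<^esub> (- int k) \<otimes>\<^bsub>PA\<^esub>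
        (pgen Cx [^]\<^bsub>PA\<^esub> p \<otimes>\<^bsub>PA\<^esub> pgen Ct [^]\<^bsub>PA\<^esub> (int k + 1))"
      by (simp add: wroot_def kappa kappa.hom_nat_pow kappa.hom_int_pow PA.m_assoc
          PA.int_pow_neg_int PA.int_pow_mult int_pow_int)
    then show ?thesis unfolding Phi aut_val_eq phi_hom using PA_relations k by (simp add: kappa PA.m_assoc)
  qed
  then show ?thesis
    using hom_eqI[OF group_presented_group conj_PA_hom h2 _ _ g] a by simp
qed

text \<open>The image of \<open>kappa\<close> is normal, and conjugation acts on it through the
  automorphism that the word represents.\<close>

lemma twist:
  assumes "m \<in> carrier PA" "g \<in> carrier G"
  shows "m \<otimes>\<^bsub>PA\<^esub> kappa g = kappa (pres_map m g) \<otimes>\<^bsub>PA\<^esub> m"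
proof -
  have "m \<in> generate PA (pgen ` aut_gens)" using assms(1) generate_presented_group by blast
  then have "m \<in> carrier PA \<and> (\<forall>g\<in>carrier G. m \<otimes>\<^bsub>PA\<^esub> kappa g = kappa (pres_map m g) \<otimes>\<^bsub>PA\<^esub> m)"
  proof induction
    case one
    then show ?case by (simp add: one_AutoGroup)
  next
    case (incl m)
    then obtain a where a: "a \<in> aut_gens" "m = pgen a" by blast
    have "pgen a \<otimes>\<^bsub>PA\<^esub> kappa g = kappa (aut_val p q a g) \<otimes>\<^bsub>PA\<^esub> pgen a" if "g \<in> carrier G" for g
      using twist_gen[OF a(1) that] PA.conj_eq_iff[of "pgen a" "kappa g" "kappa (aut_val p q a g)"] that a
      by (simp add: auto_closed[OF aut_val_auto])
    then show ?case using a by (simp add: pres_map_gen)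
  next
    case (inv m)
    then obtain a where a: "a \<in> aut_gens" "m = pgen a" by blast
    define \<alpha> where "\<alpha> = aut_val p q a"
    have \<alpha>: "\<alpha> \<in> auto G" by (simp add: \<alpha>_def aut_val_auto)
    have m: "m \<in> carrier PA" using a by simp
    have pi: "pres_map (inv\<^bsub>PA\<^esub> m) = inv\<^bsub>AutoGroup G\<^esub> \<alpha>"
      using a by (simp add: pres_map_gen \<alpha>_def)
    have "inv\<^bsub>PA\<^esub> m \<otimes>\<^bsub>PA\<^esub> kappa g = kappa (pres_map (inv\<^bsub>PA\<^esub> m) g) \<otimes>\<^bsub>PA\<^esub> inv\<^bsub>PA\<^esub> m"
      if g: "g \<in> carrier G" for g
    proof -
      define h where "h = (inv\<^bsub>AutoGroup G\<^esub> \<alpha>) g"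
      have h: "h \<in> carrier G" "\<alpha> h = g"
        using auto_inv_apply(1)[OF \<alpha> g] auto_closed[OF auto_inv_closed[OF \<alpha>] g] by (simp_all add: h_def)
      have "m \<otimes>\<^bsub>PA\<^esub> kappa h \<otimes>\<^bsub>PA\<^esub> inv\<^bsub>PA\<^esub> m = kappa g"
        using twist_gen[OF a(1) h(1)] h(2) by (simp add: a \<alpha>_def)
      then have "inv\<^bsub>PA\<^esub> m \<otimes>\<^bsub>PA\<^esub> kappa g = inv\<^bsub>PA\<^esub> m \<otimes>\<^bsub>PA\<^esub> (m \<otimes>\<^bsub>PA\<^esub> kappa h \<otimes>\<^bsub>PA\<^esub> inv\<^bsub>PA\<^esub> m)"
        by simp
      also have "\<dots> = kappa h \<otimes>\<^bsub>PA\<^esub> inv\<^bsub>PA\<^esub> m" using m h by (simp add: PA.m_assoc)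
      finally show ?thesis by (simp add: pi h_def)
    qed
    then show ?case using m by simp
  next
    case (eng a b)
    have "a \<otimes>\<^bsub>PA\<^esub> b \<otimes>\<^bsub>PA\<^esub> kappa g = kappa (pres_map (a \<otimes>\<^bsub>PA\<^esub> b) g) \<otimes>\<^bsub>PA\<^esub> (a \<otimes>\<^bsub>PA\<^esub> b)"
      if g: "g \<in> carrier G" for g
    proof -
      have ab: "a \<in> carrier PA" "b \<in> carrier PA" "pres_map a \<in> auto G" "pres_map b \<in> auto G"
        using eng pm.hom_closed by auto
      then have c: "pres_map b g \<in> carrier G" "pres_map a (pres_map b g) \<in> carrier G"
        using g by (simp_all add: auto_closed)
      have "a \<otimes>\<^bsub>PA\<^esub> b \<otimes>\<^bsub>PA\<^esub> kappa g = a \<otimes>\<^bsub>PA\<^esub> (b \<otimes>\<^bsub>PA\<^esub> kappa g)" using ab g by (simp add: PA.m_assoc)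
      also have "b \<otimes>\<^bsub>PA\<^esub> kappa g = kappa (pres_map b g) \<otimes>\<^bsub>PA\<^esub> b" using eng g by blast
      also have "a \<otimes>\<^bsub>PA\<^esub> (kappa (pres_map b g) \<otimes>\<^bsub>PA\<^esub> b) = a \<otimes>\<^bsub>PA\<^esub> kappa (pres_map b g) \<otimes>\<^bsub>PA\<^esub> b"
        using ab c by (simp add: PA.m_assoc)
      also have "a \<otimes>\<^bsub>PA\<^esub> kappa (pres_map b g) = kappa (pres_map a (pres_map b g)) \<otimes>\<^bsub>PA\<^esub> a"
        using eng c by blast
      finally show ?thesis using ab c g by (simp add: PA.m_assoc auto_mult_apply)
    qed
    then show ?case using eng by simp
  qed
  then show ?thesis using assms by blast
qed

section \<open>Words in \<open>Psi\<close> and the \<open>Phi k\<close>\<close>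

definition psi_words :: "aut_gen word set set" where
  "psi_words = range (\<lambda>i::int. pgen Psi [^]\<^bsub>PA\<^esub> i)"

definition phi_words :: "aut_gen word set set" where
  "phi_words = {pgen (Phi k) [^]\<^bsub>PA\<^esub> c |k (c::int). 1 \<le> k}"

lemma pres_map_psi: "pres_map (pgen Psi [^]\<^bsub>PA\<^esub> (i::int)) = psi i"
  by (simp add: pm.hom_int_pow pres_map_gen aut_val_eq psi_pow del: aut_val.simps)

lemma pres_map_phi: "1 \<le> k \<Longrightarrow> pres_map (pgen (Phi k) [^]\<^bsub>PA\<^esub> (c::int)) = phi k c"
  by (simp add: pm.hom_int_pow pres_map_gen aut_val_eq phi_pow del: aut_val.simps)

lemma phi_word_lift:
  assumes "1 \<le> k"
  shows "pgen (Phi (k + m)) [^]\<^bsub>PA\<^esub> (c * n ^ m) = pgen (Phi k) [^]\<^bsub>PA\<^esub> c"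
proof (induction m arbitrary: c)
  case (Suc m)
  have "pgen (Phi (k + Suc m)) [^]\<^bsub>PA\<^esub> (c * n ^ Suc m) = (pgen (Phi (k + m + 1)) [^]\<^bsub>PA\<^esub> n) [^]\<^bsub>PA\<^esub> (c * n ^ m)"
    by (simp add: PA.int_pow_pow mult_ac)
  also have "\<dots> = pgen (Phi (k + m)) [^]\<^bsub>PA\<^esub> (c * n ^ m)"
    using PA_rel(5)[of "k + m"] assms by simp
  finally show ?case using Suc by simp
qed simp

lemma phi_word_in_psi_words:
  assumes "1 \<le> k" "n ^ k dvd c"
  shows "pgen (Phi k) [^]\<^bsub>PA\<^esub> c \<in> psi_words"
proof -
  obtain d where d: "c = n ^ k * d" using assms(2) by (auto simp: dvd_def)
  \<comment> \<open>The chain of relations ends at \<open>Phi 1\<close>, which is reached after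
    \<open>k - 1\<close> steps; the remaining factor \<open>n\<close> of \<open>c\<close> is
    absorbed by \<open>\<psi>^p = \<phi>_1^n\<close>.\<close>
  define m where "m = k - 1"
  have k: "k = 1 + m" using assms(1) by (simp add: m_def)
  have "pgen (Phi k) [^]\<^bsub>PA\<^esub> c = pgen (Phi (1 + m)) [^]\<^bsub>PA\<^esub> (n * d * n ^ m)"
    by (simp add: d k mult_ac)
  also have "\<dots> = (pgen (Phi 1) [^]\<^bsub>PA\<^esub> n) [^]\<^bsub>PA\<^esub> d"
    by (simp only: phi_word_lift order.refl) (simp add: PA.int_pow_pow)
  also have "\<dots> = pgen Psi [^]\<^bsub>PA\<^esub> (p * d)"
    unfolding PA_rel(3)[symmetric] by (simp add: PA.int_pow_pow)
  finally show ?thesis by (auto simp: psi_words_def)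
qed

lemma psi_word_in_phi_words:
  assumes "p dvd i"
  shows "pgen Psi [^]\<^bsub>PA\<^esub> i \<in> phi_words"
proof -
  obtain d where d: "i = p * d" using assms by (auto simp: dvd_def)
  have "pgen Psi [^]\<^bsub>PA\<^esub> i = (pgen Psi [^]\<^bsub>PA\<^esub> p) [^]\<^bsub>PA\<^esub> d" by (simp add: d PA.int_pow_pow)
  also have "\<dots> = pgen (Phi 1) [^]\<^bsub>PA\<^esub> (n * d)"
    unfolding PA_rel(3) by (simp add: PA.int_pow_pow)
  finally have "pgen Psi [^]\<^bsub>PA\<^esub> i = pgen (Phi 1) [^]\<^bsub>PA\<^esub> (n * d)" .
  moreover have "(1::nat) \<le> 1" by simp
  ultimately show ?thesis unfolding phi_words_def by blast
qed

lemma subgroup_psi_words: "subgroup psi_words PA"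
  unfolding psi_words_def by (rule PA.subgroup_int_pow_range) simp

lemma subgroup_phi_words: "subgroup phi_words PA"
proof (rule PA.subgroupI)
  show "phi_words \<subseteq> carrier PA" by (auto simp: phi_words_def)
  show "phi_words \<noteq> {}" by (auto simp: phi_words_def)
next
  fix a assume "a \<in> phi_words"
  then obtain k and c :: int where a: "a = pgen (Phi k) [^]\<^bsub>PA\<^esub> c" "1 \<le> k" by (auto simp: phi_words_def)
  then have "inv\<^bsub>PA\<^esub> a = pgen (Phi k) [^]\<^bsub>PA\<^esub> (- c)" by (simp add: PA.int_pow_neg)
  then show "inv\<^bsub>PA\<^esub> a \<in> phi_words" unfolding phi_words_def using a(2) by blast
next
  fix a b assume "a \<in> phi_words" "b \<in> phi_words"
  then obtain k l and c d :: int where a: "a = pgen (Phi k) [^]\<^bsub>PA\<^esub> c" "1 \<le> k"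
    and b: "b = pgen (Phi l) [^]\<^bsub>PA\<^esub> d" "1 \<le> l" by (auto simp: phi_words_def)
  have "a = pgen (Phi (k + l)) [^]\<^bsub>PA\<^esub> (c * n ^ l)"
    unfolding a(1) by (rule phi_word_lift[OF a(2), symmetric])
  moreover have "b = pgen (Phi (k + l)) [^]\<^bsub>PA\<^esub> (d * n ^ k)"
    unfolding b(1) add.commute[of k l] by (rule phi_word_lift[OF b(2), symmetric])
  ultimately have "a \<otimes>\<^bsub>PA\<^esub> b = pgen (Phi (k + l)) [^]\<^bsub>PA\<^esub> (c * n ^ l + d * n ^ k)"
    using a(2) by (simp add: PA.int_pow_mult)
  then show "a \<otimes>\<^bsub>PA\<^esub> b \<in> phi_words" unfolding phi_words_def using a(2) by (metis (mono_tags, lifting) mem_Collect_eq trans_le_add1)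
qed

definition fix_words :: "aut_gen word set set" where
  "fix_words = generate PA (psi_words \<union> phi_words)"

lemma words_closed: "psi_words \<union> phi_words \<subseteq> carrier PA"
  using subgroup.subset[OF subgroup_psi_words] subgroup.subset[OF subgroup_phi_words] by blast

lemma subgroup_fix_words: "subgroup fix_words PA"
  unfolding fix_words_def by (rule PA.generate_is_subgroup[OF words_closed])

text \<open>A word whose automorphism lies in the other family already lies in the other subgroup of
  words, by the relations. So an alternating product of words is mapped to an alternating product of
  automorphisms.\<close>

lemma fix_words_cases:
  assumes "\<mu> \<in> fix_words"
  obtains (psi) i :: int where "\<mu> = pgen Psi [^]\<^bsub>PA\<^esub> i"
  | (alt) h i where "pres_map \<mu> = h \<otimes>\<^bsub>AutoGroup G\<^esub> psi i" "h \<in> alternating (AutoGroup G) psis phis"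
proof -
  consider "\<mu> \<in> psi_words" | h a where "h \<in> alternating PA psi_words phi_words" "a \<in> psi_words" "\<mu> = h \<otimes>\<^bsub>PA\<^esub> a"
    using PA.alternating_exhaust[OF subgroup_psi_words subgroup_phi_words] assms
    unfolding fix_words_def by blast
  then show ?thesis
  proof cases
    case 1
    then show ?thesis using psi by (auto simp: psi_words_def)
  next
    case (2 h a)
    obtain i :: int where i: "a = pgen Psi [^]\<^bsub>PA\<^esub> i" using 2 by (auto simp: psi_words_def)
    have "pres_map h \<in> alternating (AutoGroup G) psis phis"
    proof (rule alternating_hom_image[OF group_presented_group AutoGroup pres_map_hom subgroup_psi_words
          subgroup_phi_words _ _ _ _ 2(1)])
      fix a assume "a \<in> psi_words"
      then obtain i :: int where i: "a = pgen Psi [^]\<^bsub>PA\<^esub> i" by (auto simp: psi_words_def)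
      then show "pres_map a \<in> psis" by (auto simp: pres_map_psi psis_def)
      assume "pres_map a \<in> phis"
      then have "p dvd i" using psi_eq_phi(1) by (auto simp: i pres_map_psi phis_def)
      then show "a \<in> phi_words" unfolding i by (rule psi_word_in_phi_words)
    next
      fix b assume "b \<in> phi_words"
      then obtain k and c :: int where b: "b = pgen (Phi k) [^]\<^bsub>PA\<^esub> c" "1 \<le> k" by (auto simp: phi_words_def)
      then show "pres_map b \<in> phis" by (auto simp: pres_map_phi phis_def)
      assume "pres_map b \<in> psis"
      then obtain j where "psi j = phi k c" using b by (auto simp: pres_map_phi psis_def)
      then have "n ^ k dvd c" by (rule psi_eq_phi(2))
      then show "b \<in> psi_words" unfolding b(1) by (rule phi_word_in_psi_words[OF b(2)])
    qed
    moreover have "pres_map \<mu> = pres_map h \<otimes>\<^bsub>AutoGroup G\<^esub> psi i"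
      using 2(1,3) PA.alternating_closed[OF subgroup_psi_words subgroup_phi_words 2(1)]
      by (simp add: i pres_map_psi)
    ultimately show ?thesis by (intro alt)
  qed
qed

lemma iota_word: "pgen Iota \<otimes>\<^bsub>PA\<^esub> pgen Iota = \<one>\<^bsub>PA\<^esub>"
  using PA_rel(2) PA.r_inv[of "pgen Iota"] by simp

lemma iota_word_conj:
  assumes "\<mu> \<in> fix_words"
  shows "pgen Iota \<otimes>\<^bsub>PA\<^esub> \<mu> \<otimes>\<^bsub>PA\<^esub> pgen Iota \<in> fix_words"
proof -
  have I: "pgen Iota \<in> carrier PA" by simp
  have conj: "pgen Iota \<otimes>\<^bsub>PA\<^esub> g [^]\<^bsub>PA\<^esub> (k::int) \<otimes>\<^bsub>PA\<^esub> pgen Iota = g [^]\<^bsub>PA\<^esub> (- k)"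
    if "g \<in> carrier PA" "pgen Iota \<otimes>\<^bsub>PA\<^esub> (g \<otimes>\<^bsub>PA\<^esub> pgen Iota) = inv\<^bsub>PA\<^esub> g" for g k
  proof -
    have "(pgen Iota \<otimes>\<^bsub>PA\<^esub> g \<otimes>\<^bsub>PA\<^esub> inv\<^bsub>PA\<^esub> pgen Iota) [^]\<^bsub>PA\<^esub> k
        = pgen Iota \<otimes>\<^bsub>PA\<^esub> g [^]\<^bsub>PA\<^esub> k \<otimes>\<^bsub>PA\<^esub> inv\<^bsub>PA\<^esub> pgen Iota"
      by (rule PA.conj_int_pow[OF I that(1)])
    moreover have "pgen Iota \<otimes>\<^bsub>PA\<^esub> g \<otimes>\<^bsub>PA\<^esub> inv\<^bsub>PA\<^esub> pgen Iota = inv\<^bsub>PA\<^esub> g"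
      using that by (simp add: PA_rel(2) PA.m_assoc)
    ultimately show ?thesis using that(1) by (simp add: PA_rel(2) PA.int_pow_inv PA.int_pow_neg)
  qed
  have gen: "pgen Iota \<otimes>\<^bsub>PA\<^esub> a \<otimes>\<^bsub>PA\<^esub> pgen Iota \<in> fix_words" if "a \<in> psi_words \<union> phi_words" for a
    using that
  proof
    assume "a \<in> psi_words"
    then obtain i :: int where i: "a = pgen Psi [^]\<^bsub>PA\<^esub> i" by (auto simp: psi_words_def)
    have "pgen Iota \<otimes>\<^bsub>PA\<^esub> a \<otimes>\<^bsub>PA\<^esub> pgen Iota = pgen Psi [^]\<^bsub>PA\<^esub> (- i)"
      unfolding i using PA_relations by (intro conj) simp_all
    then show ?thesis unfolding fix_words_def by (auto simp: psi_words_def intro!: generate.incl)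
  next
    assume "a \<in> phi_words"
    then obtain k and c :: int where a: "a = pgen (Phi k) [^]\<^bsub>PA\<^esub> c" "1 \<le> k" by (auto simp: phi_words_def)
    have "pgen Iota \<otimes>\<^bsub>PA\<^esub> a \<otimes>\<^bsub>PA\<^esub> pgen Iota = pgen (Phi k) [^]\<^bsub>PA\<^esub> (- c)"
      unfolding a(1) using PA_relations a(2) by (intro conj) simp_all
    then have "pgen Iota \<otimes>\<^bsub>PA\<^esub> a \<otimes>\<^bsub>PA\<^esub> pgen Iota \<in> phi_words"
      unfolding phi_words_def using a(2) by blast
    then show ?thesis unfolding fix_words_def by (simp add: generate.incl)
  qed
  note fw = subgroup.mem_carrier[OF subgroup_fix_words]
  from assms show ?thesis unfolding fix_words_def[of]
  proof induction
    case one
    then show ?case using iota_word by (simp add: generate.one)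
  next
    case (incl a)
    then show ?case using gen by (simp add: fix_words_def)
  next
    case (inv a)
    have a: "a \<in> carrier PA" using inv words_closed by blast
    have "inv\<^bsub>PA\<^esub> (pgen Iota \<otimes>\<^bsub>PA\<^esub> a \<otimes>\<^bsub>PA\<^esub> pgen Iota) = pgen Iota \<otimes>\<^bsub>PA\<^esub> inv\<^bsub>PA\<^esub> a \<otimes>\<^bsub>PA\<^esub> pgen Iota"
      using a by (simp add: PA.inv_mult_group PA_rel(2) PA.m_assoc)
    then show ?case
      using subgroup.m_inv_closed[OF subgroup_fix_words gen[OF inv]] by (simp add: fix_words_def)
  next
    case (eng a b)
    have ab: "a \<in> carrier PA" "b \<in> carrier PA" using eng fw by (simp_all add: fix_words_def)
    have "(pgen Iota \<otimes>\<^bsub>PA\<^esub> a \<otimes>\<^bsub>PA\<^esub> pgen Iota) \<otimes>\<^bsub>PA\<^esub> (pgen Iota \<otimes>\<^bsub>PA\<^esub> b \<otimes>\<^bsub>PA\<^esub> pgen Iota)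
        = pgen Iota \<otimes>\<^bsub>PA\<^esub> a \<otimes>\<^bsub>PA\<^esub> (pgen Iota \<otimes>\<^bsub>PA\<^esub> pgen Iota) \<otimes>\<^bsub>PA\<^esub> b \<otimes>\<^bsub>PA\<^esub> pgen Iota"
      using ab by (simp add: PA.m_assoc)
    also have "\<dots> = pgen Iota \<otimes>\<^bsub>PA\<^esub> (a \<otimes>\<^bsub>PA\<^esub> b) \<otimes>\<^bsub>PA\<^esub> pgen Iota"
      unfolding iota_word using ab by (simp add: PA.m_assoc)
    finally show ?case using generate.eng[OF eng.IH] by simp
  qed
qed

text \<open>Moving the inner part to the left by \<open>twist\<close> and \<open>Iota\<close> to the
  right, where conjugation by it preserves \<open>fix_words\<close>, sorts every word into three
  blocks.\<close>

lemma PA_normal_form: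
  assumes "u \<in> carrier PA"
  shows "\<exists>g\<in>carrier G. \<exists>\<mu>\<in>fix_words. \<exists>i\<in>{\<one>\<^bsub>PA\<^esub>, pgen Iota}. u = kappa g \<otimes>\<^bsub>PA\<^esub> \<mu> \<otimes>\<^bsub>PA\<^esub> i"
proof -
  note fw = subgroup.mem_carrier[OF subgroup_fix_words]
  define Z where "Z = {kappa g \<otimes>\<^bsub>PA\<^esub> \<mu> \<otimes>\<^bsub>PA\<^esub> i |g \<mu> i. g \<in> carrier G \<and> \<mu> \<in> fix_words \<and> i \<in> {\<one>\<^bsub>PA\<^esub>, pgen Iota}}"
  \<comment> \<open>The left multipliers that preserve the sorted forms; once the generators and
    their inverses are seen to belong to them, so does \<open>u\<close>.\<close>
  define Y where "Y = {y \<in> carrier PA. \<forall>z\<in>Z. y \<otimes>\<^bsub>PA\<^esub> z \<in> Z}"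
  have ZI: "kappa g \<otimes>\<^bsub>PA\<^esub> \<mu> \<otimes>\<^bsub>PA\<^esub> i \<in> Z" if "g \<in> carrier G" "\<mu> \<in> fix_words" "i \<in> {\<one>\<^bsub>PA\<^esub>, pgen Iota}" for g \<mu> i
    unfolding Z_def using that by blast
  have ZE: "\<exists>g \<mu> i. z = kappa g \<otimes>\<^bsub>PA\<^esub> \<mu> \<otimes>\<^bsub>PA\<^esub> i \<and> g \<in> carrier G \<and> \<mu> \<in> fix_words \<and> i \<in> {\<one>\<^bsub>PA\<^esub>, pgen Iota}"
    if "z \<in> Z" for z using that unfolding Z_def by blast
  have ZC: "z \<in> carrier PA" if "z \<in> Z" for z
    using ZE[OF that] fw by auto
  have Y_kappa: "kappa h \<in> Y" if h: "h \<in> carrier G" for h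
  proof -
    have "kappa h \<otimes>\<^bsub>PA\<^esub> z \<in> Z" if "z \<in> Z" for z
    proof -
      obtain g \<mu> i where z: "z = kappa g \<otimes>\<^bsub>PA\<^esub> \<mu> \<otimes>\<^bsub>PA\<^esub> i" "g \<in> carrier G" "\<mu> \<in> fix_words"
        "i \<in> {\<one>\<^bsub>PA\<^esub>, pgen Iota}" using ZE[OF \<open>z \<in> Z\<close>] by (elim exE conjE) (rule that)
      have "kappa h \<otimes>\<^bsub>PA\<^esub> z = kappa (h \<otimes> g) \<otimes>\<^bsub>PA\<^esub> \<mu> \<otimes>\<^bsub>PA\<^esub> i"
        using h z fw by (auto simp: PA.m_assoc)
      then show ?thesis using ZI[of "h \<otimes> g" \<mu> i] h z by simp
    qed
    then show ?thesis using h by (simp add: Y_def)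
  qed
  have Y_fix: "\<nu> \<in> Y" if \<nu>: "\<nu> \<in> fix_words" for \<nu>
  proof -
    have "\<nu> \<otimes>\<^bsub>PA\<^esub> z \<in> Z" if "z \<in> Z" for z
    proof -
      obtain g \<mu> i where z: "z = kappa g \<otimes>\<^bsub>PA\<^esub> \<mu> \<otimes>\<^bsub>PA\<^esub> i" "g \<in> carrier G" "\<mu> \<in> fix_words"
        "i \<in> {\<one>\<^bsub>PA\<^esub>, pgen Iota}" using ZE[OF \<open>z \<in> Z\<close>] by (elim exE conjE) (rule that)
      have c: "\<nu> \<in> carrier PA" "\<mu> \<in> carrier PA" "i \<in> carrier PA" "pres_map \<nu> g \<in> carrier G"
        using \<nu> z fw pm.hom_closed[of \<nu>] by (auto simp: auto_closed)
      have "\<nu> \<otimes>\<^bsub>PA\<^esub> z = (\<nu> \<otimes>\<^bsub>PA\<^esub> kappa g) \<otimes>\<^bsub>PA\<^esub> \<mu> \<otimes>\<^bsub>PA\<^esub> i"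
        using z c by (simp add: PA.m_assoc)
      also have "\<dots> = kappa (pres_map \<nu> g) \<otimes>\<^bsub>PA\<^esub> (\<nu> \<otimes>\<^bsub>PA\<^esub> \<mu>) \<otimes>\<^bsub>PA\<^esub> i"
        unfolding twist[OF c(1) z(2)] using z c by (simp add: PA.m_assoc)
      finally show ?thesis
        using ZI[OF c(4) subgroup.m_closed[OF subgroup_fix_words \<nu> z(3)] z(4)] by simp
    qed
    then show ?thesis using \<nu> fw by (simp add: Y_def)
  qed
  have Y_iota: "pgen Iota \<in> Y"
  proof -
    have "pgen Iota \<otimes>\<^bsub>PA\<^esub> z \<in> Z" if "z \<in> Z" for z
    proof -
      obtain g \<mu> i where z: "z = kappa g \<otimes>\<^bsub>PA\<^esub> \<mu> \<otimes>\<^bsub>PA\<^esub> i" "g \<in> carrier G" "\<mu> \<in> fix_words"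
        "i \<in> {\<one>\<^bsub>PA\<^esub>, pgen Iota}" using ZE[OF \<open>z \<in> Z\<close>] by (elim exE conjE) (rule that)
      have I: "pgen Iota \<in> carrier PA" by simp
      have c: "\<mu> \<in> carrier PA" "i \<in> carrier PA" "pres_map (pgen Iota) g \<in> carrier G"
        using z fw pm.hom_closed[OF I] by (auto simp: auto_closed)
      have i': "pgen Iota \<otimes>\<^bsub>PA\<^esub> i \<in> {\<one>\<^bsub>PA\<^esub>, pgen Iota}" using z(4) iota_word by (elim insertE emptyE) simp_all
      have "pgen Iota \<otimes>\<^bsub>PA\<^esub> z = (pgen Iota \<otimes>\<^bsub>PA\<^esub> kappa g) \<otimes>\<^bsub>PA\<^esub> \<mu> \<otimes>\<^bsub>PA\<^esub> i"
        using z c by (simp add: PA.m_assoc)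
      also have "\<dots> = kappa (pres_map (pgen Iota) g) \<otimes>\<^bsub>PA\<^esub>
          (pgen Iota \<otimes>\<^bsub>PA\<^esub> \<mu> \<otimes>\<^bsub>PA\<^esub> (pgen Iota \<otimes>\<^bsub>PA\<^esub> pgen Iota)) \<otimes>\<^bsub>PA\<^esub> i"
        unfolding twist[OF I z(2)] iota_word using z c by (simp add: PA.m_assoc)
      also have "\<dots> = kappa (pres_map (pgen Iota) g) \<otimes>\<^bsub>PA\<^esub>
          (pgen Iota \<otimes>\<^bsub>PA\<^esub> \<mu> \<otimes>\<^bsub>PA\<^esub> pgen Iota) \<otimes>\<^bsub>PA\<^esub> (pgen Iota \<otimes>\<^bsub>PA\<^esub> i)"
        using z c by (simp add: PA.m_assoc)
      finally show ?thesis using ZI[OF c(3) iota_word_conj[OF z(3)] i'] by simp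
    qed
    then show ?thesis by (simp add: Y_def)
  qed
  have in_fix: "pgen Psi [^]\<^bsub>PA\<^esub> (c::int) \<in> fix_words" "1 \<le> k \<Longrightarrow> pgen (Phi k) [^]\<^bsub>PA\<^esub> (c::int) \<in> fix_words" for c k
  proof -
    show "pgen Psi [^]\<^bsub>PA\<^esub> c \<in> fix_words"
      unfolding fix_words_def by (rule generate.incl) (auto simp: psi_words_def)
    show "pgen (Phi k) [^]\<^bsub>PA\<^esub> c \<in> fix_words" if "1 \<le> k"
      unfolding fix_words_def using that by (intro generate.incl) (auto simp: phi_words_def)
  qed
  have gens: "pgen a \<in> Y \<and> inv\<^bsub>PA\<^esub> pgen a \<in> Y" if a: "a \<in> aut_gens" for a
  proof (cases a)
    case Cx
    then show ?thesis using Y_kappa[of x] Y_kappa[of "inv x"] by (simp add: kappa)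
  next
    case Ct
    then show ?thesis using Y_kappa[of t] Y_kappa[of "inv t"] by (simp add: kappa)
  next
    case Psi
    then show ?thesis using Y_fix[OF in_fix(1)[of 1]] Y_fix[OF in_fix(1)[of "- 1"]] by (simp add: PA.int_pow_neg)
  next
    case Iota
    then show ?thesis using Y_iota PA_rel(2) by simp
  next
    case (Phi k)
    then show ?thesis
      using a Y_fix[OF in_fix(2)[of k 1]] Y_fix[OF in_fix(2)[of k "- 1"]] by (simp add: PA.int_pow_neg)
  qed
  have "u \<in> generate PA (pgen ` aut_gens)" using assms generate_presented_group by blast
  then have "u \<in> Y"
  proof induction
    case one
    then show ?case using ZC by (simp add: Y_def)
  next
    case (eng a b)
    have "a \<otimes>\<^bsub>PA\<^esub> b \<otimes>\<^bsub>PA\<^esub> z \<in> Z" if "z \<in> Z" for z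
    proof -
      have "a \<otimes>\<^bsub>PA\<^esub> (b \<otimes>\<^bsub>PA\<^esub> z) \<in> Z" using eng that by (simp add: Y_def)
      then show ?thesis using eng that ZC by (simp add: Y_def PA.m_assoc)
    qed
    then show ?case using eng by (simp add: Y_def)
  next
    case (incl h)
    then show ?case using gens by (elim imageE) simp
  next
    case (inv h)
    then show ?case using gens by (elim imageE) simp
  qed
  moreover have "\<one>\<^bsub>PA\<^esub> \<in> Z"
    using ZI[of \<one> "\<one>\<^bsub>PA\<^esub>" "\<one>\<^bsub>PA\<^esub>"] subgroup.one_closed[OF subgroup_fix_words] by simp
  ultimately have "u \<otimes>\<^bsub>PA\<^esub> \<one>\<^bsub>PA\<^esub> \<in> Z" unfolding Y_def by (elim CollectE conjE) (erule bspec)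
  then have "u \<in> Z" unfolding PA.r_one[OF assms] .
  from ZE[OF this] show ?thesis by (elim exE conjE) (intro bexI)
qed

text \<open>In a sorted word with trivial image the middle block cannot alternate, so it is a power
  of \<open>Psi\<close>, and the last block is empty. The relation
  \<open>\<psi>^(p(n-1)) = c_x^(-p)\<close> cancels what remains.\<close>

lemma pres_map_kernel:
  assumes u: "u \<in> carrier PA" "pres_map u = \<one>\<^bsub>AutoGroup G\<^esub>"
  shows "u = \<one>\<^bsub>PA\<^esub>"
proof -
  obtain g \<mu> i where g: "g \<in> carrier G" and \<mu>: "\<mu> \<in> fix_words" and i: "i \<in> {\<one>\<^bsub>PA\<^esub>, pgen Iota}"
    and ue: "u = kappa g \<otimes>\<^bsub>PA\<^esub> \<mu> \<otimes>\<^bsub>PA\<^esub> i" using PA_normal_form[OF u(1)] by (elim bexE) (rule that)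
  have c: "\<mu> \<in> carrier PA" "i \<in> carrier PA"
    using \<mu> i subgroup.mem_carrier[OF subgroup_fix_words] by auto
  have pi: "pres_map (pgen Iota) = iota" by (simp add: pres_map_gen aut_val_eq del: aut_val.simps)
  then have \<epsilon>: "pres_map i \<in> {\<one>\<^bsub>AutoGroup G\<^esub>, iota}" using i by auto
  have e: "conj_auto G g \<otimes>\<^bsub>AutoGroup G\<^esub> pres_map \<mu> \<otimes>\<^bsub>AutoGroup G\<^esub> pres_map i = \<one>\<^bsub>AutoGroup G\<^esub>"
    using u(2) g c by (simp add: ue pres_map_kappa)
  show ?thesis
    using \<mu>
  proof (cases rule: fix_words_cases)
    case (alt h j)
    then show ?thesis using trivial_product_alternating[OF g alt(2) \<epsilon>] e by simp
  next
    case (psi j)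
    have e': "conj_auto G g \<otimes>\<^bsub>AutoGroup G\<^esub> psi j \<otimes>\<^bsub>AutoGroup G\<^esub> pres_map i = \<one>\<^bsub>AutoGroup G\<^esub>"
      using e by (simp add: psi pres_map_psi)
    have i1: "i = \<one>\<^bsub>PA\<^esub>" using trivial_product_psi(1)[OF g \<epsilon> e'] i pi iota_not_one by auto
    obtain m where m: "g = x [^] (p * m)" "j = p * (n - 1) * m"
      using trivial_product_psi(2)[OF g \<epsilon> e'] by (elim exE conjE) (rule that)
    have "pgen Psi [^]\<^bsub>PA\<^esub> j = (pgen Psi [^]\<^bsub>PA\<^esub> (p * (n - 1))) [^]\<^bsub>PA\<^esub> m"
      by (simp add: m PA.int_pow_pow)
    also have "\<dots> = pgen Cx [^]\<^bsub>PA\<^esub> (- (p * m))" unfolding PA_rel(4) by (simp add: PA.int_pow_pow)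
    finally have "u = pgen Cx [^]\<^bsub>PA\<^esub> (p * m) \<otimes>\<^bsub>PA\<^esub> pgen Cx [^]\<^bsub>PA\<^esub> (- (p * m))"
      by (simp add: ue psi i1 m(1) kappa.hom_int_pow kappa)
    then show ?thesis by (simp flip: PA.int_pow_mult)
  qed
qed

theorem has_presentation_auto:
  "has_presentation (AutoGroup G) aut_gens (aut_rels p n q) (aut_val p q)"
proof -
  have "pres_map \<in> iso PA (AutoGroup G)"
    unfolding pm.iso_iff using pres_map_surj pres_map_kernel by blast
  then show ?thesis
    unfolding has_presentation_def using AutoGroup aut_val_funcset by blast
qed

end

section \<open>Amalgamated products\<close>

lemma amalgam_gens_iff [simp]:
  "Inl a \<in> amalgam_gens A B \<longleftrightarrow> a \<in> carrier A" "Inr b \<in> amalgam_gens A B \<longleftrightarrow> b \<in> carrier B"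
  by (auto simp: amalgam_gens_def)

text \<open>The multiplication tables say that \<open>k\<close> restricts to a homomorphism on each
  factor, and the last relations say that the two agree on \<open>C\<close>.\<close>

lemma amalgam_rels_iff:
  fixes H :: "('d, 'k) monoid_scheme"
  assumes H: "group H" and AB: "group A" "group B"
    and k: "k \<in> amalgam_gens A B \<rightarrow> carrier H"
    and fg: "f \<in> carrier C \<rightarrow> carrier A" "g \<in> carrier C \<rightarrow> carrier B"
  shows "(\<forall>(l, r)\<in>amalgam_rels C A B f g. eval_word H k l = eval_word H k r) \<longleftrightarrow>
    (\<forall>a\<in>carrier A. \<forall>a'\<in>carrier A. k (Inl (a \<otimes>\<^bsub>A\<^esub> a')) = k (Inl a) \<otimes>\<^bsub>H\<^esub> k (Inl a')) \<and>
    (\<forall>b\<in>carrier B. \<forall>b'\<in>carrier B. k (Inr (b \<otimes>\<^bsub>B\<^esub> b')) = k (Inr b) \<otimes>\<^bsub>H\<^esub> k (Inr b')) \<and>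
    (\<forall>c\<in>carrier C. k (Inl (f c)) = k (Inr (g c)))"
proof -
  interpret H: group H by (rule H)
  interpret A: group A by (rule AB)
  interpret B: group B by (rule AB)
  have c: "k (Inl a) \<in> carrier H" if "a \<in> carrier A" for a
    using k that by auto
  have d: "k (Inr b) \<in> carrier H" if "b \<in> carrier B" for b
    using k that by auto
  have l: "letter (Inl a) \<in> lists (amalgam_gens A B \<times> UNIV)" if "a \<in> carrier A" for a
    using that by (intro H.letter_lists) simp
  have r: "letter (Inr b) \<in> lists (amalgam_gens A B \<times> UNIV)" if "b \<in> carrier B" for b
    using that by (intro H.letter_lists) simp
  have eA: "eval_word H k (letter (Inl a) @ letter (Inl a')) = k (Inl a) \<otimes>\<^bsub>H\<^esub> k (Inl a')"
    if "a \<in> carrier A" "a' \<in> carrier A" for a a'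
    using that by (simp add: H.eval_word_append[OF k l l] H.eval_word_letter c)
  have eB: "eval_word H k (letter (Inr b) @ letter (Inr b')) = k (Inr b) \<otimes>\<^bsub>H\<^esub> k (Inr b')"
    if "b \<in> carrier B" "b' \<in> carrier B" for b b'
    using that by (simp add: H.eval_word_append[OF k r r] H.eval_word_letter d)
  have e1: "eval_word H k (letter (Inl a)) = k (Inl a)" if "a \<in> carrier A" for a
    using that by (simp add: H.eval_word_letter c)
  have e2: "eval_word H k (letter (Inr b)) = k (Inr b)" if "b \<in> carrier B" for b
    using that by (simp add: H.eval_word_letter d)
  have 1: "(\<forall>(l, r)\<in>{(letter (Inl a) @ letter (Inl a'), letter (Inl (a \<otimes>\<^bsub>A\<^esub> a'))) |a a'. a \<in> carrier A \<and> a' \<in> carrier A}.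
        eval_word H k l = eval_word H k r) \<longleftrightarrow>
      (\<forall>a\<in>carrier A. \<forall>a'\<in>carrier A. k (Inl (a \<otimes>\<^bsub>A\<^esub> a')) = k (Inl a) \<otimes>\<^bsub>H\<^esub> k (Inl a'))" (is "?L \<longleftrightarrow> ?R")
  proof
    assume L: ?L
    show ?R
    proof (intro ballI)
      fix a a' assume a: "a \<in> carrier A" "a' \<in> carrier A"
      then have "eval_word H k (letter (Inl a) @ letter (Inl a')) = eval_word H k (letter (Inl (a \<otimes>\<^bsub>A\<^esub> a')))"
        using L by blast
      then show "k (Inl (a \<otimes>\<^bsub>A\<^esub> a')) = k (Inl a) \<otimes>\<^bsub>H\<^esub> k (Inl a')" using a by (simp add: eA e1)
    qed
  next
    assume R: ?R
    show ?L using R by (clarsimp simp: eA e1)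
  qed
  have 2: "(\<forall>(l, r)\<in>{(letter (Inr b) @ letter (Inr b'), letter (Inr (b \<otimes>\<^bsub>B\<^esub> b'))) |b b'. b \<in> carrier B \<and> b' \<in> carrier B}.
        eval_word H k l = eval_word H k r) \<longleftrightarrow>
      (\<forall>b\<in>carrier B. \<forall>b'\<in>carrier B. k (Inr (b \<otimes>\<^bsub>B\<^esub> b')) = k (Inr b) \<otimes>\<^bsub>H\<^esub> k (Inr b'))" (is "?L \<longleftrightarrow> ?R")
  proof
    assume L: ?L
    show ?R
    proof (intro ballI)
      fix b b' assume b: "b \<in> carrier B" "b' \<in> carrier B"
      then have "eval_word H k (letter (Inr b) @ letter (Inr b')) = eval_word H k (letter (Inr (b \<otimes>\<^bsub>B\<^esub> b')))"
        using L by blast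
      then show "k (Inr (b \<otimes>\<^bsub>B\<^esub> b')) = k (Inr b) \<otimes>\<^bsub>H\<^esub> k (Inr b')" using b by (simp add: eB e2)
    qed
  next
    assume R: ?R
    show ?L using R by (clarsimp simp: eB e2)
  qed
  have 3: "(\<forall>(l, r)\<in>{(letter (Inl (f c)), letter (Inr (g c))) |c. c \<in> carrier C}.
        eval_word H k l = eval_word H k r) \<longleftrightarrow> (\<forall>c\<in>carrier C. k (Inl (f c)) = k (Inr (g c)))" (is "?L \<longleftrightarrow> ?R")
  proof
    assume L: ?L
    show ?R
    proof
      fix c assume c: "c \<in> carrier C"
      then have "eval_word H k (letter (Inl (f c))) = eval_word H k (letter (Inr (g c)))" using L by blast
      moreover have "f c \<in> carrier A" "g c \<in> carrier B" using fg c by auto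
      ultimately show "k (Inl (f c)) = k (Inr (g c))" by (simp add: e1 e2)
    qed
  next
    assume R: ?R
    have "f c \<in> carrier A" "g c \<in> carrier B" if "c \<in> carrier C" for c using fg that by auto
    then show ?L using R by (clarsimp simp: e1 e2)
  qed
  show ?thesis unfolding amalgam_rels_def ball_Un 1 2 3 by (simp only: conj_assoc)
qed

lemma amalgam_rels_lists:
  assumes "(l, r) \<in> amalgam_rels C A B f g" and AB: "group A" "group B"
    and fg: "f \<in> carrier C \<rightarrow> carrier A" "g \<in> carrier C \<rightarrow> carrier B"
  shows "l \<in> lists (amalgam_gens A B \<times> UNIV)" "r \<in> lists (amalgam_gens A B \<times> UNIV)"
proof -
  interpret A: group A by (rule AB)
  interpret B: group B by (rule AB)
  have "f c \<in> carrier A" "g c \<in> carrier B" if "c \<in> carrier C" for c using fg that by auto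
  then show "l \<in> lists (amalgam_gens A B \<times> UNIV)" "r \<in> lists (amalgam_gens A B \<times> UNIV)"
    using assms(1) unfolding amalgam_rels_def letter_def by auto
qed

locale amalgamation =
  fixes C :: "'c monoid" and A :: "'a monoid" and B :: "'b monoid"
    and f :: "'c \<Rightarrow> 'a" and g :: "'c \<Rightarrow> 'b"
  assumes group_A: "group A" and group_B: "group B"
    and f_closed: "f \<in> carrier C \<rightarrow> carrier A" and g_closed: "g \<in> carrier C \<rightarrow> carrier B"
begin

abbreviation "N \<equiv> amalgam C A B f g"
abbreviation "inl \<equiv> amalgam_inl C A B f g"
abbreviation "inr \<equiv> amalgam_inr C A B f g"

lemma group_N: "group N"
  unfolding amalgam_def by (rule group_presented_group)

lemma gen_funcset: "pres_gen (amalgam_gens A B) (amalgam_rels C A B f g) \<in> amalgam_gens A B \<rightarrow> carrier N"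
  unfolding amalgam_def by (auto simp: pres_gen_closed)

lemma inl_closed: "a \<in> carrier A \<Longrightarrow> inl a \<in> carrier N"
  unfolding amalgam_def amalgam_inl_def by (rule pres_gen_closed) simp

lemma inr_closed: "b \<in> carrier B \<Longrightarrow> inr b \<in> carrier N"
  unfolding amalgam_def amalgam_inr_def by (rule pres_gen_closed) simp

lemma amalgam_relations:
  "a \<in> carrier A \<Longrightarrow> a' \<in> carrier A \<Longrightarrow> inl (a \<otimes>\<^bsub>A\<^esub> a') = inl a \<otimes>\<^bsub>N\<^esub> inl a'"
  "b \<in> carrier B \<Longrightarrow> b' \<in> carrier B \<Longrightarrow> inr (b \<otimes>\<^bsub>B\<^esub> b') = inr b \<otimes>\<^bsub>N\<^esub> inr b'"
  "c \<in> carrier C \<Longrightarrow> inl (f c) = inr (g c)"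
proof -
  have "\<forall>(l, r)\<in>amalgam_rels C A B f g.
      eval_word N (pres_gen (amalgam_gens A B) (amalgam_rels C A B f g)) l
      = eval_word N (pres_gen (amalgam_gens A B) (amalgam_rels C A B f g)) r"
  proof (rule ballI, clarify)
    fix l r assume lr: "(l, r) \<in> amalgam_rels C A B f g"
    show "eval_word N (pres_gen (amalgam_gens A B) (amalgam_rels C A B f g)) l
      = eval_word N (pres_gen (amalgam_gens A B) (amalgam_rels C A B f g)) r"
      unfolding amalgam_def
      by (rule presented_group_rel[OF lr amalgam_rels_lists[OF lr group_A group_B f_closed g_closed]])
  qed
  note this[unfolded amalgam_rels_iff[OF group_N group_A group_B gen_funcset f_closed g_closed]]
  then show "a \<in> carrier A \<Longrightarrow> a' \<in> carrier A \<Longrightarrow> inl (a \<otimes>\<^bsub>A\<^esub> a') = inl a \<otimes>\<^bsub>N\<^esub> inl a'"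
    "b \<in> carrier B \<Longrightarrow> b' \<in> carrier B \<Longrightarrow> inr (b \<otimes>\<^bsub>B\<^esub> b') = inr b \<otimes>\<^bsub>N\<^esub> inr b'"
    "c \<in> carrier C \<Longrightarrow> inl (f c) = inr (g c)"
    unfolding amalgam_inl_def amalgam_inr_def by blast+
qed

lemma inl_hom: "inl \<in> hom A N" and inr_hom: "inr \<in> hom B N"
  by (auto intro!: homI simp: inl_closed inr_closed amalgam_relations)

lemma generate_N: "generate N (inl ` carrier A \<union> inr ` carrier B) = carrier N"
proof -
  have "inl ` carrier A \<union> inr ` carrier B
      = pres_gen (amalgam_gens A B) (amalgam_rels C A B f g) ` amalgam_gens A B"
    unfolding amalgam_gens_def Plus_def image_Un image_image amalgam_inl_def amalgam_inr_def ..
  then show ?thesis unfolding amalgam_def by (simp add: generate_presented_group)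
qed

definition lift :: "('d, 'k) monoid_scheme \<Rightarrow> ('a \<Rightarrow> 'd) \<Rightarrow> ('b \<Rightarrow> 'd) \<Rightarrow> ('a + 'b) word set \<Rightarrow> 'd" where
  "lift H h k = pres_hom (amalgam_gens A B) (amalgam_rels C A B f g) H (case_sum h k)"

text \<open>The universal property of the pushout.\<close>

lemma lift:
  fixes H :: "('d, 'k) monoid_scheme"
  assumes H: "group H" and h: "h \<in> hom A H" and k: "k \<in> hom B H"
    and fg: "\<And>c. c \<in> carrier C \<Longrightarrow> h (f c) = k (g c)"
  shows "lift H h k \<in> hom N H" "a \<in> carrier A \<Longrightarrow> lift H h k (inl a) = h a"
    "b \<in> carrier B \<Longrightarrow> lift H h k (inr b) = k b"
proof -
  have fs: "case_sum h k \<in> amalgam_gens A B \<rightarrow> carrier H"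
    using h k by (auto simp: amalgam_gens_def hom_def)
  have "\<forall>(l, r)\<in>amalgam_rels C A B f g. eval_word H (case_sum h k) l = eval_word H (case_sum h k) r"
    unfolding amalgam_rels_iff[OF H group_A group_B fs f_closed g_closed]
    using h k fg by (simp add: hom_mult)
  then have r: "eval_word H (case_sum h k) l = eval_word H (case_sum h k) r"
    if "(l, r) \<in> amalgam_rels C A B f g" for l r using that by blast
  show "lift H h k \<in> hom N H"
    unfolding lift_def amalgam_def by (rule pres_hom_hom[OF H fs r])
  show "lift H h k (inl a) = h a" if "a \<in> carrier A"
    unfolding lift_def amalgam_inl_def using that
    by (subst pres_hom_gen[OF H fs r]) simp_all
  show "lift H h k (inr b) = k b" if "b \<in> carrier B"
    unfolding lift_def amalgam_inr_def using that
    by (subst pres_hom_gen[OF H fs r]) simp_all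
qed

lemma lift_extensional: "lift H h k \<in> extensional (carrier N)"
  by (simp add: lift_def pres_hom_def amalgam_def)

lemma N_hom_eqI:
  fixes H :: "('d, 'k) monoid_scheme"
  assumes "group H" "h \<in> hom N H" "k \<in> hom N H"
    and "\<And>a. a \<in> carrier A \<Longrightarrow> h (inl a) = k (inl a)" "\<And>b. b \<in> carrier B \<Longrightarrow> h (inr b) = k (inr b)"
    and "u \<in> carrier N"
  shows "h u = k u"
  by (rule hom_eq_on_generate[OF group_N assms(1-3), of "inl ` carrier A \<union> inr ` carrier B"])
    (use assms(4-6) in \<open>auto simp: inl_closed inr_closed generate_N\<close>)

lemma subgroup_inl: "subgroup (inl ` carrier A) N" and subgroup_inr: "subgroup (inr ` carrier B) N"
proof -
  interpret l: group_hom A N inl by (simp add: group_hom_def group_hom_axioms_def group_A group_N inl_hom)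
  interpret r: group_hom B N inr by (simp add: group_hom_def group_hom_axioms_def group_B group_N inr_hom)
  show "subgroup (inl ` carrier A) N" "subgroup (inr ` carrier B) N"
    by (rule l.img_is_subgroup, rule r.img_is_subgroup)
qed

end

lemma (in group) involution_auto:
  assumes "h \<in> hom G G" "h \<in> extensional (carrier G)" "\<And>g. g \<in> carrier G \<Longrightarrow> h (h g) = g"
  shows "h \<in> auto G"
proof -
  have "bij_betw h (carrier G) (carrier G)"
    using assms hom_in_carrier[OF assms(1)] by (intro bij_betw_byWitness[where f' = h]) auto
  then show ?thesis using assms by (simp add: auto_def Bij_def)
qed

lemma (in group) involution_action:
  assumes "h \<in> auto G" "\<And>g. g \<in> carrier G \<Longrightarrow> h (h g) = g"
  shows "(\<lambda>i. if i = 0 then \<one>\<^bsub>AutoGroup G\<^esub> else h) \<in> hom (integer_mod_group 2) (AutoGroup G)"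
proof (rule homI)
  interpret A: group "AutoGroup G" by (rule AutoGroup)
  have hh: "h \<otimes>\<^bsub>AutoGroup G\<^esub> h = \<one>\<^bsub>AutoGroup G\<^esub>"
    using assms id_in_auto by (intro auto_eqI) (auto simp: auto_mult_closed auto_mult_apply one_AutoGroup)
  have one: "\<one>\<^bsub>AutoGroup G\<^esub> \<in> auto G" using A.one_closed by simp
  show "(if i = 0 then \<one>\<^bsub>AutoGroup G\<^esub> else h) \<in> carrier (AutoGroup G)" for i :: int
    using assms one by simp
  fix i j :: int assume "i \<in> carrier (integer_mod_group 2)" "j \<in> carrier (integer_mod_group 2)"
  then have "i = 0 \<or> i = 1" "j = 0 \<or> j = 1" by (auto simp: carrier_integer_mod_group)
  then show "(if i \<otimes>\<^bsub>integer_mod_group 2\<^esub> j = 0 then \<one>\<^bsub>AutoGroup G\<^esub> else h)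
      = (if i = 0 then \<one>\<^bsub>AutoGroup G\<^esub> else h) \<otimes>\<^bsub>AutoGroup G\<^esub> (if j = 0 then \<one>\<^bsub>AutoGroup G\<^esub> else h)"
    using A.l_one[of h] A.r_one[of h] A.l_one[OF A.one_closed] assms(1) hh by auto
qed

section \<open>The factors of the outer automorphism group\<close>

lemma Z_inverting_simps [simp]:
  "r \<otimes>\<^bsub>Z_inverting m\<^esub> s = r + s" "\<one>\<^bsub>Z_inverting m\<^esub> = 0"
  by (simp_all add: Z_inverting_def)

lemma Z_invertingI: "of_int a / of_int m ^ k \<in> carrier (Z_inverting m)"
  by (auto simp: Z_inverting_def)

text \<open>The sign of the denominator moves into the numerator. This lets \<open>n\<close> itself
  be used, as in \<open>\<phi>_{k+1}^n = \<phi>_k\<close>, even when it is negative.\<close>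

lemma carrier_Z_inverting_abs:
  "carrier (Z_inverting \<bar>n\<bar>) = {of_int a / of_int n ^ k |a k. True}"
proof -
  have "carrier (Z_inverting (- m)) \<subseteq> carrier (Z_inverting m)" for m
  proof
    fix r assume "r \<in> carrier (Z_inverting (- m))"
    then obtain a k where r: "r = of_int a / of_int (- m) ^ k" by (auto simp: Z_inverting_def)
    have "r = of_int ((- 1) ^ k * a) / of_int m ^ k" unfolding r by (cases "even k") auto
    then show "r \<in> carrier (Z_inverting m)" by (simp only: Z_invertingI)
  qed
  from this[of n] this[of "- n"] show ?thesis by (simp add: Z_inverting_def abs_if)
qed

lemma frac_add:
  fixes n :: int
  assumes "n \<noteq> 0"
  shows "of_int a / of_int n ^ k + of_int b / of_int n ^ l
    = (of_int (a * n ^ l + b * n ^ k) / of_int n ^ (k + l) :: rat)"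
  using assms by (simp add: power_add field_simps)

lemma comm_group_Z_inverting:
  fixes n :: int
  assumes "n \<noteq> 0"
  shows "comm_group (Z_inverting \<bar>n\<bar>)"
proof (rule comm_groupI)
  fix r s :: rat
  assume rs: "r \<in> carrier (Z_inverting \<bar>n\<bar>)" "s \<in> carrier (Z_inverting \<bar>n\<bar>)"
  then obtain a k b l where "r = of_int a / of_int n ^ k" "s = of_int b / of_int n ^ l"
    unfolding carrier_Z_inverting_abs by auto
  then have "r + s = of_int (a * n ^ l + b * n ^ k) / of_int n ^ (k + l)" by (simp only: frac_add[OF assms])
  then show "r \<otimes>\<^bsub>Z_inverting \<bar>n\<bar>\<^esub> s \<in> carrier (Z_inverting \<bar>n\<bar>)"
    unfolding carrier_Z_inverting_abs Z_inverting_simps by blast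
next
  have "(0::rat) = of_int 0 / of_int n ^ 0" by simp
  then show "\<one>\<^bsub>Z_inverting \<bar>n\<bar>\<^esub> \<in> carrier (Z_inverting \<bar>n\<bar>)"
    unfolding carrier_Z_inverting_abs Z_inverting_simps by blast
next
  fix r :: rat
  assume "r \<in> carrier (Z_inverting \<bar>n\<bar>)"
  then obtain a k where r: "r = of_int a / of_int n ^ k"
    unfolding carrier_Z_inverting_abs by auto
  have "- r = of_int (- a) / of_int n ^ k" by (simp add: r)
  then have "- r \<in> carrier (Z_inverting \<bar>n\<bar>)"
    unfolding carrier_Z_inverting_abs by blast
  then show "\<exists>s\<in>carrier (Z_inverting \<bar>n\<bar>). s \<otimes>\<^bsub>Z_inverting \<bar>n\<bar>\<^esub> r = \<one>\<^bsub>Z_inverting \<bar>n\<bar>\<^esub>"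
    by (intro bexI[of _ "- r"]) simp_all
qed simp_all

lemma int_in_Z_inverting: "of_int a \<in> carrier (Z_inverting m)"
  using Z_invertingI[of a m 0] by simp

lemma int_multiplesI: "of_int (m * a) \<in> int_multiples m"
  by (auto simp: int_multiples_def)

lemma int_multiples_add:
  assumes "r \<in> int_multiples m" "s \<in> int_multiples m"
  shows "r + s \<in> int_multiples m"
proof -
  obtain a b where "r = of_int (m * a)" "s = of_int (m * b)" using assms by (auto simp: int_multiples_def)
  then have "r + s = of_int (m * (a + b))" by (simp add: distrib_left)
  then show ?thesis by (simp only: int_multiplesI)
qed

lemma int_multiples_minus:
  assumes "r \<in> int_multiples m"
  shows "- r \<in> int_multiples m"
proof -
  obtain a where "r = of_int (m * a)" using assms by (auto simp: int_multiples_def)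
  then have "- r = of_int (m * (- a))" by simp
  then show ?thesis by (simp only: int_multiplesI)
qed

lemma int_multiples_0: "0 \<in> int_multiples m"
  by (auto simp: int_multiples_def intro!: exI[of _ 0])

lemma int_multiples_abs: "int_multiples \<bar>m\<bar> = int_multiples m"
proof -
  have "int_multiples (- m) \<subseteq> int_multiples m" for m
  proof
    fix r assume "r \<in> int_multiples (- m)"
    then obtain a where "r = of_int (- m * a)" by (auto simp: int_multiples_def)
    then have "r = of_int (m * (- a))" by simp
    then show "r \<in> int_multiples m" unfolding int_multiples_def by blast
  qed
  from this[of m] this[of "- m"] show ?thesis by (simp add: abs_if)
qed

lemma int_multiples_subgroup:
  assumes "n \<noteq> 0"
  shows "subgroup (int_multiples m) (Z_inverting \<bar>n\<bar>)"
proof -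
  interpret comm_group "Z_inverting \<bar>n\<bar>" by (rule comm_group_Z_inverting[OF assms])
  have sub: "int_multiples m \<subseteq> carrier (Z_inverting \<bar>n\<bar>)"
    unfolding int_multiples_def using int_in_Z_inverting by blast
  have inv: "inv\<^bsub>Z_inverting \<bar>n\<bar>\<^esub> r = - r" if "r \<in> int_multiples m" for r
    using that int_multiples_minus[OF that] sub by (intro inv_equality) auto
  show ?thesis
    by (rule subgroupI)
      (use sub int_multiples_0[of m] in \<open>auto simp: inv int_multiples_minus int_multiples_add\<close>)
qed

lemma out_B_normal:
  assumes "n \<noteq> 0"
  shows "int_multiples \<bar>n * (n - 1)\<bar> \<lhd> Z_inverting \<bar>n\<bar>"
  by (rule comm_group.subgroup_imp_normal[OF comm_group_Z_inverting[OF assms] int_multiples_subgroup[OF assms]])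

lemma group_out_B: "n \<noteq> 0 \<Longrightarrow> group (out_B n)"
  unfolding out_B_def by (rule normal.factorgroup_is_group[OF out_B_normal])

lemma out_B_class_hom:
  assumes "n \<noteq> 0"
  shows "out_B_class n \<in> hom (Z_inverting \<bar>n\<bar>) (out_B n)"
proof -
  have e: "out_B_class n = (\<lambda>r. int_multiples \<bar>n * (n - 1)\<bar> #>\<^bsub>Z_inverting \<bar>n\<bar>\<^esub> r)"
    by (simp add: fun_eq_iff out_B_class_def)
  show ?thesis
    unfolding e out_B_def by (rule normal.r_coset_hom_Mod[OF out_B_normal[OF assms]])
qed

lemma carrier_out_B: "carrier (out_B n) = out_B_class n ` carrier (Z_inverting \<bar>n\<bar>)"
  unfolding out_B_def out_B_class_def by (rule carrier_FactGroup)

lemma out_B_class_eq_iff: "out_B_class n r = out_B_class n s \<longleftrightarrow> r - s \<in> int_multiples (n * (n - 1))"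
proof -
  define M where "M = int_multiples (n * (n - 1))"
  have c: "out_B_class n r = (\<lambda>h. h + r) ` M" for r
    by (auto simp: out_B_class_def r_coset_def M_def int_multiples_abs)
  have M: "0 \<in> M" "\<And>a b. a \<in> M \<Longrightarrow> b \<in> M \<Longrightarrow> a + b \<in> M" "\<And>a. a \<in> M \<Longrightarrow> - a \<in> M"
    by (auto simp: M_def int_multiples_0 int_multiples_add int_multiples_minus)
  have sub: "(\<lambda>h. h + r) ` M \<subseteq> (\<lambda>h. h + s) ` M" if "r - s \<in> M" for r s
  proof
    fix y assume "y \<in> (\<lambda>h. h + r) ` M"
    then obtain h where h: "h \<in> M" "y = h + r" by blast
    have "y = (h + (r - s)) + s" by (simp add: h)
    then show "y \<in> (\<lambda>h. h + s) ` M" using M(2)[OF h(1) that] by blast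
  qed
  show ?thesis
    unfolding c M_def[symmetric]
  proof
    assume e: "(\<lambda>h. h + r) ` M = (\<lambda>h. h + s) ` M"
    have "0 + r \<in> (\<lambda>h. h + s) ` M" unfolding e[symmetric] using M(1) by blast
    then show "r - s \<in> M" by auto
  next
    assume rs: "r - s \<in> M"
    then have "s - r \<in> M" using M(3)[OF rs] by simp
    then show "(\<lambda>h. h + r) ` M = (\<lambda>h. h + s) ` M" using sub rs by blast
  qed
qed

section \<open>The outer automorphism group\<close>

lemma carrier_mod_group_pos: "0 < k \<Longrightarrow> carrier (integer_mod_group (nat k)) = {0..<k}"
  by (simp add: carrier_integer_mod_group)

context bs
begin

section \<open>Classes modulo inner automorphisms and the maps on the two factors\<close>

interpretation Aut: group "AutoGroup G"
  by (rule AutoGroup)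

interpretation Inn: normal "Inn G" "AutoGroup G"
  by (rule Inn_normal)

lemma group_Out: "group (Out G)"
  unfolding Out_def by (rule Inn.factorgroup_is_group)

interpretation Out: group "Out G"
  by (rule group_Out)

lemma out_class_hom: "out_class G \<in> hom (AutoGroup G) (Out G)"
proof -
  have "out_class G = (\<lambda>\<alpha>. Inn G #>\<^bsub>AutoGroup G\<^esub> \<alpha>)" by (simp add: fun_eq_iff out_class_def)
  then show ?thesis unfolding Out_def by (simp only: Inn.r_coset_hom_Mod)
qed

interpretation oc: group_hom "AutoGroup G" "Out G" "out_class G"
  by (simp add: group_hom_def group_hom_axioms_def AutoGroup group_Out out_class_hom)

lemma carrier_Out: "carrier (Out G) = out_class G ` auto G"
  unfolding Out_def out_class_def by (simp add: carrier_FactGroup)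

lemma out_class_closed: "\<alpha> \<in> auto G \<Longrightarrow> out_class G \<alpha> \<in> carrier (Out G)"
  using oc.hom_closed by simp

lemma out_class_mult:
  "\<alpha> \<in> auto G \<Longrightarrow> \<beta> \<in> auto G \<Longrightarrow>
    out_class G (\<alpha> \<otimes>\<^bsub>AutoGroup G\<^esub> \<beta>) = out_class G \<alpha> \<otimes>\<^bsub>Out G\<^esub> out_class G \<beta>"
  using oc.hom_mult by simp

lemma out_class_one_iff:
  assumes "\<alpha> \<in> auto G"
  shows "out_class G \<alpha> = \<one>\<^bsub>Out G\<^esub> \<longleftrightarrow> \<alpha> \<in> Inn G"
proof
  assume "out_class G \<alpha> = \<one>\<^bsub>Out G\<^esub>"
  then have "Inn G #>\<^bsub>AutoGroup G\<^esub> \<alpha> = Inn G" by (simp add: Out_def out_class_def)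
  then show "\<alpha> \<in> Inn G" using Aut.coset_join1 assms Inn.subgroup_axioms by simp
next
  assume "\<alpha> \<in> Inn G"
  then show "out_class G \<alpha> = \<one>\<^bsub>Out G\<^esub>"
    using Inn.rcos_const[OF AutoGroup] by (simp add: Out_def out_class_def)
qed

lemma psi_Inn: "psi (p * (n - 1) * m) \<in> Inn G"
  using conj_auto_x_pow_eq_psi[of "- m"] unfolding Inn_def by (auto intro!: image_eqI[of _ _ "x [^] (p * - m)"])

text \<open>The homomorphism from \<open>Z[1/n]\<close> to automorphisms with
  \<open>1/n^k \<mapsto> \<phi>_{k+1}\<close>; the shift makes 1 correspond to
  \<open>\<phi>_1\<close>. Different fractions for \<open>r\<close> yield the same automorphism
  after passing to a common index.\<close>

definition rat_phi :: "rat \<Rightarrow> bs_gen word set \<Rightarrow> bs_gen word set" where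
  "rat_phi r = (THE \<alpha>. \<exists>a k. r = of_int a / of_int n ^ k \<and> \<alpha> = phi (Suc k) a)"

lemma rat_phi: "rat_phi (of_int a / of_int n ^ k) = phi (Suc k) a"
  unfolding rat_phi_def
proof (rule the_equality)
  fix \<alpha> assume "\<exists>b l. (of_int a / of_int n ^ k :: rat) = of_int b / of_int n ^ l \<and> \<alpha> = phi (Suc l) b"
  then obtain b l where e: "(of_int a / of_int n ^ k :: rat) = of_int b / of_int n ^ l" and \<alpha>: "\<alpha> = phi (Suc l) b"
    by blast
  have "(of_int (a * n ^ l) :: rat) = of_int (b * n ^ k)" using e by (simp add: field_simps)
  then have ab: "a * n ^ l = b * n ^ k" by (simp only: of_int_eq_iff)
  have "phi (Suc k) a = phi (Suc k + l) (a * n ^ l)" by (rule phi_lift[symmetric])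
  also have "\<dots> = phi (Suc l + k) (b * n ^ k)" by (simp add: ab add.commute)
  also have "\<dots> = phi (Suc l) b" by (rule phi_lift)
  finally show "\<alpha> = phi (Suc k) a" by (simp add: \<alpha>)
qed blast

lemma rat_cases:
  assumes "r \<in> carrier (Z_inverting \<bar>n\<bar>)"
  obtains a k where "r = of_int a / of_int n ^ k"
  using assms unfolding carrier_Z_inverting_abs by blast

lemma rat_phi_add:
  assumes "r \<in> carrier (Z_inverting \<bar>n\<bar>)" "s \<in> carrier (Z_inverting \<bar>n\<bar>)"
  shows "rat_phi (r + s) = rat_phi r \<otimes>\<^bsub>AutoGroup G\<^esub> rat_phi s"
proof -
  obtain a k where r: "r = of_int a / of_int n ^ k" by (rule rat_cases[OF assms(1)])
  obtain b l where s: "s = of_int b / of_int n ^ l" by (rule rat_cases[OF assms(2)])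
  have "rat_phi (r + s) = phi (Suc (k + l)) (a * n ^ l + b * n ^ k)"
    unfolding r s frac_add[OF n_ne] by (rule rat_phi)
  also have "\<dots> = phi (Suc k + l) (a * n ^ l) \<otimes>\<^bsub>AutoGroup G\<^esub> phi (Suc l + k) (b * n ^ k)"
    by (simp add: phi_mult add.commute)
  finally show ?thesis unfolding r s rat_phi phi_lift .
qed

lemma rat_phi_auto: "r \<in> carrier (Z_inverting \<bar>n\<bar>) \<Longrightarrow> rat_phi r \<in> auto G"
  by (erule rat_cases) (simp add: rat_phi)

lemma rat_phi_int: "rat_phi (of_int (n * c)) = psi (p * c)"
  using rat_phi[of "n * c" 0] phi_lift[of 0 1 c] by (simp add: phi_0 mult.commute)

text \<open>The origin of the modulus: \<open>n * (n - 1) * c\<close> is sent to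
  \<open>\<phi>_1^(n(n-1)c) = \<psi>^(p(n-1)c)\<close>, which is conjugation by a power of
  \<open>x^p\<close>.\<close>

lemma rat_phi_Inn:
  assumes "r \<in> int_multiples (n * (n - 1))"
  shows "rat_phi r \<in> Inn G"
proof -
  obtain c where "r = of_int (n * ((n - 1) * c))" using assms by (auto simp: int_multiples_def mult.assoc)
  then have "rat_phi r = psi (p * (n - 1) * c)" by (simp only: rat_phi_int mult.assoc)
  then show ?thesis by (simp only: psi_Inn)
qed

lemma out_class_rat_phi_hom: "(\<lambda>r. out_class G (rat_phi r)) \<in> hom (Z_inverting \<bar>n\<bar>) (Out G)"
  by (rule homI) (simp_all add: rat_phi_auto rat_phi_add out_class_closed out_class_mult)

text \<open>The map induced by \<open>rat_phi\<close> on the quotient; the universal property of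
  factor groups supplies its existence, hence the choice operator.\<close>

definition beta :: "rat set \<Rightarrow> (bs_gen word set \<Rightarrow> bs_gen word set) set" where
  "beta = (SOME \<beta>. \<beta> \<in> hom (out_B n) (Out G) \<and>
     (\<forall>r\<in>carrier (Z_inverting \<bar>n\<bar>). \<beta> (out_B_class n r) = out_class G (rat_phi r)))"

lemma beta:
  "beta \<in> hom (out_B n) (Out G)"
  "r \<in> carrier (Z_inverting \<bar>n\<bar>) \<Longrightarrow> beta (out_B_class n r) = out_class G (rat_phi r)"
proof -
  interpret Zn: comm_group "Z_inverting \<bar>n\<bar>" by (rule comm_group_Z_inverting[OF n_ne])
  have wd: "out_class G (rat_phi r) = out_class G (rat_phi s)"
    if rs: "r \<in> carrier (Z_inverting \<bar>n\<bar>)" "s \<in> carrier (Z_inverting \<bar>n\<bar>)"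
      and e: "int_multiples \<bar>n * (n - 1)\<bar> #>\<^bsub>Z_inverting \<bar>n\<bar>\<^esub> r = int_multiples \<bar>n * (n - 1)\<bar> #>\<^bsub>Z_inverting \<bar>n\<bar>\<^esub> s"
    for r s
  proof -
    have m: "r - s \<in> int_multiples (n * (n - 1))"
      using e out_B_class_eq_iff[of n r s] by (simp add: out_B_class_def)
    then have mc: "r - s \<in> carrier (Z_inverting \<bar>n\<bar>)"
      using subgroup.mem_carrier[OF int_multiples_subgroup[OF n_ne]] by blast
    have "rat_phi r = rat_phi (r - s) \<otimes>\<^bsub>AutoGroup G\<^esub> rat_phi s"
      using rat_phi_add[OF mc rs(2)] by simp
    moreover have "out_class G (rat_phi (r - s)) = \<one>\<^bsub>Out G\<^esub>"
      using out_class_one_iff[OF rat_phi_auto[OF mc]] rat_phi_Inn[OF m] by simp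
    ultimately show ?thesis
      using Out.l_one[OF out_class_closed[OF rat_phi_auto[OF rs(2)]]]
      by (simp add: out_class_mult rat_phi_auto rs mc)
  qed
  obtain \<beta> where \<beta>: "\<beta> \<in> hom (Z_inverting \<bar>n\<bar> Mod int_multiples \<bar>n * (n - 1)\<bar>) (Out G)"
    "\<And>r. r \<in> carrier (Z_inverting \<bar>n\<bar>) \<Longrightarrow>
      \<beta> (int_multiples \<bar>n * (n - 1)\<bar> #>\<^bsub>Z_inverting \<bar>n\<bar>\<^esub> r) = out_class G (rat_phi r)"
    by (rule FactGroup_universal[OF out_class_rat_phi_hom out_B_normal[OF n_ne]], erule (2) wd, rule that)
  have "\<exists>\<beta>. \<beta> \<in> hom (out_B n) (Out G) \<and>
     (\<forall>r\<in>carrier (Z_inverting \<bar>n\<bar>). \<beta> (out_B_class n r) = out_class G (rat_phi r))"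
    using \<beta> unfolding out_B_def out_B_class_def by (intro exI[of _ \<beta>] conjI ballI)
  from someI_ex[OF this] show "beta \<in> hom (out_B n) (Out G)"
    "r \<in> carrier (Z_inverting \<bar>n\<bar>) \<Longrightarrow> beta (out_B_class n r) = out_class G (rat_phi r)"
    unfolding beta_def by blast+
qed

lemma order_pos: "0 < p * \<bar>n - 1\<bar>" "0 < \<bar>n - 1\<bar>"
  using p_gt n_gt by auto

lemma carrier_out_A: "carrier (out_A p n) = {0..<p * \<bar>n - 1\<bar>}"
  unfolding out_A_def by (rule carrier_mod_group_pos[OF order_pos(1)])

lemma carrier_out_C: "carrier (out_C n) = {0..<\<bar>n - 1\<bar>}"
  unfolding out_C_def by (rule carrier_mod_group_pos[OF order_pos(2)])

lemma mult_out_A: "a \<otimes>\<^bsub>out_A p n\<^esub> b = (a + b) mod (p * \<bar>n - 1\<bar>)"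
  using order_pos by (simp add: out_A_def)

lemma mult_out_C: "a \<otimes>\<^bsub>out_C n\<^esub> b = (a + b) mod \<bar>n - 1\<bar>"
  using order_pos by (simp add: out_C_def)

lemma out_class_psi_mod: "out_class G (psi (i mod (p * \<bar>n - 1\<bar>))) = out_class G (psi i)"
proof -
  define m where "m = p * \<bar>n - 1\<bar>"
  \<comment> \<open>The absolute value is traded for a sign in the multiplier, since inner powers
    are described by \<open>p * (n - 1)\<close>.\<close>
  have "p * \<bar>n - 1\<bar> * k = p * (n - 1) * (sgn (n - 1) * k)" for k
    using abs_sgn[of "n - 1"] by (simp add: mult.assoc)
  then have "psi (m * (i div m)) \<in> Inn G" unfolding m_def by (simp only: psi_Inn)
  then have "out_class G (psi (m * (i div m))) = \<one>\<^bsub>Out G\<^esub>"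
    using out_class_one_iff[OF psi_auto] by blast
  moreover have "psi i = psi (m * (i div m)) \<otimes>\<^bsub>AutoGroup G\<^esub> psi (i mod m)"
    by (simp add: psi_mult)
  ultimately have "out_class G (psi i) = out_class G (psi (i mod m))"
    using Out.l_one[OF out_class_closed[OF psi_auto]] by (simp only: out_class_mult psi_auto)
  then show ?thesis by (simp only: m_def)
qed

lemma out_class_psi_hom: "(\<lambda>i. out_class G (psi i)) \<in> hom (out_A p n) (Out G)"
  by (rule homI)
    (simp_all only: out_class_closed psi_auto mult_out_A out_class_psi_mod psi_mult[symmetric] out_class_mult)

lemma group_out_A: "group (out_A p n)" and group_out_C: "group (out_C n)"
  unfolding out_A_def out_C_def by simp_all

lemma out_f_mon: "out_f p \<in> mon (out_C n) (out_A p n)"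
proof -
  have "out_f p \<in> hom (out_C n) (out_A p n)"
  proof (rule homI)
    fix c d assume "c \<in> carrier (out_C n)"
    then show "out_f p c \<in> carrier (out_A p n)"
      using p_gt by (simp add: out_f_def carrier_out_A carrier_out_C)
    show "out_f p (c \<otimes>\<^bsub>out_C n\<^esub> d) = out_f p c \<otimes>\<^bsub>out_A p n\<^esub> out_f p d"
      unfolding out_f_def mult_out_A mult_out_C mult_mod_right distrib_left ..
  qed
  moreover have "inj_on (out_f p) (carrier (out_C n))" using p_gt by (auto simp: inj_on_def out_f_def)
  ultimately show ?thesis by (simp add: mon_def)
qed

text \<open>The factor \<open>n\<close> cancels in \<open>n * (c - d) = n * (n - 1) * a\<close>, so
  the embedded subgroup has order exactly \<open>\<bar>n - 1\<bar>\<close>.\<close>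

lemma out_g_eq_iff: "out_g n c = out_g n d \<longleftrightarrow> (n - 1) dvd (c - d)"
proof -
  have "out_g n c = out_g n d \<longleftrightarrow> of_int (n * (c - d)) \<in> int_multiples (n * (n - 1))"
    unfolding out_g_def out_B_class_eq_iff by (simp add: right_diff_distrib)
  also have "\<dots> \<longleftrightarrow> (\<exists>a. n * (c - d) = n * (n - 1) * a)"
    unfolding int_multiples_def by (auto simp only: of_int_eq_iff mem_Collect_eq)
  also have "\<dots> \<longleftrightarrow> (n - 1) dvd (c - d)" by (auto simp: dvd_def mult.assoc)
  finally show ?thesis .
qed

lemma out_g_closed: "out_g n c \<in> carrier (out_B n)"
  unfolding out_g_def carrier_out_B using int_in_Z_inverting by blast

lemma out_g_mon: "out_g n \<in> mon (out_C n) (out_B n)"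
proof -
  have "out_g n (c \<otimes>\<^bsub>out_C n\<^esub> d) = out_g n c \<otimes>\<^bsub>out_B n\<^esub> out_g n d" for c d
  proof -
    have "(n - 1) dvd ((c + d) mod \<bar>n - 1\<bar> - (c + d))"
      by (metis abs_dvd_iff mod_eq_dvd_iff mod_mod_trivial)
    then have "out_g n (c \<otimes>\<^bsub>out_C n\<^esub> d) = out_g n (c + d)"
      by (simp add: mult_out_C out_g_eq_iff)
    also have "\<dots> = out_B_class n (of_int (n * c) + of_int (n * d))"
      by (simp add: out_g_def distrib_left)
    also have "\<dots> = out_g n c \<otimes>\<^bsub>out_B n\<^esub> out_g n d"
      using hom_mult[OF out_B_class_hom[OF n_ne] int_in_Z_inverting int_in_Z_inverting, of "n * c" "n * d"]
      by (simp add: out_g_def)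
    finally show ?thesis .
  qed
  then have "out_g n \<in> hom (out_C n) (out_B n)" by (intro homI out_g_closed)
  moreover have "inj_on (out_g n) (carrier (out_C n))"
  proof (rule inj_onI)
    fix c d assume cd: "c \<in> carrier (out_C n)" "d \<in> carrier (out_C n)" "out_g n c = out_g n d"
    then have "\<bar>n - 1\<bar> dvd (c - d)" by (simp add: out_g_eq_iff)
    then have "c mod \<bar>n - 1\<bar> = d mod \<bar>n - 1\<bar>" by (simp add: mod_eq_dvd_iff)
    then show "c = d" using cd by (simp add: carrier_out_C)
  qed
  ultimately show ?thesis by (simp add: mon_def)
qed

section \<open>The map from the amalgam to the outer automorphism group\<close>

interpretation am: amalgamation "out_C n" "out_A p n" "out_B n" "out_f p" "out_g n"
  using out_f_mon out_g_mon
  by (intro amalgamation.intro group_out_A group_out_B) (simp_all add: mon_def hom_def)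

lemma out_N_eq: "out_N p n = am.N" and out_inl_eq: "out_inl p n = am.inl" and out_inr_eq: "out_inr p n = am.inr"
  by (simp_all add: out_N_def out_inl_def out_inr_def fun_eq_iff)

definition theta :: "(int + rat set) word set \<Rightarrow> (bs_gen word set \<Rightarrow> bs_gen word set) set" where
  "theta = am.lift (Out G) (\<lambda>i. out_class G (psi i)) beta"

lemma theta:
  "theta \<in> hom am.N (Out G)"
  "i \<in> carrier (out_A p n) \<Longrightarrow> theta (am.inl i) = out_class G (psi i)"
  "b \<in> carrier (out_B n) \<Longrightarrow> theta (am.inr b) = beta b"
proof -
  have c: "out_class G (psi (out_f p c)) = beta (out_g n c)" for c
    unfolding out_f_def out_g_def beta(2)[OF int_in_Z_inverting] rat_phi_int ..
  show "theta \<in> hom am.N (Out G)"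
    "i \<in> carrier (out_A p n) \<Longrightarrow> theta (am.inl i) = out_class G (psi i)"
    "b \<in> carrier (out_B n) \<Longrightarrow> theta (am.inr b) = beta b"
    unfolding theta_def using am.lift[OF group_Out out_class_psi_hom beta(1) c] by simp_all
qed

interpretation N: group am.N
  by (rule am.group_N)

interpretation theta: group_hom am.N "Out G" theta
  by (simp add: group_hom_def group_hom_axioms_def am.group_N group_Out theta)

interpretation A: group "out_A p n"
  by (rule group_out_A)

interpretation B: group "out_B n"
  by (rule group_out_B) simp

lemma out_B_comm: "b \<in> carrier (out_B n) \<Longrightarrow> b' \<in> carrier (out_B n) \<Longrightarrow>
    b \<otimes>\<^bsub>out_B n\<^esub> b' = b' \<otimes>\<^bsub>out_B n\<^esub> b"
proof -
  interpret Zn: comm_group "Z_inverting \<bar>n\<bar>" by (rule comm_group_Z_inverting[OF n_ne])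
  assume "b \<in> carrier (out_B n)" "b' \<in> carrier (out_B n)"
  then obtain r s where rs: "r \<in> carrier (Z_inverting \<bar>n\<bar>)" "s \<in> carrier (Z_inverting \<bar>n\<bar>)"
    "b = out_B_class n r" "b' = out_B_class n s" unfolding carrier_out_B by blast
  show ?thesis
    unfolding rs(3,4) using hom_mult[OF out_B_class_hom[OF n_ne] rs(1,2)]
      hom_mult[OF out_B_class_hom[OF n_ne] rs(2,1)] by (simp add: add.commute)
qed

text \<open>Inversion is a homomorphism on each factor because both are abelian, and it respects the
  identification; so it extends to the amalgam.\<close>

definition flip :: "(int + rat set) word set \<Rightarrow> (int + rat set) word set" where
  "flip = am.lift am.N (\<lambda>a. am.inl (inv\<^bsub>out_A p n\<^esub> a)) (\<lambda>b. am.inr (inv\<^bsub>out_B n\<^esub> b))"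

lemma flip:
  "flip \<in> hom am.N am.N"
  "a \<in> carrier (out_A p n) \<Longrightarrow> flip (am.inl a) = am.inl (inv\<^bsub>out_A p n\<^esub> a)"
  "b \<in> carrier (out_B n) \<Longrightarrow> flip (am.inr b) = am.inr (inv\<^bsub>out_B n\<^esub> b)"
proof -
  interpret C: group "out_C n" by (rule group_out_C)
  have l: "(\<lambda>a. am.inl (inv\<^bsub>out_A p n\<^esub> a)) \<in> hom (out_A p n) am.N"
  proof (rule homI)
    fix a b assume ab: "a \<in> carrier (out_A p n)" "b \<in> carrier (out_A p n)"
    have "a \<otimes>\<^bsub>out_A p n\<^esub> b = b \<otimes>\<^bsub>out_A p n\<^esub> a" by (simp add: mult_out_A add.commute)
    then have "inv\<^bsub>out_A p n\<^esub> (a \<otimes>\<^bsub>out_A p n\<^esub> b) = inv\<^bsub>out_A p n\<^esub> a \<otimes>\<^bsub>out_A p n\<^esub> inv\<^bsub>out_A p n\<^esub> b"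
      using A.inv_mult_group[OF ab(2,1)] by (simp only:)
    then show "am.inl (inv\<^bsub>out_A p n\<^esub> (a \<otimes>\<^bsub>out_A p n\<^esub> b))
        = am.inl (inv\<^bsub>out_A p n\<^esub> a) \<otimes>\<^bsub>am.N\<^esub> am.inl (inv\<^bsub>out_A p n\<^esub> b)"
      using am.amalgam_relations(1)[OF A.inv_closed[OF ab(1)] A.inv_closed[OF ab(2)]] by (simp only:)
  qed (rule am.inl_closed[OF A.inv_closed])
  have r: "(\<lambda>b. am.inr (inv\<^bsub>out_B n\<^esub> b)) \<in> hom (out_B n) am.N"
  proof (rule homI)
    fix a b assume ab: "a \<in> carrier (out_B n)" "b \<in> carrier (out_B n)"
    have "inv\<^bsub>out_B n\<^esub> (a \<otimes>\<^bsub>out_B n\<^esub> b) = inv\<^bsub>out_B n\<^esub> a \<otimes>\<^bsub>out_B n\<^esub> inv\<^bsub>out_B n\<^esub> b"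
      unfolding out_B_comm[OF ab] by (rule B.inv_mult_group[OF ab(2,1)])
    then show "am.inr (inv\<^bsub>out_B n\<^esub> (a \<otimes>\<^bsub>out_B n\<^esub> b))
        = am.inr (inv\<^bsub>out_B n\<^esub> a) \<otimes>\<^bsub>am.N\<^esub> am.inr (inv\<^bsub>out_B n\<^esub> b)"
      using am.amalgam_relations(2)[OF B.inv_closed[OF ab(1)] B.inv_closed[OF ab(2)]] by (simp only:)
  qed (rule am.inr_closed[OF B.inv_closed])
  interpret f: group_hom "out_C n" "out_A p n" "out_f p"
    using out_f_mon by (simp add: group_hom_def group_hom_axioms_def group_out_A group_out_C mon_def)
  interpret g: group_hom "out_C n" "out_B n" "out_g n"
    using out_g_mon by (simp add: group_hom_def group_hom_axioms_def group_out_B group_out_C mon_def)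
  have c: "am.inl (inv\<^bsub>out_A p n\<^esub> (out_f p c)) = am.inr (inv\<^bsub>out_B n\<^esub> (out_g n c))" if "c \<in> carrier (out_C n)" for c
    using am.amalgam_relations(3)[OF C.inv_closed[OF that]] f.hom_inv[OF that] g.hom_inv[OF that] by (simp only:)
  show "flip \<in> hom am.N am.N"
    "a \<in> carrier (out_A p n) \<Longrightarrow> flip (am.inl a) = am.inl (inv\<^bsub>out_A p n\<^esub> a)"
    "b \<in> carrier (out_B n) \<Longrightarrow> flip (am.inr b) = am.inr (inv\<^bsub>out_B n\<^esub> b)"
    unfolding flip_def by (rule am.lift[OF am.group_N l r c]; assumption)+
qed

lemma flip_flip: "u \<in> carrier am.N \<Longrightarrow> flip (flip u) = u"
proof -
  assume u: "u \<in> carrier am.N"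
  have "(flip \<circ> flip) u = id u"
  proof (rule am.N_hom_eqI[OF am.group_N _ _ _ _ u])
    show "flip \<circ> flip \<in> hom am.N am.N" by (rule Group.hom_compose[OF flip(1) flip(1)])
    show "id \<in> hom am.N am.N" by (rule homI) simp_all
    show "(flip \<circ> flip) (am.inl a) = id (am.inl a)" if "a \<in> carrier (out_A p n)" for a
      unfolding comp_apply id_apply flip(2)[OF that] flip(2)[OF A.inv_closed[OF that]] A.inv_inv[OF that] ..
    show "(flip \<circ> flip) (am.inr b) = id (am.inr b)" if "b \<in> carrier (out_B n)" for b
      unfolding comp_apply id_apply flip(3)[OF that] flip(3)[OF B.inv_closed[OF that]] B.inv_inv[OF that] ..
  qed
  then show ?thesis by simp
qed

lemma flip_auto: "flip \<in> auto am.N"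
  by (rule N.involution_auto[OF flip(1) _ flip_flip]) (simp add: flip_def am.lift_extensional)

definition flip_action :: "int \<Rightarrow> (int + rat set) word set \<Rightarrow> (int + rat set) word set" where
  "flip_action i = (if i = 0 then \<one>\<^bsub>AutoGroup am.N\<^esub> else flip)"

lemma inverting_action_flip: "inverting_action p n flip_action"
proof -
  have "flip_action \<in> hom (integer_mod_group 2) (AutoGroup am.N)"
    using N.involution_action[OF flip_auto flip_flip] by (simp add: flip_action_def[abs_def])
  then show ?thesis
    unfolding inverting_action_def out_N_eq out_inl_eq out_inr_eq
    by (simp add: flip_action_def flip)
qed

text \<open>Both sides are homomorphisms in \<open>u\<close>, so the two factors suffice; there the
  claim is that \<open>\<iota>\<close> inverts the powers of \<open>\<psi>\<close> and of each
  \<open>\<phi>_k\<close>.\<close>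

lemma iota_theta:
  assumes u: "u \<in> carrier am.N"
  shows "out_class G iota \<otimes>\<^bsub>Out G\<^esub> theta u \<otimes>\<^bsub>Out G\<^esub> out_class G iota = theta (flip u)"
proof -
  define c where "c = out_class G iota"
  have c: "c \<in> carrier (Out G)" by (simp add: c_def out_class_closed)
  have cc: "c \<otimes>\<^bsub>Out G\<^esub> c = \<one>\<^bsub>Out G\<^esub>"
    unfolding c_def using out_class_mult[OF iota_auto iota_auto] oc.hom_one by (simp add: iota_mult)
  have ic: "inv\<^bsub>Out G\<^esub> c = c" by (rule Out.inv_equality[OF cc c c])
  have conj: "c \<otimes>\<^bsub>Out G\<^esub> out_class G \<alpha> \<otimes>\<^bsub>Out G\<^esub> c
      = out_class G (iota \<otimes>\<^bsub>AutoGroup G\<^esub> (\<alpha> \<otimes>\<^bsub>AutoGroup G\<^esub> iota))" if "\<alpha> \<in> auto G" for \<alpha>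
    using that c by (simp add: c_def out_class_mult auto_mult_closed out_class_closed Out.m_assoc)
  have h1: "(\<lambda>u. c \<otimes>\<^bsub>Out G\<^esub> theta u \<otimes>\<^bsub>Out G\<^esub> c) \<in> hom am.N (Out G)"
  proof (rule homI)
    fix u v assume uv: "u \<in> carrier am.N" "v \<in> carrier am.N"
    have "(c \<otimes>\<^bsub>Out G\<^esub> theta u \<otimes>\<^bsub>Out G\<^esub> c) \<otimes>\<^bsub>Out G\<^esub> (c \<otimes>\<^bsub>Out G\<^esub> theta v \<otimes>\<^bsub>Out G\<^esub> c)
        = c \<otimes>\<^bsub>Out G\<^esub> theta u \<otimes>\<^bsub>Out G\<^esub> (c \<otimes>\<^bsub>Out G\<^esub> c) \<otimes>\<^bsub>Out G\<^esub> theta v \<otimes>\<^bsub>Out G\<^esub> c"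
      using uv c by (simp add: Out.m_assoc)
    also have "\<dots> = c \<otimes>\<^bsub>Out G\<^esub> theta (u \<otimes>\<^bsub>am.N\<^esub> v) \<otimes>\<^bsub>Out G\<^esub> c"
      unfolding cc using uv c by (simp add: Out.m_assoc)
    finally show "c \<otimes>\<^bsub>Out G\<^esub> theta (u \<otimes>\<^bsub>am.N\<^esub> v) \<otimes>\<^bsub>Out G\<^esub> c
        = (c \<otimes>\<^bsub>Out G\<^esub> theta u \<otimes>\<^bsub>Out G\<^esub> c) \<otimes>\<^bsub>Out G\<^esub> (c \<otimes>\<^bsub>Out G\<^esub> theta v \<otimes>\<^bsub>Out G\<^esub> c)" ..
  qed (use c in simp)
  have "c \<otimes>\<^bsub>Out G\<^esub> theta u \<otimes>\<^bsub>Out G\<^esub> c = (theta \<circ> flip) u"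
  proof (rule am.N_hom_eqI[OF group_Out h1 Group.hom_compose[OF flip(1) theta(1)] _ _ u])
    fix a assume a: "a \<in> carrier (out_A p n)"
    have "theta (flip (am.inl a)) = inv\<^bsub>Out G\<^esub> out_class G (psi a)"
      using group_hom.hom_inv[OF group_hom.intro[OF group_out_A group_Out], unfolded group_hom_axioms_def,
          OF out_class_psi_hom a] a
      by (simp only: flip(2) theta(2) A.inv_closed)
    also have "\<dots> = out_class G (psi (- a))"
      using oc.hom_inv[of "psi a"] by (simp add: psi_inv)
    also have "\<dots> = c \<otimes>\<^bsub>Out G\<^esub> theta (am.inl a) \<otimes>\<^bsub>Out G\<^esub> c"
      unfolding theta(2)[OF a] conj[OF psi_auto] iota_psi ..
    finally show "c \<otimes>\<^bsub>Out G\<^esub> theta (am.inl a) \<otimes>\<^bsub>Out G\<^esub> c = (theta \<circ> flip) (am.inl a)" by simp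
  next
    fix b assume b: "b \<in> carrier (out_B n)"
    then obtain r where r: "r \<in> carrier (Z_inverting \<bar>n\<bar>)" "b = out_B_class n r" unfolding carrier_out_B by blast
    obtain a k where ak: "r = of_int a / of_int n ^ k" by (rule rat_cases[OF r(1)])
    have bb: "beta b = out_class G (phi (Suc k) a)"
      by (simp only: r(2) beta(2)[OF r(1)] rat_phi[of a k, folded ak])
    have "theta (flip (am.inr b)) = inv\<^bsub>Out G\<^esub> beta b"
      using group_hom.hom_inv[OF group_hom.intro[OF B.is_group group_Out], unfolded group_hom_axioms_def,
          OF beta(1) b] b
      by (simp only: flip(3) theta(3) B.inv_closed)
    also have "\<dots> = out_class G (phi (Suc k) (- a))"
      unfolding bb using oc.hom_inv[of "phi (Suc k) a"] by (simp add: phi_inv)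
    also have "\<dots> = c \<otimes>\<^bsub>Out G\<^esub> theta (am.inr b) \<otimes>\<^bsub>Out G\<^esub> c"
      unfolding theta(3)[OF b] bb conj[OF phi_auto] iota_phi ..
    finally show "c \<otimes>\<^bsub>Out G\<^esub> theta (am.inr b) \<otimes>\<^bsub>Out G\<^esub> c = (theta \<circ> flip) (am.inr b)" by simp
  qed
  then show ?thesis by (simp add: c_def)
qed

text \<open>With \<open>inr_in_inl\<close> below, this identifies in the amalgam what
  \<open>psi_eq_phi\<close> finds to be common among automorphisms.\<close>

lemma inl_in_inr:
  assumes "a \<in> carrier (out_A p n)" "p dvd a"
  shows "am.inl a \<in> am.inr ` carrier (out_B n)"
proof -
  obtain d where d: "a = p * d" using assms(2) by (auto simp: dvd_def)
  then have "p * d \<in> {0..<p * \<bar>n - 1\<bar>}" using assms(1) by (simp only: carrier_out_A)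
  then have "p * 0 \<le> p * d" "p * d < p * \<bar>n - 1\<bar>" by (simp_all only: mult_zero_right atLeastLessThan_iff)
  moreover have "0 < p" using p_gt by simp
  ultimately have "0 \<le> d" "d < \<bar>n - 1\<bar>" by (simp_all only: mult_le_cancel_left_pos mult_less_cancel_left_pos)
  then have "d \<in> carrier (out_C n)" by (simp add: carrier_out_C)
  then have "am.inl a = am.inr (out_g n d)" using am.amalgam_relations(3)[of d] by (simp add: d out_f_def)
  then show ?thesis using out_g_closed by blast
qed

lemma inr_in_inl:
  assumes "n ^ Suc k dvd a"
  shows "am.inr (out_B_class n (of_int a / of_int n ^ k)) \<in> am.inl ` carrier (out_A p n)"
proof -
  obtain d where d: "a = n ^ Suc k * d" using assms by (auto simp: dvd_def)
  have "(of_int a / of_int n ^ k :: rat) = of_int (n * d)" using n_ne by (simp add: d)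
  then have e: "out_B_class n (of_int a / of_int n ^ k) = out_g n d" by (simp add: out_g_def)
  define c where "c = d mod \<bar>n - 1\<bar>"
  have c: "c \<in> carrier (out_C n)" using order_pos(2) by (simp add: carrier_out_C c_def)
  have "(n - 1) dvd (d - c)"
    unfolding c_def by (metis abs_dvd_iff dvd_minus_mod)
  then have "out_g n d = out_g n c" by (simp add: out_g_eq_iff)
  then have "am.inr (out_B_class n (of_int a / of_int n ^ k)) = am.inl (out_f p c)"
    using am.amalgam_relations(3)[OF c] by (simp add: e)
  moreover have "out_f p c \<in> carrier (out_A p n)" using am.f_closed c by blast
  ultimately show ?thesis by blast
qed

text \<open>Each syllable is represented by an automorphism \<open>psi i\<close> or
  \<open>phi (Suc k) c\<close>. A representative in the wrong family would, by the divisibility in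
  \<open>psi_eq_phi\<close>, put the syllable into the other factor of the amalgam.\<close>

lemma theta_alternating:
  assumes "h \<in> alternating am.N (am.inl ` carrier (out_A p n)) (am.inr ` carrier (out_B n))"
  shows "\<exists>\<gamma>\<in>alternating (AutoGroup G) psis phis. theta h = out_class G \<gamma>"
proof -
  have b_cases: "\<exists>k a. phi (Suc k) a \<notin> psis \<and> theta b = out_class G (phi (Suc k) a) \<and> b \<in> carrier am.N"
    if b: "b \<in> am.inr ` carrier (out_B n)" "b \<notin> am.inl ` carrier (out_A p n)" for b
  proof -
    obtain c where c: "c \<in> carrier (out_B n)" "b = am.inr c" using b(1) by blast
    then obtain r where r: "r \<in> carrier (Z_inverting \<bar>n\<bar>)" "c = out_B_class n r" unfolding carrier_out_B by blast
    obtain a k where ak: "r = of_int a / of_int n ^ k" by (rule rat_cases[OF r(1)])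
    have "\<not> n ^ Suc k dvd a" using inr_in_inl[of k a] b(2) by (auto simp: c r ak)
    moreover have "n ^ Suc k dvd a" if h: "phi (Suc k) a \<in> psis"
    proof -
      obtain i where "phi (Suc k) a = psi i" using h unfolding psis_def by blast
      from psi_eq_phi(2)[OF this[symmetric]] show ?thesis .
    qed
    ultimately have "phi (Suc k) a \<notin> psis" by blast
    moreover have "theta b = out_class G (phi (Suc k) a)"
    proof -
      have "theta b = beta c" unfolding c(2) by (rule theta(3)[OF c(1)])
      also have "\<dots> = out_class G (rat_phi r)" unfolding r(2) by (rule beta(2)[OF r(1)])
      also have "rat_phi r = phi (Suc k) a" unfolding ak by (rule rat_phi)
      finally show ?thesis .
    qed
    moreover have "b \<in> carrier am.N" using am.inr_closed[OF c(1)] c(2) by simp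
    ultimately show ?thesis by blast
  qed
  have phi: "phi k a \<in> phis" for k a by (auto simp: phis_def)
  have psi: "psi i \<in> psis" for i by (auto simp: psis_def)
  show ?thesis using assms
  proof induction
    case (base a b)
    obtain i where i: "i \<in> carrier (out_A p n)" "a = am.inl i" using base(1) by blast
    obtain k c where kc: "phi (Suc k) c \<notin> psis" "theta b = out_class G (phi (Suc k) c)" "b \<in> carrier am.N"
      using b_cases[OF base(2,3)] by (elim exE conjE) (rule that)
    have "theta (a \<otimes>\<^bsub>am.N\<^esub> b) = out_class G (psi i \<otimes>\<^bsub>AutoGroup G\<^esub> phi (Suc k) c)"
      using am.inl_closed[OF i(1)] kc by (simp add: i theta(2) out_class_mult)
    moreover have "psi i \<otimes>\<^bsub>AutoGroup G\<^esub> phi (Suc k) c \<in> alternating (AutoGroup G) psis phis"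
      by (rule alternating.base[OF psi phi kc(1)])
    ultimately show ?case by (intro bexI)
  next
    case (step g a b)
    obtain \<gamma> where \<gamma>: "\<gamma> \<in> alternating (AutoGroup G) psis phis" "theta g = out_class G \<gamma>"
      using step.IH by (elim bexE) (rule that)
    have \<gamma>a: "\<gamma> \<in> auto G" using alternating_autos(1)[OF \<gamma>(1)] by (simp add: fixers_def)
    have g: "g \<in> carrier am.N" by (rule N.alternating_closed[OF am.subgroup_inl am.subgroup_inr step(1)])
    obtain i where i: "i \<in> carrier (out_A p n)" "a = am.inl i" using step(2) by blast
    have "psi i \<notin> phis"
    proof
      assume "psi i \<in> phis"
      then obtain k c where "psi i = phi k c" unfolding phis_def by blast
      then have "p dvd i" by (rule psi_eq_phi(1))
      then show False using inl_in_inr[OF i(1)] step(3) i(2) by simp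
    qed
    moreover obtain k c where kc: "phi (Suc k) c \<notin> psis" "theta b = out_class G (phi (Suc k) c)" "b \<in> carrier am.N"
      using b_cases[OF step(4,5)] by (elim exE conjE) (rule that)
    ultimately have "\<gamma> \<otimes>\<^bsub>AutoGroup G\<^esub> (psi i \<otimes>\<^bsub>AutoGroup G\<^esub> phi (Suc k) c) \<in> alternating (AutoGroup G) psis phis"
      using alternating.step[OF \<gamma>(1) psi _ phi] by blast
    moreover have "theta (g \<otimes>\<^bsub>am.N\<^esub> (a \<otimes>\<^bsub>am.N\<^esub> b))
        = out_class G (\<gamma> \<otimes>\<^bsub>AutoGroup G\<^esub> (psi i \<otimes>\<^bsub>AutoGroup G\<^esub> phi (Suc k) c))"
      using am.inl_closed[OF i(1)] kc g \<gamma> \<gamma>a by (simp add: i theta(2) out_class_mult auto_mult_closed)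
    ultimately show ?case by (intro bexI)
  qed
qed

text \<open>The additional factor \<open>\<epsilon>\<close> makes one statement yield both that
  \<open>theta\<close> is injective and that the class of \<open>\<iota>\<close> is not in its
  image.\<close>

lemma theta_kernel:
  assumes u: "u \<in> carrier am.N" and \<epsilon>: "\<epsilon> \<in> {\<one>\<^bsub>AutoGroup G\<^esub>, iota}"
    and triv: "theta u \<otimes>\<^bsub>Out G\<^esub> out_class G \<epsilon> = \<one>\<^bsub>Out G\<^esub>"
  shows "\<epsilon> = \<one>\<^bsub>AutoGroup G\<^esub>" "u = \<one>\<^bsub>am.N\<^esub>"
proof -
  have \<epsilon>a: "\<epsilon> \<in> auto G" using \<epsilon> Aut.one_closed by auto
  have inner: "\<exists>g\<in>carrier G. conj_auto G g \<otimes>\<^bsub>AutoGroup G\<^esub> \<gamma> \<otimes>\<^bsub>AutoGroup G\<^esub> \<epsilon> = \<one>\<^bsub>AutoGroup G\<^esub>"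
    if \<gamma>: "\<gamma> \<in> auto G" "theta u = out_class G \<gamma>" for \<gamma>
  proof -
    interpret c: group_hom G "AutoGroup G" "conj_auto G"
      by (simp add: group_hom_def group_hom_axioms_def AutoGroup conj_auto_hom)
    have "out_class G (\<gamma> \<otimes>\<^bsub>AutoGroup G\<^esub> \<epsilon>) = \<one>\<^bsub>Out G\<^esub>"
      using triv \<gamma> \<epsilon>a by (simp only: out_class_mult)
    then have "\<gamma> \<otimes>\<^bsub>AutoGroup G\<^esub> \<epsilon> \<in> Inn G"
      using out_class_one_iff[OF auto_mult_closed[OF \<gamma>(1) \<epsilon>a]] by blast
    then obtain g where g: "g \<in> carrier G" "\<gamma> \<otimes>\<^bsub>AutoGroup G\<^esub> \<epsilon> = conj_auto G g" by (auto simp: Inn_def)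
    have "conj_auto G (inv g) \<otimes>\<^bsub>AutoGroup G\<^esub> \<gamma> \<otimes>\<^bsub>AutoGroup G\<^esub> \<epsilon>
        = conj_auto G (inv g) \<otimes>\<^bsub>AutoGroup G\<^esub> conj_auto G g"
      unfolding g(2)[symmetric] using \<gamma>(1) \<epsilon>a conj_auto_in_auto[OF inv_closed[OF g(1)]]
      by (intro Aut.m_assoc) (simp_all only: carrier_AutoGroup)
    also have "\<dots> = \<one>\<^bsub>AutoGroup G\<^esub>"
      unfolding c.hom_mult[OF inv_closed[OF g(1)] g(1), symmetric] l_inv[OF g(1)] by (rule c.hom_one)
    finally show ?thesis by (rule bexI[OF _ inv_closed[OF g(1)]])
  qed
  have "u \<in> generate am.N (am.inl ` carrier (out_A p n) \<union> am.inr ` carrier (out_B n))"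
    using u am.generate_N by simp
  then have "u \<in> am.inl ` carrier (out_A p n) \<or>
      (\<exists>h\<in>alternating am.N (am.inl ` carrier (out_A p n)) (am.inr ` carrier (out_B n)).
        \<exists>a\<in>am.inl ` carrier (out_A p n). u = h \<otimes>\<^bsub>am.N\<^esub> a)"
    by (rule N.alternating_exhaust[OF am.subgroup_inl am.subgroup_inr])
  then consider i where "i \<in> carrier (out_A p n)" "u = am.inl i"
    | h i where "h \<in> alternating am.N (am.inl ` carrier (out_A p n)) (am.inr ` carrier (out_B n))"
      "i \<in> carrier (out_A p n)" "u = h \<otimes>\<^bsub>am.N\<^esub> am.inl i"
  proof
    assume "u \<in> am.inl ` carrier (out_A p n)"
    then show ?thesis by (rule imageE) (rule that(1))
  next
    assume "\<exists>h\<in>alternating am.N (am.inl ` carrier (out_A p n)) (am.inr ` carrier (out_B n)).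
        \<exists>a\<in>am.inl ` carrier (out_A p n). u = h \<otimes>\<^bsub>am.N\<^esub> a"
    then obtain h a where ha: "h \<in> alternating am.N (am.inl ` carrier (out_A p n)) (am.inr ` carrier (out_B n))"
      "a \<in> am.inl ` carrier (out_A p n)" "u = h \<otimes>\<^bsub>am.N\<^esub> a" by (elim bexE) (rule that)
    from ha(2) obtain i where "i \<in> carrier (out_A p n)" "a = am.inl i" by (elim imageE) (rule that)
    then show ?thesis using that(2)[OF ha(1), of i] ha(3) by simp
  qed
  then have "\<epsilon> = \<one>\<^bsub>AutoGroup G\<^esub> \<and> u = \<one>\<^bsub>am.N\<^esub>"
  proof cases
    case (1 i)
    have "theta u = out_class G (psi i)" unfolding 1(2) by (rule theta(2)[OF 1(1)])
    from inner[OF psi_auto this] obtain g where g: "g \<in> carrier G"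
      "conj_auto G g \<otimes>\<^bsub>AutoGroup G\<^esub> psi i \<otimes>\<^bsub>AutoGroup G\<^esub> \<epsilon> = \<one>\<^bsub>AutoGroup G\<^esub>"
      by (elim bexE) (rule that)
    have e: "\<epsilon> = \<one>\<^bsub>AutoGroup G\<^esub>" by (rule trivial_product_psi(1)[OF g(1) \<epsilon> g(2)])
    obtain m where "i = p * (n - 1) * m" using trivial_product_psi(2)[OF g(1) \<epsilon> g(2)] by (elim exE conjE) (rule that)
    \<comment> \<open>Triviality makes \<open>i\<close> a multiple of \<open>p * (n - 1)\<close>,
      hence of \<open>p * \<bar>n - 1\<bar>\<close>; the range of residues leaves only
      \<open>i = 0\<close>.\<close>
    also have "n - 1 = \<bar>n - 1\<bar> * sgn (n - 1)" by (simp only: abs_mult_sgn)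
    finally have "p * \<bar>n - 1\<bar> dvd i" by (simp add: mult.assoc)
    then have "i = 0" using 1(1) by (simp add: carrier_out_A dvd_eq_mod_eq_0)
    moreover have "am.inl 0 = \<one>\<^bsub>am.N\<^esub>"
      using hom_one[OF am.inl_hom group_out_A am.group_N] by (simp add: out_A_def)
    ultimately show ?thesis using e 1 by simp
  next
    case (2 h i)
    obtain \<gamma> where \<gamma>: "\<gamma> \<in> alternating (AutoGroup G) psis phis" "theta h = out_class G \<gamma>"
      using theta_alternating[OF 2(1)] by (elim bexE) (rule that)
    have \<gamma>a: "\<gamma> \<in> auto G" using alternating_autos(1)[OF \<gamma>(1)] by (simp add: fixers_def)
    have h: "h \<in> carrier am.N" by (rule N.alternating_closed[OF am.subgroup_inl am.subgroup_inr 2(1)])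
    have "theta u = out_class G (\<gamma> \<otimes>\<^bsub>AutoGroup G\<^esub> psi i)"
      using h am.inl_closed[OF 2(2)] \<gamma> \<gamma>a by (simp add: 2(3) theta(2)[OF 2(2)] out_class_mult)
    from inner[OF auto_mult_closed[OF \<gamma>a psi_auto] this] obtain g where g: "g \<in> carrier G"
      "conj_auto G g \<otimes>\<^bsub>AutoGroup G\<^esub> (\<gamma> \<otimes>\<^bsub>AutoGroup G\<^esub> psi i) \<otimes>\<^bsub>AutoGroup G\<^esub> \<epsilon> = \<one>\<^bsub>AutoGroup G\<^esub>"
      by (elim bexE) (rule that)
    from trivial_product_alternating[OF g(1) \<gamma>(1) \<epsilon>] g(2) show ?thesis by (rule notE)
  qed
  then show "\<epsilon> = \<one>\<^bsub>AutoGroup G\<^esub>" "u = \<one>\<^bsub>am.N\<^esub>" by auto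
qed

section \<open>The semidirect product with the inversion\<close>

abbreviation semi :: "((int + rat set) word set \<times> int) monoid" where
  "semi \<equiv> semidirect am.N (integer_mod_group 2) flip_action"

lemma carrier_semi: "carrier semi = carrier am.N \<times> {0, 1}"
  by (auto simp: semidirect_def carrier_integer_mod_group)

lemma mult_semi: "(u, i) \<otimes>\<^bsub>semi\<^esub> (v, j) = (u \<otimes>\<^bsub>am.N\<^esub> flip_action i v, (i + j) mod 2)"
  by (simp add: semidirect_def)

definition theta_iota :: "(int + rat set) word set \<times> int \<Rightarrow> (bs_gen word set \<Rightarrow> bs_gen word set) set" where
  "theta_iota v = theta (fst v) \<otimes>\<^bsub>Out G\<^esub> out_class G (if snd v = 0 then \<one>\<^bsub>AutoGroup G\<^esub> else iota)"

lemma theta_iota_hom: "theta_iota \<in> hom semi (Out G)"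
proof (rule homI)
  define c where "c = out_class G iota"
  have c: "c \<in> carrier (Out G)" by (simp add: c_def out_class_closed)
  have cc: "c \<otimes>\<^bsub>Out G\<^esub> c = \<one>\<^bsub>Out G\<^esub>"
    unfolding c_def using out_class_mult[OF iota_auto iota_auto] oc.hom_one by (simp add: iota_mult)
  have t: "theta_iota (u, 0) = theta u" "theta_iota (u, 1) = theta u \<otimes>\<^bsub>Out G\<^esub> c" if "u \<in> carrier am.N" for u
    using that by (simp_all add: theta_iota_def c_def del: One_nat_def)
  fix v assume "v \<in> carrier semi"
  then obtain u i where v: "v = (u, i)" "u \<in> carrier am.N" "i = 0 \<or> i = 1" by (auto simp: carrier_semi)
  then show "theta_iota v \<in> carrier (Out G)" using t[OF v(2)] c by auto
  fix v' assume "v' \<in> carrier semi"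
  then obtain u' i' where v': "v' = (u', i')" "u' \<in> carrier am.N" "i' = 0 \<or> i' = 1" by (auto simp: carrier_semi)
  have fu: "flip u' \<in> carrier am.N" by (rule hom_in_carrier[OF flip(1) v'(2)])
  have f0: "flip_action 0 u' = u'" "flip_action 1 u' = flip u'"
    using v'(2) by (simp_all add: flip_action_def N.one_AutoGroup)
  have f: "theta u \<otimes>\<^bsub>Out G\<^esub> c \<otimes>\<^bsub>Out G\<^esub> theta u' = theta (u \<otimes>\<^bsub>am.N\<^esub> flip u') \<otimes>\<^bsub>Out G\<^esub> c"
  proof -
    have "theta (flip u') \<otimes>\<^bsub>Out G\<^esub> c = c \<otimes>\<^bsub>Out G\<^esub> theta u' \<otimes>\<^bsub>Out G\<^esub> (c \<otimes>\<^bsub>Out G\<^esub> c)"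
      unfolding iota_theta[OF v'(2), symmetric] c_def[symmetric] using c v'(2) by (simp add: Out.m_assoc)
    then show ?thesis using c v(2) v'(2) fu by (simp add: cc Out.m_assoc)
  qed
  have closed: "u \<otimes>\<^bsub>am.N\<^esub> u' \<in> carrier am.N" "u \<otimes>\<^bsub>am.N\<^esub> flip u' \<in> carrier am.N"
    using v v' fu by simp_all
  show "theta_iota (v \<otimes>\<^bsub>semi\<^esub> v') = theta_iota v \<otimes>\<^bsub>Out G\<^esub> theta_iota v'"
  proof (cases "i = 0")
    case True
    then show ?thesis
      using v v' c by (elim disjE) (simp_all add: mult_semi f0 t closed Out.m_assoc)
  next
    case False
    then have i: "i = 1" using v(3) by simp
    have "theta u \<otimes>\<^bsub>Out G\<^esub> c \<otimes>\<^bsub>Out G\<^esub> (theta u' \<otimes>\<^bsub>Out G\<^esub> c) = theta (u \<otimes>\<^bsub>am.N\<^esub> flip u') \<otimes>\<^bsub>Out G\<^esub> (c \<otimes>\<^bsub>Out G\<^esub> c)"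
      using f c v(2) v'(2) closed by (simp flip: Out.m_assoc)
    then have f': "theta u \<otimes>\<^bsub>Out G\<^esub> c \<otimes>\<^bsub>Out G\<^esub> (theta u' \<otimes>\<^bsub>Out G\<^esub> c) = theta (u \<otimes>\<^bsub>am.N\<^esub> flip u')"
      using closed by (simp only: cc Out.r_one theta.hom_closed)
    from v'(3) show ?thesis
    proof
      assume "i' = 0"
      then show ?thesis by (simp only: v(1) v'(1) i mult_semi f0 t v(2) v'(2) closed f) (simp add: t closed)
    next
      assume "i' = 1"
      then show ?thesis by (simp only: v(1) v'(1) i mult_semi f0 t v(2) v'(2) closed f') (simp add: t closed)
    qed
  qed
qed

lemma generate_Out:
  "generate (Out G) (out_class G ` ({psi 1, iota} \<union> {phi k 1 |k. 1 \<le> k})) = carrier (Out G)"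
proof
  let ?S = "out_class G ` ({psi 1, iota} \<union> {phi k 1 |k. 1 \<le> k})"
  have sub: "?S \<subseteq> carrier (Out G)" by (auto simp: out_class_closed)
  show "generate (Out G) ?S \<subseteq> carrier (Out G)" by (rule Out.generate_incl[OF sub])
  have span: "generate (AutoGroup G) (aut_val p q ` aut_gens) = carrier (AutoGroup G)"
    using aut_span_eq by (simp add: aut_span_def)
  have "out_class G ` carrier (AutoGroup G) = generate (Out G) (out_class G ` aut_val p q ` aut_gens)"
    by (rule hom_image_generate_eq[OF AutoGroup group_Out out_class_hom _ span])
      (simp add: image_subset_iff aut_val_auto)
  moreover have "out_class G ` aut_val p q ` aut_gens \<subseteq> generate (Out G) ?S"
  proof (clarify)
    fix a assume a: "a \<in> aut_gens"
    have inner: "out_class G (conj_auto G g) \<in> generate (Out G) ?S" if "g \<in> carrier G" for g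
    proof -
      have "out_class G (conj_auto G g) = \<one>\<^bsub>Out G\<^esub>"
        using out_class_one_iff[OF conj_auto_in_auto[OF that]] that by (simp add: Inn_def)
      then show ?thesis by (simp add: generate.one)
    qed
    show "out_class G (aut_val p q a) \<in> generate (Out G) ?S"
    proof (cases a)
      case Cx
      then show ?thesis unfolding Cx aut_val_eq by (intro inner x_closed)
    next
      case Ct
      then show ?thesis unfolding Ct aut_val_eq by (intro inner t_closed)
    next
      case Psi
      show ?thesis unfolding Psi aut_val_eq by (rule generate.incl) blast
    next
      case Iota
      show ?thesis unfolding Iota aut_val_eq by (rule generate.incl) blast
    next
      case (Phi k)
      then have "1 \<le> k" using a by simp
      then show ?thesis unfolding Phi aut_val_eq by (intro generate.incl imageI) blast
    qed
  qed
  ultimately show "carrier (Out G) \<subseteq> generate (Out G) ?S"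
    using Out.generate_subgroup_incl[OF _ Out.generate_is_subgroup[OF sub]] by (simp add: carrier_Out)
qed

text \<open>The exponent \<open>k - 1\<close> undoes the index shift in
  \<open>rat_phi\<close>.\<close>

lemma theta_inr_phi:
  "1 \<le> k \<Longrightarrow> theta (am.inr (out_B_class n (1 / of_int n ^ (k - 1)))) = out_class G (phi k 1)"
proof -
  assume k: "1 \<le> k"
  have r: "(of_int 1 / of_int n ^ (k - 1) :: rat) \<in> carrier (Z_inverting \<bar>n\<bar>)"
    unfolding carrier_Z_inverting_abs by blast
  have "theta (am.inr (out_B_class n (of_int 1 / of_int n ^ (k - 1)))) = out_class G (phi (Suc (k - 1)) 1)"
    using theta(3)[of "out_B_class n (of_int 1 / of_int n ^ (k - 1))"] r
    by (simp only: beta(2) rat_phi carrier_out_B imageI)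
  then show ?thesis using k by simp
qed

lemma one_in_out_A: "1 \<in> carrier (out_A p n)"
proof -
  have "1 * 1 < p * \<bar>n - 1\<bar>" using p_gt order_pos(2) by (intro mult_less_le_imp_less) auto
  then show ?thesis by (simp add: carrier_out_A)
qed

lemma theta_iota_values:
  "theta_iota (am.inl 1, 0) = out_class G (psi 1)"
  "1 \<le> k \<Longrightarrow> theta_iota (am.inr (out_B_class n (1 / of_int n ^ (k - 1))), 0) = out_class G (phi k 1)"
  "theta_iota (\<one>\<^bsub>am.N\<^esub>, 1) = out_class G iota"
  using oc.hom_one theta_inr_phi[of k]
  by (simp_all add: theta_iota_def theta(2)[OF one_in_out_A] out_class_closed)

lemma theta_iota_iso: "theta_iota \<in> iso semi (Out G)"
proof (rule isoI[OF theta_iota_hom])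
  have "inj_on theta_iota (carrier semi)"
  proof (rule inj_onI)
    fix v v' assume vv: "v \<in> carrier semi" "v' \<in> carrier semi" "theta_iota v = theta_iota v'"
    obtain u i where v: "v = (u, i)" "u \<in> carrier am.N" "i = 0 \<or> i = 1" using vv(1) by (auto simp: carrier_semi)
    obtain u' i' where v': "v' = (u', i')" "u' \<in> carrier am.N" "i' = 0 \<or> i' = 1" using vv(2) by (auto simp: carrier_semi)
    define e where "e j = (if j = 0 then \<one>\<^bsub>AutoGroup G\<^esub> else iota)" for j :: int
    have e: "e j \<in> auto G" "e j \<otimes>\<^bsub>AutoGroup G\<^esub> e j = \<one>\<^bsub>AutoGroup G\<^esub>" for j
      using Aut.one_closed Aut.l_one[OF Aut.one_closed] iota_mult by (simp_all add: e_def)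
    have ee: "e i \<otimes>\<^bsub>AutoGroup G\<^esub> e i' \<in> {\<one>\<^bsub>AutoGroup G\<^esub>, iota}"
      using Aut.one_closed Aut.l_one[OF Aut.one_closed] Aut.l_one[of iota] Aut.r_one[of iota] iota_mult
      by (simp add: e_def)
    have eq: "theta u \<otimes>\<^bsub>Out G\<^esub> out_class G (e i) = theta u' \<otimes>\<^bsub>Out G\<^esub> out_class G (e i')"
      using vv(3) by (simp add: v v' theta_iota_def e_def)
    have c: "theta u \<in> carrier (Out G)" "theta u' \<in> carrier (Out G)" "out_class G (e i) \<in> carrier (Out G)"
      "out_class G (e i') \<in> carrier (Out G)"
      using v v' e by (simp_all add: out_class_closed)
    \<comment> \<open>Bringing both sides together gives a trivial product of an element of the
      amalgam and one of \<open>1\<close>, \<open>\<iota>\<close>, to which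
      \<open>theta_kernel\<close> applies; each \<open>e j\<close> is its own inverse.\<close>
    have "theta (inv\<^bsub>am.N\<^esub> u' \<otimes>\<^bsub>am.N\<^esub> u) \<otimes>\<^bsub>Out G\<^esub> out_class G (e i \<otimes>\<^bsub>AutoGroup G\<^esub> e i')
        = inv\<^bsub>Out G\<^esub> theta u' \<otimes>\<^bsub>Out G\<^esub> (theta u \<otimes>\<^bsub>Out G\<^esub> out_class G (e i)) \<otimes>\<^bsub>Out G\<^esub> out_class G (e i')"
      using c v v' e by (simp add: out_class_mult Out.m_assoc)
    also have "\<dots> = out_class G (e i' \<otimes>\<^bsub>AutoGroup G\<^esub> e i')"
      unfolding eq out_class_mult[OF e(1) e(1)] using c by (simp add: Out.m_assoc[symmetric])
    also have "\<dots> = \<one>\<^bsub>Out G\<^esub>" unfolding e(2) by (rule oc.hom_one)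
    finally have t: "theta (inv\<^bsub>am.N\<^esub> u' \<otimes>\<^bsub>am.N\<^esub> u) \<otimes>\<^bsub>Out G\<^esub> out_class G (e i \<otimes>\<^bsub>AutoGroup G\<^esub> e i') = \<one>\<^bsub>Out G\<^esub>" .
    have w: "inv\<^bsub>am.N\<^esub> u' \<otimes>\<^bsub>am.N\<^esub> u \<in> carrier am.N" using v v' by simp
    have 1: "e i \<otimes>\<^bsub>AutoGroup G\<^esub> e i' = \<one>\<^bsub>AutoGroup G\<^esub>" by (rule theta_kernel(1)[OF w ee t])
    have "i = i'"
      using 1 v(3) v'(3) iota_not_one Aut.l_one[of iota] Aut.r_one[of iota] by (auto simp: e_def)
    moreover have "u = u'"
    proof -
      have "u' \<otimes>\<^bsub>am.N\<^esub> (inv\<^bsub>am.N\<^esub> u' \<otimes>\<^bsub>am.N\<^esub> u) = u' \<otimes>\<^bsub>am.N\<^esub> \<one>\<^bsub>am.N\<^esub>"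
        unfolding theta_kernel(2)[OF w ee t] ..
      then show ?thesis using v v' by simp
    qed
    ultimately show "v = v'" by (simp add: v v')
  qed
  moreover have "theta_iota ` carrier semi = carrier (Out G)"
  proof
    show "theta_iota ` carrier semi \<subseteq> carrier (Out G)" using hom_in_carrier[OF theta_iota_hom] by blast
    have m: "y \<otimes>\<^bsub>Out G\<^esub> z \<in> theta_iota ` carrier semi"
      if yz: "y \<in> theta_iota ` carrier semi" "z \<in> theta_iota ` carrier semi" for y z
    proof -
      obtain v w where vw: "v \<in> carrier semi" "w \<in> carrier semi" "y = theta_iota v" "z = theta_iota w"
        using yz by (elim imageE) (rule that)
      have fa: "flip_action i u \<in> carrier am.N" if "u \<in> carrier am.N" for i u
        using that hom_in_carrier[OF flip(1)] by (simp add: flip_action_def N.one_AutoGroup)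
      have "v \<otimes>\<^bsub>semi\<^esub> w \<in> carrier semi"
        using vw(1,2) by (cases v; cases w) (auto simp: carrier_semi mult_semi fa)
      moreover have "theta_iota (v \<otimes>\<^bsub>semi\<^esub> w) = y \<otimes>\<^bsub>Out G\<^esub> z"
        using hom_mult[OF theta_iota_hom vw(1,2)] vw by simp
      ultimately show ?thesis by (metis imageI)
    qed
    have t: "theta u \<in> theta_iota ` carrier semi" if "u \<in> carrier am.N" for u
    proof -
      have "theta_iota (u, 0) = theta u" using that oc.hom_one by (simp add: theta_iota_def)
      moreover have "(u, 0) \<in> carrier semi" using that by (simp add: carrier_semi)
      ultimately show ?thesis by (metis imageI)
    qed
    have ti: "out_class G iota \<in> theta_iota ` carrier semi"
      using theta_iota_values(3) imageI[of "(\<one>\<^bsub>am.N\<^esub>, 1)" "carrier semi" theta_iota] by (simp add: carrier_semi)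
    have ii: "inv\<^bsub>Out G\<^esub> out_class G iota = out_class G iota"
      using oc.hom_inv[of iota] by (simp add: iota_inv)
    have gens: "s \<in> theta_iota ` carrier semi \<and> inv\<^bsub>Out G\<^esub> s \<in> theta_iota ` carrier semi"
      if s: "s \<in> out_class G ` ({psi 1, iota} \<union> {phi k 1 |k. 1 \<le> k})" for s
    proof -
      consider "s = out_class G iota" | u where "u \<in> carrier am.N" "s = theta u"
      proof -
        from s obtain \<alpha> where \<alpha>: "\<alpha> \<in> {psi 1, iota} \<union> {phi k 1 |k. 1 \<le> k}" "s = out_class G \<alpha>"
          by (rule imageE)
        then consider "\<alpha> = psi 1" | "\<alpha> = iota" | k where "1 \<le> k" "\<alpha> = phi k 1"
          by (elim UnE insertE emptyE CollectE exE conjE)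
        then show ?thesis
        proof cases
          case 1
          then have "s = theta (am.inl 1)" by (simp only: \<alpha>(2) theta(2)[OF one_in_out_A])
          then show ?thesis by (rule that(2)[OF am.inl_closed[OF one_in_out_A]])
        next
          case 2
          then show ?thesis by (intro that(1)) (simp only: \<alpha>(2))
        next
          case (3 k)
          have "(of_int 1 / of_int n ^ (k - 1) :: rat) \<in> carrier (Z_inverting \<bar>n\<bar>)"
            unfolding carrier_Z_inverting_abs by blast
          then have "am.inr (out_B_class n (1 / of_int n ^ (k - 1))) \<in> carrier am.N"
            unfolding of_int_1 by (intro am.inr_closed) (simp only: carrier_out_B imageI)
          moreover have "s = theta (am.inr (out_B_class n (1 / of_int n ^ (k - 1))))"
            by (simp only: \<alpha>(2) 3(2) theta_inr_phi[OF 3(1)])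
          ultimately show ?thesis by (rule that(2))
        qed
      qed
      then show ?thesis
      proof cases
        case 1
        then show ?thesis using ti ii by simp
      next
        case (2 u)
        then show ?thesis using t[of u] t[of "inv\<^bsub>am.N\<^esub> u"] by simp
      qed
    qed
    have "y \<in> theta_iota ` carrier semi"
      if "y \<in> generate (Out G) (out_class G ` ({psi 1, iota} \<union> {phi k 1 |k. 1 \<le> k}))" for y
      using that
    proof induction
      case one
      then show ?case using t[OF N.one_closed] by simp
    next
      case (incl s)
      then show ?case using gens by blast
    next
      case (inv s)
      then show ?case using gens by blast
    next
      case (eng y z)
      then show ?case by (intro m)
    qed
    then show "carrier (Out G) \<subseteq> theta_iota ` carrier semi" unfolding generate_Out by (rule subsetI)
  qed
  ultimately show "bij_betw theta_iota (carrier semi) (carrier (Out G))" by (simp add: bij_betw_def)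
qed

end

theorem theorem4p4:
  fixes p n q :: int
  assumes "p > 1" and "\<bar>n\<bar> > 1" and "q = p * n"
  shows
    "generate (AutoGroup (BS p q)) (aut_val p q ` aut_gens) = carrier (AutoGroup (BS p q)) \<and>
     has_presentation (AutoGroup (BS p q)) aut_gens (aut_rels p n q) (aut_val p q) \<and>
     out_f p \<in> mon (out_C n) (out_A p n) \<and>
     out_g n \<in> mon (out_C n) (out_B n) \<and>
     (\<exists>\<alpha> \<theta>. inverting_action p n \<alpha> \<and>
        \<theta> \<in> iso (semidirect (out_N p n) (integer_mod_group 2) \<alpha>) (Out (BS p q)) \<and>
        \<theta> (out_inl p n 1, 0) = out_class (BS p q) (BS_psi p q) \<and>
        (\<forall>k\<ge>1. \<theta> (out_inr p n (out_B_class n (1 / of_int n ^ (k - 1))), 0)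
                 = out_class (BS p q) (BS_phi p q k)) \<and>
        \<theta> (\<one>\<^bsub>out_N p n\<^esub>, 1) = out_class (BS p q) (BS_iota p q)) \<and>
     generate (Out (BS p q))
        (out_class (BS p q) ` ({BS_psi p q, BS_iota p q} \<union> {BS_phi p q k |k. 1 \<le> k}))
       = carrier (Out (BS p q))"
proof -
  interpret bs "BS p q" p n q "BS_x p q" "BS_t p q"
    using assms by (intro bs.intro bs_axioms.intro) (simp_all add: BS_def group_presented_group)
  have vals: "BS_psi p q = psi 1" "BS_iota p q = iota" "BS_phi p q k = phi k 1" for k
    using aut_val_eq(3-5) by simp_all
  show ?thesis
    unfolding vals out_N_eq out_inl_eq out_inr_eq
    using aut_span_eq has_presentation_auto out_f_mon out_g_mon inverting_action_flip
      theta_iota_iso theta_iota_values generate_Out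
    by (intro conjI exI[of _ flip_action] exI[of _ theta_iota] allI impI)
      (simp_all only: aut_span_def carrier_AutoGroup)
qed

end
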